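(* The functor $|\cdot|\colon\mathbb{U}^{\mathrm{op}}\to\mathbb{F}_*$, taking a connected undirected graph $G$ to its set of vertices with a disjoint base point $V(G)_+$, is a morphism of algebraic patterns $\mathbb{U}^{\mathrm{op},\natural}\to\mathbb{F}_*^{\natural}$, and exhibits $\mathbb{U}^{\mathrm{op},\natural}$ as an enrichable pattern.
   Context: Patterns. An algebraic pattern is an $\infty$-category $\mathcal{O}$ with a factorization system in which each map factors as an inert map followed by an active map, together with a full subcategory $\mathcal{O}^{\mathrm{el}} \subseteq \mathcal{O}^{\mathrm{int}}$ of elementary objects, where $\mathcal{O}^{\mathrm{int}}$ is the wide subcategory of inert maps. A morphism of patterns is a functor preserving inert maps, active maps and elementary objects. Set $\mathcal{O}^{\mathrm{el}}_{O/} := \mathcal{O}^{\mathrm{el}}\times_{\mathcal{O}^{\mathrm{int}}}\mathcal{O}^{\mathrm{int}}_{O/}$. $\mathbb{F}_*$ is the category of finite pointed sets; a map is inert if it is an isomorphism away from the base point, active if only the base point is sent to the base point. $\mathbb{F}_*^{\flat}$ has $\langle 1\rangle=(\{0,1\},0)$ as only elementary object, $\mathbb{F}_*^{\natural}$ has elementary objects $\langle 0\rangle=(\{0\},0)$ and $\langle 1\rangle$. A cartesian pattern is a pattern with a morphism of patterns $|\cdot|\colon\mathcal{O}\to\mathbb{F}_*^{\flat}$ such that $\mathcal{O}^{\mathrm{el}}_{O/}\to(\mathbb{F}_*^{\flat})^{\mathrm{el}}_{|O|/}$ is an equivalence for all $O$. An enrichable pattern is a pattern $\mathcal{O}$ with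 a morphism of patterns to $\mathbb{F}_*^{\natural}$ such that $\mathcal{O}^{\flat}$ (the same factorization system, with only those elementary objects over $\langle 1\rangle$) is a cartesian pattern. Graphs. An undirected graph $G$ consists of finite sets $A(G)$ (arcs), $D(G)\hookrightarrow A(G)$, $V(G)$ (vertices), a fixed-point-free involution $\dagger$ on $A(G)$ and a map $t\colon D(G)\to V(G)$. Its boundary is $\partial(G)=A(G)\setminus D(G)$; its edges $E(G)$ are the $\dagger$-orbits $\{a,a^\dagger\}$. $G$ is connected if its geometric realization is, i.e. the equivalence relation on $A(G)\amalg V(G)$ generated by $a\sim a^\dagger$ and $d\sim t(d)$ (for $d\in D(G)$) has exactly one class. The edge $\eta$ has $A=\{1,2\}$ swapped by $\dagger$, $D=V=\emptyset$. The $n$-star $\star_n$ has $A=\mathbf{n}\amalg\mathbf{n}$ with $\dagger$ swapping the copies, $D=\mathbf{n}$ one copy, and one vertex. An embedding $G'\to G$ of connected graphs is a triple of maps $A(G')\to A(G)$, $D(G')\to D(G)$, $V(G')\to V(G)$ commuting with the structure maps, such that $D(G')\cong D(G)\times_{V(G)}V(G')$, the map on arcs commutes with $\dagger$, and $V(G')\to V(G)$ is injective. $\mathrm{Emb}(G)$ is the set of isomorphism classes of embeddings of connected graphs into $G$. $E(G)$ is identified with the embeddings of $\eta$ and $V(G)$ with the embeddings of stars $\star_n$, $n\ge0$; so $E(G),V(G)\hookrightarrow\mathrm{Emb}(G)$. For $h\colon H\to G$ in $\mathrm{Emb}(G)$ write $V_h\subseteq V(G)$ for the image of $V(H)$, and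 $\partial(h)\subseteq A(G)$ for the image of $\partial(H)$ (the map $\partial(H)\to A(G)$ is injective). Two embeddings $h,k$ are vertex disjoint if $V_h\cap V_k=\emptyset$. An embedding $\ell\colon L\to G$ is a union of $h\colon H\to G$ and $k\colon K\to G$ if $h,k$ factor through $\ell$ by embeddings $H\to L\leftarrow K$ that are jointly surjective on arcs and on vertices. A graph map $\phi\colon G\to G'$ between connected graphs is a pair of a function $\phi_0\colon A(G)\to A(G')$ with $\phi_0\dagger=\dagger\phi_0$ and a function $\hat\phi\colon\mathrm{Emb}(G)\to\mathrm{Emb}(G')$ such that $\hat\phi$ sends edges to edges, preserves unions (if $\ell$ is a union of $h,k$ then $\hat\phi(\ell)$ is a union of $\hat\phi(h),\hat\phi(k)$), sends vertex disjoint pairs to vertex disjoint pairs, and is boundary-compatible: for every $h\in\mathrm{Emb}(G)$, $\phi_0$ restricts to a bijection $\partial(h)\to\partial(\hat\phi(h))$. $\mathbb{U}$ is the category of connected undirected graphs and graph maps. A graph map is active if $\hat\phi(\mathrm{id}_G)=\mathrm{id}_{G'}$, and inert if $V(G)\hookrightarrow\mathrm{Emb}(G)\xrightarrow{\hat\phi}\mathrm{Emb}(G')$ factors through $V(G')$; inert maps $G\to G'$ correspond to embeddings. These form a factorization system on $\mathbb{U}$ (active followed by inert), and $\mathbb{U}^{\mathrm{op},\natural}$ is the pattern on $\mathbb{U}^{\mathrm{op}}$ with the induced inert–active factorization system and elementary objects $\eta$ and $\star_n$, $n\geq0$. The functor $|\cdot|$. On objects $|G|=V(G)_+$. For a graph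 map $\phi\colon G'\to G$, $|\phi|\colon V(G)_+\to V(G')_+$ sends $v\in V(G)$ to $w\in V(G')$ if $v\in V_{\hat\phi(w)}\subseteq V(G)$, and to the base point if there is no such $w$. *)

theory Defs
  imports Main "HOL-Library.FuncSet"
begin

text \<open>
  Both categories involved are ordinary categories, so the notions of the theory of algebraic
  patterns are stated for ordinary categories. A category has a set of objects and a set of
  arrows; arrows know their source and target, and \<open>Cmp C g f\<close> is \<open>g\<close> after \<open>f\<close>.
\<close>

section \<open>Categories\<close>

record ('o, 'm) cat =
  Obj :: "'o set"
  Arr :: "'m set"
  Src :: "'m \<Rightarrow> 'o"
  Tgt :: "'m \<Rightarrow> 'o"
  Idn :: "'o \<Rightarrow> 'm"
  Cmp :: "'m \<Rightarrow> 'm \<Rightarrow> 'm"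

definition is_category :: "('o, 'm, 'z) cat_scheme \<Rightarrow> bool" where
  "is_category C \<longleftrightarrow>
     (\<forall>f\<in>Arr C. Src C f \<in> Obj C \<and> Tgt C f \<in> Obj C) \<and>
     (\<forall>x\<in>Obj C. Idn C x \<in> Arr C \<and> Src C (Idn C x) = x \<and> Tgt C (Idn C x) = x) \<and>
     (\<forall>f\<in>Arr C. \<forall>g\<in>Arr C. Tgt C f = Src C g \<longrightarrow>
        Cmp C g f \<in> Arr C \<and> Src C (Cmp C g f) = Src C f \<and> Tgt C (Cmp C g f) = Tgt C g) \<and>
     (\<forall>f\<in>Arr C. Cmp C f (Idn C (Src C f)) = f \<and> Cmp C (Idn C (Tgt C f)) f = f) \<and>
     (\<forall>f\<in>Arr C. \<forall>g\<in>Arr C. \<forall>h\<in>Arr C. Tgt C f = Src C g \<longrightarrow> Tgt C g = Src C h \<longrightarrow>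
        Cmp C h (Cmp C g f) = Cmp C (Cmp C h g) f)"

definition is_iso :: "('o, 'm, 'z) cat_scheme \<Rightarrow> 'm \<Rightarrow> bool" where
  "is_iso C f \<longleftrightarrow> f \<in> Arr C \<and>
     (\<exists>g\<in>Arr C. Src C g = Tgt C f \<and> Tgt C g = Src C f \<and>
        Cmp C g f = Idn C (Src C f) \<and> Cmp C f g = Idn C (Tgt C f))"

definition isomorphic :: "('o, 'm, 'z) cat_scheme \<Rightarrow> 'o \<Rightarrow> 'o \<Rightarrow> bool" where
  "isomorphic C x y \<longleftrightarrow> (\<exists>f. is_iso C f \<and> Src C f = x \<and> Tgt C f = y)"

definition iso_closure :: "('o, 'm, 'z) cat_scheme \<Rightarrow> 'o set \<Rightarrow> 'o set" where
  "iso_closure C S = {x \<in> Obj C. \<exists>s\<in>S. isomorphic C x s}"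

definition op_cat :: "('o, 'm) cat \<Rightarrow> ('o, 'm) cat" where
  "op_cat C = \<lparr>Obj = Obj C, Arr = Arr C, Src = Tgt C, Tgt = Src C, Idn = Idn C,
     Cmp = (\<lambda>g f. Cmp C f g)\<rparr>"

definition full_subcat :: "('o, 'm) cat \<Rightarrow> 'o set \<Rightarrow> ('o, 'm) cat" where
  "full_subcat C S = C\<lparr>Obj := Obj C \<inter> S,
     Arr := {f \<in> Arr C. Src C f \<in> S \<and> Tgt C f \<in> S}\<rparr>"

text \<open>
  In the category under \<open>x\<close> the triple \<open>(f, g, f')\<close> is the arrow given by \<open>g\<close> from the
  object \<open>f\<close> to the object \<open>f' = g f\<close>.
\<close>

definition under_cat :: "('o, 'm) cat \<Rightarrow> 'o \<Rightarrow> ('m, 'm \<times> 'm \<times> 'm) cat" where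
  "under_cat C x =
     \<lparr>Obj = {f \<in> Arr C. Src C f = x},
      Arr = {(f, g, f'). f \<in> Arr C \<and> g \<in> Arr C \<and> f' \<in> Arr C \<and> Src C f = x \<and>
               Tgt C f = Src C g \<and> f' = Cmp C g f},
      Src = (\<lambda>(f, g, f'). f),
      Tgt = (\<lambda>(f, g, f'). f'),
      Idn = (\<lambda>f. (f, Idn C (Tgt C f), f)),
      Cmp = (\<lambda>(f', h, f'') (f, g, _). (f, Cmp C h g, f''))\<rparr>"

record ('o, 'm, 'p, 'n) fctr =
  FOb :: "'o \<Rightarrow> 'p"
  FAr :: "'m \<Rightarrow> 'n"

definition is_functor ::
  "('o, 'm, 'y) cat_scheme \<Rightarrow> ('p, 'n, 'z) cat_scheme \<Rightarrow> ('o, 'm, 'p, 'n) fctr \<Rightarrow> bool" where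
  "is_functor C D F \<longleftrightarrow> is_category C \<and> is_category D \<and>
     (\<forall>x\<in>Obj C. FOb F x \<in> Obj D \<and> FAr F (Idn C x) = Idn D (FOb F x)) \<and>
     (\<forall>f\<in>Arr C. FAr F f \<in> Arr D \<and>
        Src D (FAr F f) = FOb F (Src C f) \<and> Tgt D (FAr F f) = FOb F (Tgt C f)) \<and>
     (\<forall>f\<in>Arr C. \<forall>g\<in>Arr C. Tgt C f = Src C g \<longrightarrow>
        FAr F (Cmp C g f) = Cmp D (FAr F g) (FAr F f))"

definition id_fctr :: "('o, 'm, 'o, 'm) fctr" where
  "id_fctr = \<lparr>FOb = (\<lambda>x. x), FAr = (\<lambda>f. f)\<rparr>"

definition comp_fctr ::
  "('p, 'n, 'q, 'k) fctr \<Rightarrow> ('o, 'm, 'p, 'n) fctr \<Rightarrow> ('o, 'm, 'q, 'k) fctr" where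
  "comp_fctr G F = \<lparr>FOb = (\<lambda>x. FOb G (FOb F x)), FAr = (\<lambda>f. FAr G (FAr F f))\<rparr>"

definition is_nat_iso ::
  "('o, 'm, 'y) cat_scheme \<Rightarrow> ('p, 'n, 'z) cat_scheme \<Rightarrow>
   ('o, 'm, 'p, 'n) fctr \<Rightarrow> ('o, 'm, 'p, 'n) fctr \<Rightarrow> ('o \<Rightarrow> 'n) \<Rightarrow> bool" where
  "is_nat_iso C D F G \<tau> \<longleftrightarrow>
     (\<forall>x\<in>Obj C. is_iso D (\<tau> x) \<and> Src D (\<tau> x) = FOb F x \<and> Tgt D (\<tau> x) = FOb G x) \<and>
     (\<forall>f\<in>Arr C. Cmp D (\<tau> (Tgt C f)) (FAr F f) = Cmp D (FAr G f) (\<tau> (Src C f)))"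

definition is_equivalence ::
  "('o, 'm, 'y) cat_scheme \<Rightarrow> ('p, 'n, 'z) cat_scheme \<Rightarrow> ('o, 'm, 'p, 'n) fctr \<Rightarrow> bool" where
  "is_equivalence C D F \<longleftrightarrow> is_functor C D F \<and>
     (\<exists>G. is_functor D C G \<and>
        (\<exists>\<tau>. is_nat_iso C C id_fctr (comp_fctr G F) \<tau>) \<and>
        (\<exists>\<sigma>. is_nat_iso D D (comp_fctr F G) id_fctr \<sigma>))"


section \<open>Algebraic patterns\<close>

definition wide_subclass :: "('o, 'm, 'z) cat_scheme \<Rightarrow> 'm set \<Rightarrow> bool" where
  "wide_subclass C W \<longleftrightarrow> W \<subseteq> Arr C \<and> (\<forall>f. is_iso C f \<longrightarrow> f \<in> W) \<and>
     (\<forall>f\<in>W. \<forall>g\<in>W. Tgt C f = Src C g \<longrightarrow> Cmp C g f \<in> W)"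

text \<open>
  Every arrow factors as an arrow of \<open>L\<close> followed by an arrow of \<open>R\<close>, and any two such
  factorizations are related by a unique isomorphism: the groupoid of factorizations is
  contractible.
\<close>

definition factorization_system :: "('o, 'm, 'z) cat_scheme \<Rightarrow> 'm set \<Rightarrow> 'm set \<Rightarrow> bool" where
  "factorization_system C L R \<longleftrightarrow> wide_subclass C L \<and> wide_subclass C R \<and>
     (\<forall>f\<in>Arr C. \<exists>l\<in>L. \<exists>r\<in>R. Tgt C l = Src C r \<and> Cmp C r l = f) \<and>
     (\<forall>l\<in>L. \<forall>r\<in>R. \<forall>l'\<in>L. \<forall>r'\<in>R.
        Tgt C l = Src C r \<longrightarrow> Tgt C l' = Src C r' \<longrightarrow> Src C l = Src C l' \<longrightarrow> Tgt C r = Tgt C r' \<longrightarrow>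
        Cmp C r l = Cmp C r' l' \<longrightarrow>
        (\<exists>!i. is_iso C i \<and> Src C i = Tgt C l \<and> Tgt C i = Tgt C l' \<and>
              Cmp C i l = l' \<and> Cmp C r' i = r))"

record ('o, 'm) pattern = "('o, 'm) cat" +
  Inert :: "'m set"
  Active :: "'m set"
  Elem :: "'o set"

text \<open>
  A full subcategory of an \<open>\<infinity>\<close>-category is closed under equivalence; correspondingly the
  elementary objects form an isomorphism-closed set of objects. The isomorphisms of the inert
  subcategory are those of the whole category.
\<close>

definition is_pattern :: "('o, 'm) pattern \<Rightarrow> bool" where
  "is_pattern P \<longleftrightarrow> is_category P \<and> factorization_system P (Inert P) (Active P) \<and>
     Elem P \<subseteq> Obj P \<and> (\<forall>x\<in>Elem P. \<forall>y. isomorphic P x y \<longrightarrow> y \<in> Elem P)"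

definition make_pattern :: "('o, 'm) cat \<Rightarrow> 'm set \<Rightarrow> 'm set \<Rightarrow> 'o set \<Rightarrow> ('o, 'm) pattern" where
  "make_pattern C I A S = \<lparr>Obj = Obj C, Arr = Arr C, Src = Src C, Tgt = Tgt C, Idn = Idn C,
     Cmp = Cmp C, Inert = I, Active = A, Elem = iso_closure C S\<rparr>"

definition pattern_morphism ::
  "('o, 'm) pattern \<Rightarrow> ('p, 'n) pattern \<Rightarrow> ('o, 'm, 'p, 'n) fctr \<Rightarrow> bool" where
  "pattern_morphism P Q F \<longleftrightarrow> is_pattern P \<and> is_pattern Q \<and> is_functor P Q F \<and>
     (\<forall>f\<in>Inert P. FAr F f \<in> Inert Q) \<and>
     (\<forall>f\<in>Active P. FAr F f \<in> Active Q) \<and>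
     (\<forall>x\<in>Elem P. FOb F x \<in> Elem Q)"

definition inert_cat :: "('o, 'm) pattern \<Rightarrow> ('o, 'm) cat" where
  "inert_cat P = \<lparr>Obj = Obj P, Arr = Inert P, Src = Src P, Tgt = Tgt P, Idn = Idn P,
     Cmp = Cmp P\<rparr>"

text \<open>
  Since the elementary objects span a full subcategory of the inert subcategory, the fibre product
  defining the category of elementary objects under \<open>x\<close> is a full subcategory of the category of
  inert arrows under \<open>x\<close>.
\<close>

definition el_under :: "('o, 'm) pattern \<Rightarrow> 'o \<Rightarrow> ('m, 'm \<times> 'm \<times> 'm) cat" where
  "el_under P x = full_subcat (under_cat (inert_cat P) x) {f. Tgt P f \<in> Elem P}"

definition under_fctr ::
  "('o, 'm, 'p, 'n) fctr \<Rightarrow> ('m, 'm \<times> 'm \<times> 'm, 'n, 'n \<times> 'n \<times> 'n) fctr" where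
  "under_fctr F = \<lparr>FOb = FAr F, FAr = (\<lambda>(f, g, f'). (FAr F f, FAr F g, FAr F f'))\<rparr>"


section \<open>Finite pointed sets\<close>

text \<open>
  The underlying sets are finite sets of elements of \<^typ>\<open>nat option\<close>, with an arbitrary
  element as base point; an arrow is a triple of source, target and map.
\<close>

type_synonym pset = "nat option set \<times> nat option"
type_synonym pmap = "pset \<times> pset \<times> (nat option \<Rightarrow> nat option)"

definition FinPt :: "(pset, pmap) cat" where
  "FinPt =
     \<lparr>Obj = {(X, x). finite X \<and> x \<in> X},
      Arr = {((X, x), (Y, y), f). finite X \<and> x \<in> X \<and> finite Y \<and> y \<in> Y \<and>
               f \<in> X \<rightarrow>\<^sub>E Y \<and> f x = y},
      Src = (\<lambda>(P, Q, f). P),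
      Tgt = (\<lambda>(P, Q, f). Q),
      Idn = (\<lambda>P. (P, P, \<lambda>a\<in>fst P. a)),
      Cmp = (\<lambda>(_, R, g) (P, _, f). (P, R, compose (fst P) g f))\<rparr>"

definition FinPt_inert :: "pmap set" where
  "FinPt_inert = {((X, x), (Y, y), f). ((X, x), (Y, y), f) \<in> Arr FinPt \<and>
     bij_betw f {a \<in> X. f a \<noteq> y} (Y - {y})}"

definition FinPt_active :: "pmap set" where
  "FinPt_active = {((X, x), (Y, y), f). ((X, x), (Y, y), f) \<in> Arr FinPt \<and>
     {a \<in> X. f a = y} = {x}}"

definition std_pset :: "nat \<Rightarrow> pset" where
  "std_pset n = (insert None (Some ` {1..n}), None)"

definition FinPt_flat :: "(pset, pmap) pattern" where
  "FinPt_flat = make_pattern FinPt FinPt_inert FinPt_active {std_pset 1}"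

definition FinPt_natural :: "(pset, pmap) pattern" where
  "FinPt_natural = make_pattern FinPt FinPt_inert FinPt_active {std_pset 0, std_pset 1}"


section \<open>Cartesian and enrichable patterns\<close>

definition cartesian_pattern :: "('o, 'm) pattern \<Rightarrow> ('o, 'm, pset, pmap) fctr \<Rightarrow> bool" where
  "cartesian_pattern P F \<longleftrightarrow> is_pattern P \<and> pattern_morphism P FinPt_flat F \<and>
     (\<forall>x\<in>Obj P. is_equivalence (el_under P x) (el_under FinPt_flat (FOb F x)) (under_fctr F))"

definition flat_pattern ::
  "('o, 'm) pattern \<Rightarrow> ('o, 'm, pset, pmap) fctr \<Rightarrow> ('o, 'm) pattern" where
  "flat_pattern P F = P\<lparr>Elem := {x \<in> Elem P. isomorphic FinPt (FOb F x) (std_pset 1)}\<rparr>"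

definition enrichable_pattern :: "('o, 'm) pattern \<Rightarrow> ('o, 'm, pset, pmap) fctr \<Rightarrow> bool" where
  "enrichable_pattern P F \<longleftrightarrow> is_pattern P \<and> pattern_morphism P FinPt_natural F \<and>
     cartesian_pattern (flat_pattern P F) F"


section \<open>Undirected graphs and embeddings\<close>

text \<open>
  Arcs and vertices are natural numbers, which covers every finite graph up to isomorphism. Maps
  are extensional, so that each graph and each map has exactly one representation.
\<close>

record graph =
  Arcs :: "nat set"
  Darts :: "nat set"
  Verts :: "nat set"
  dag :: "nat \<Rightarrow> nat"
  att :: "nat \<Rightarrow> nat"

definition is_graph :: "graph \<Rightarrow> bool" where
  "is_graph G \<longleftrightarrow> finite (Arcs G) \<and> finite (Verts G) \<and> Darts G \<subseteq> Arcs G \<and>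
     dag G \<in> Arcs G \<rightarrow>\<^sub>E Arcs G \<and> (\<forall>a\<in>Arcs G. dag G (dag G a) = a \<and> dag G a \<noteq> a) \<and>
     att G \<in> Darts G \<rightarrow>\<^sub>E Verts G"

definition graph_boundary :: "graph \<Rightarrow> nat set" where
  "graph_boundary G = Arcs G - Darts G"

definition incidence :: "graph \<Rightarrow> ((nat + nat) \<times> (nat + nat)) set" where
  "incidence G = {(Inl a, Inl (dag G a)) |a. a \<in> Arcs G} \<union>
     {(Inl d, Inr (att G d)) |d. d \<in> Darts G}"

definition connected_graph :: "graph \<Rightarrow> bool" where
  "connected_graph G \<longleftrightarrow> is_graph G \<and>
     card ((Arcs G <+> Verts G) // (incidence G \<union> (incidence G)\<inverse>)\<^sup>*) = 1"

definition edge_graph :: graph where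
  "edge_graph = \<lparr>Arcs = {1, 2}, Darts = {}, Verts = {}, dag = (\<lambda>a\<in>{1, 2}. 3 - a),
     att = (\<lambda>d\<in>{}. 0)\<rparr>"

definition star_graph :: "nat \<Rightarrow> graph" where
  "star_graph n = \<lparr>Arcs = {..<n + n}, Darts = {..<n}, Verts = {0},
     dag = (\<lambda>a\<in>{..<n + n}. if a < n then a + n else a - n),
     att = (\<lambda>d\<in>{..<n}. 0)\<rparr>"

record emb =
  edom :: graph
  earc :: "nat \<Rightarrow> nat"
  evert :: "nat \<Rightarrow> nat"

definition is_embedding :: "graph \<Rightarrow> emb \<Rightarrow> bool" where
  "is_embedding G h \<longleftrightarrow> connected_graph (edom h) \<and> connected_graph G \<and>
     earc h \<in> Arcs (edom h) \<rightarrow>\<^sub>E Arcs G \<and> evert h \<in> Verts (edom h) \<rightarrow>\<^sub>E Verts G \<and>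
     (\<forall>a\<in>Arcs (edom h). earc h (dag (edom h) a) = dag G (earc h a)) \<and>
     (\<forall>d\<in>Darts (edom h). earc h d \<in> Darts G \<and> evert h (att (edom h) d) = att G (earc h d)) \<and>
     bij_betw (\<lambda>d. (earc h d, att (edom h) d)) (Darts (edom h))
       {(d, v). d \<in> Darts G \<and> v \<in> Verts (edom h) \<and> att G d = evert h v} \<and>
     inj_on (evert h) (Verts (edom h))"

definition factors_by :: "emb \<Rightarrow> emb \<Rightarrow> emb \<Rightarrow> bool" where
  "factors_by l h i \<longleftrightarrow> is_embedding (edom l) i \<and> edom i = edom h \<and>
     (\<forall>a\<in>Arcs (edom h). earc l (earc i a) = earc h a) \<and>
     (\<forall>v\<in>Verts (edom h). evert l (evert i v) = evert h v)"

definition emb_iso :: "graph \<Rightarrow> (emb \<times> emb) set" where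
  "emb_iso G = {(h, k). is_embedding G h \<and> is_embedding G k \<and>
     (\<exists>i. factors_by k h i \<and> bij_betw (earc i) (Arcs (edom h)) (Arcs (edom k)) \<and>
        bij_betw (evert i) (Verts (edom h)) (Verts (edom k)))}"

definition Emb :: "graph \<Rightarrow> emb set set" where
  "Emb G = {h. is_embedding G h} // emb_iso G"

definition id_emb :: "graph \<Rightarrow> emb set" where
  "id_emb G = emb_iso G `` {\<lparr>edom = G, earc = (\<lambda>a\<in>Arcs G. a), evert = (\<lambda>v\<in>Verts G. v)\<rparr>}"

definition edge_embs :: "graph \<Rightarrow> emb set set" where
  "edge_embs G = {x \<in> Emb G. \<exists>h\<in>x. edom h = edge_graph}"

definition star_embs :: "graph \<Rightarrow> emb set set" where
  "star_embs G = {x \<in> Emb G. \<exists>h\<in>x. \<exists>n. edom h = star_graph n}"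

text \<open>
  In the next two definitions and in \<open>is_union\<close> the choice of representatives does not matter:
  all members of a class give the same images.
\<close>

definition emb_verts :: "emb set \<Rightarrow> nat set" where
  "emb_verts x = (\<Union>h\<in>x. evert h ` Verts (edom h))"

definition emb_boundary :: "emb set \<Rightarrow> nat set" where
  "emb_boundary x = (\<Union>h\<in>x. earc h ` graph_boundary (edom h))"

text \<open>The inclusion of the vertices of \<open>G\<close> into \<open>Emb G\<close>.\<close>

definition vert_emb :: "graph \<Rightarrow> nat \<Rightarrow> emb set" where
  "vert_emb G v = (THE x. x \<in> star_embs G \<and> emb_verts x = {v})"

definition is_union :: "emb set \<Rightarrow> emb set \<Rightarrow> emb set \<Rightarrow> bool" where
  "is_union x y z \<longleftrightarrow> (\<exists>l\<in>x. \<exists>h\<in>y. \<exists>k\<in>z. \<exists>i j. factors_by l h i \<and> factors_by l k j \<and>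
     earc i ` Arcs (edom h) \<union> earc j ` Arcs (edom k) = Arcs (edom l) \<and>
     evert i ` Verts (edom h) \<union> evert j ` Verts (edom k) = Verts (edom l))"


section \<open>The category of connected undirected graphs\<close>

record graph_map =
  gsrc :: graph
  gtgt :: graph
  garc :: "nat \<Rightarrow> nat"
  gemb :: "emb set \<Rightarrow> emb set"

definition is_graph_map :: "graph_map \<Rightarrow> bool" where
  "is_graph_map \<phi> \<longleftrightarrow> connected_graph (gsrc \<phi>) \<and> connected_graph (gtgt \<phi>) \<and>
     garc \<phi> \<in> Arcs (gsrc \<phi>) \<rightarrow>\<^sub>E Arcs (gtgt \<phi>) \<and>
     (\<forall>a\<in>Arcs (gsrc \<phi>). garc \<phi> (dag (gsrc \<phi>) a) = dag (gtgt \<phi>) (garc \<phi> a)) \<and>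
     gemb \<phi> \<in> Emb (gsrc \<phi>) \<rightarrow>\<^sub>E Emb (gtgt \<phi>) \<and>
     (\<forall>x\<in>edge_embs (gsrc \<phi>). gemb \<phi> x \<in> edge_embs (gtgt \<phi>)) \<and>
     (\<forall>x\<in>Emb (gsrc \<phi>). \<forall>y\<in>Emb (gsrc \<phi>). \<forall>z\<in>Emb (gsrc \<phi>).
        is_union x y z \<longrightarrow> is_union (gemb \<phi> x) (gemb \<phi> y) (gemb \<phi> z)) \<and>
     (\<forall>x\<in>Emb (gsrc \<phi>). \<forall>y\<in>Emb (gsrc \<phi>). emb_verts x \<inter> emb_verts y = {} \<longrightarrow>
        emb_verts (gemb \<phi> x) \<inter> emb_verts (gemb \<phi> y) = {}) \<and>
     (\<forall>x\<in>Emb (gsrc \<phi>). bij_betw (garc \<phi>) (emb_boundary x) (emb_boundary (gemb \<phi> x)))"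

definition U_cat :: "(graph, graph_map) cat" where
  "U_cat =
     \<lparr>Obj = {G. connected_graph G},
      Arr = {\<phi>. is_graph_map \<phi>},
      Src = gsrc,
      Tgt = gtgt,
      Idn = (\<lambda>G. \<lparr>gsrc = G, gtgt = G, garc = (\<lambda>a\<in>Arcs G. a), gemb = (\<lambda>x\<in>Emb G. x)\<rparr>),
      Cmp = (\<lambda>\<psi> \<phi>. \<lparr>gsrc = gsrc \<phi>, gtgt = gtgt \<psi>,
               garc = compose (Arcs (gsrc \<phi>)) (garc \<psi>) (garc \<phi>),
               gemb = compose (Emb (gsrc \<phi>)) (gemb \<psi>) (gemb \<phi>)\<rparr>)\<rparr>"

definition U_active :: "graph_map set" where
  "U_active = {\<phi>. is_graph_map \<phi> \<and> gemb \<phi> (id_emb (gsrc \<phi>)) = id_emb (gtgt \<phi>)}"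

definition U_inert :: "graph_map set" where
  "U_inert = {\<phi>. is_graph_map \<phi> \<and>
     (\<forall>v\<in>Verts (gsrc \<phi>). gemb \<phi> (vert_emb (gsrc \<phi>) v) \<in> vert_emb (gtgt \<phi>) ` Verts (gtgt \<phi>))}"

definition Uop_natural :: "(graph, graph_map) pattern" where
  "Uop_natural =
     make_pattern (op_cat U_cat) U_inert U_active (insert edge_graph (range star_graph))"

definition verts_plus :: "graph \<Rightarrow> pset" where
  "verts_plus G = (insert None (Some ` Verts G), None)"

definition verts_map :: "graph_map \<Rightarrow> nat option \<Rightarrow> nat option" where
  "verts_map \<phi> = (\<lambda>p\<in>fst (verts_plus (gtgt \<phi>)). case p of None \<Rightarrow> None | Some v \<Rightarrow>
     (if \<exists>w\<in>Verts (gsrc \<phi>). v \<in> emb_verts (gemb \<phi> (vert_emb (gsrc \<phi>) w))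
      then Some (THE w. w \<in> Verts (gsrc \<phi>) \<and> v \<in> emb_verts (gemb \<phi> (vert_emb (gsrc \<phi>) w)))
      else None))"

definition vertex_functor :: "(graph, graph_map, pset, pmap) fctr" where
  "vertex_functor = \<lparr>FOb = verts_plus,
     FAr = (\<lambda>\<phi>. (verts_plus (gtgt \<phi>), verts_plus (gsrc \<phi>), verts_map \<phi>))\<rparr>"

end

theory Submission
  imports Defs
begin

text \<open>
  An embedding \<open>h\<close> into a connected graph \<open>G\<close> is determined up to isomorphism by two sets: the set
  \<open>V\<close> of vertices in its image and the set \<open>B\<close> of arcs hit by its boundary. Indeed the darts of the
  domain are the darts of \<open>G\<close> at \<open>V\<close>, the remaining arcs are the boundary, and both inject into the
  arcs of \<open>G\<close>. If \<open>V\<close> is empty the embedding is an edge; otherwise \<open>B\<close> only records which of the edges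
  between vertices of \<open>V\<close> are cut open, and any such choice that leaves \<open>V\<close> connected occurs
  (\<open>region_realize\<close>). Factoring \<open>h\<close> through \<open>l\<close> means that \<open>V\<close> grows and that whatever \<open>l\<close> cuts is
  already cut by \<open>h\<close> (\<open>factors_iff_pair_le\<close>), and a union of \<open>h\<close> and \<open>k\<close> is an upper bound whose vertices
  are those of \<open>h\<close> and \<open>k\<close> (\<open>is_union_iff\<close>). So preservation of unions is monotonicity together with
  additivity on vertices, and a graph map is the same as its effect on arcs together with a family of
  disjoint vertex sets, one for each vertex of the source (\<open>graph_map_verts\<close>, \<open>graph_map_ext\<close>,
  \<open>graph_mapI\<close>).

  The factorization of \<open>\<phi>\<close> from \<open>G\<close> to \<open>G'\<close> is forced: if \<open>h\<close> represents the image of the identity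
  embedding, then the inert part is \<open>h\<close> itself and the active part is a lift of \<open>\<phi>\<close> along \<open>h\<close>.
  As \<open>h\<close> is injective on vertices, on darts and on the boundary, the only ambiguity is in an arc of
  \<open>G'\<close> that is hit both by a dart and by a boundary arc, which happens where \<open>h\<close> glues two of its ends.
  The following notion resolves it. An arc \<open>a\<close> of \<open>G\<close> is live if it lies on the boundary of an
  embedding that \<open>\<phi>\<close> does not collapse to an edge; boundary compatibility then forces the opposite
  arc to lift to a dart. Cutting \<open>G\<close> at an edge divides its vertices into at most two sides, and a
  vertex that is not collapsed lies on one of them, so that one of the two arcs of every edge is live
  unless \<open>\<phi>\<close> collapses all of \<open>G\<close> (\<open>live_cases\<close>). This determines the lift, and the locale
  \<open>active_lift\<close> shows that it is a graph map. The same forcing shows that inert maps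
  can be cancelled on the left of active ones (\<open>ginert_cancel\<close>), and all uniqueness statements follow.

  The vertex functor sends inert maps to inert maps since these carry vertices injectively to
  vertices, and active maps to active maps since the vertex sets attached to the vertices of the
  source then cover the target. For the cartesian condition both categories of elementary
  objects under an object are equivalent to the discrete set of vertices: an inert map out of a star is the same as a
  vertex, two of them with the same vertex differ by an isomorphism, and by cancellation there is
  only one arrow between them (\<open>thin_equivalence\<close>, \<open>Uflat_el_equivalence\<close>).
\<close>

section \<open>Connected graphs\<close>

lemma is_graphD:
  assumes "is_graph G"
  shows "finite (Arcs G)" "finite (Verts G)" "d \<in> Darts G \<Longrightarrow> d \<in> Arcs G"
    "a \<in> Arcs G \<Longrightarrow> dag G a \<in> Arcs G" "a \<in> Arcs G \<Longrightarrow> dag G (dag G a) = a"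
    "a \<in> Arcs G \<Longrightarrow> dag G a \<noteq> a" "d \<in> Darts G \<Longrightarrow> att G d \<in> Verts G"
  using assms unfolding is_graph_def by (auto simp: PiE_def Pi_def)

lemma connected_graph_iff:
  "connected_graph G \<longleftrightarrow> is_graph G \<and> Arcs G <+> Verts G \<noteq> {} \<and>
     (\<forall>x\<in>Arcs G <+> Verts G. \<forall>y\<in>Arcs G <+> Verts G. (x, y) \<in> (incidence G \<union> (incidence G)\<inverse>)\<^sup>*)"
proof -
  define r where "r = (incidence G \<union> (incidence G)\<inverse>)\<^sup>*"
  define A where "A = Arcs G <+> Verts G"
  have sr: "sym r" unfolding r_def by (intro sym_rtrancl) (auto simp: sym_def)
  have tr: "trans r" unfolding r_def by (rule trans_rtrancl)
  have rr: "(x, x) \<in> r" for x unfolding r_def by simp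
  have cls: "r `` {x} = r `` {y} \<longleftrightarrow> (x, y) \<in> r" for x y
    by (rule eq_equiv_class_iff) (use sr tr rr in \<open>auto simp: equiv_def refl_on_def\<close>)
  have "card (A // r) = 1 \<longleftrightarrow> A \<noteq> {} \<and> (\<forall>x\<in>A. \<forall>y\<in>A. (x, y) \<in> r)"
  proof
    assume "card (A // r) = 1"
    then obtain X where X: "A // r = {X}" by (auto simp: card_1_singleton_iff)
    then have "A \<noteq> {}" by (auto simp: quotient_def)
    moreover have "r `` {x} = X" if "x \<in> A" for x
      using quotientI[OF that, of r] unfolding X by simp
    ultimately show "A \<noteq> {} \<and> (\<forall>x\<in>A. \<forall>y\<in>A. (x, y) \<in> r)" using cls by metis
  next
    assume a: "A \<noteq> {} \<and> (\<forall>x\<in>A. \<forall>y\<in>A. (x, y) \<in> r)"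
    then obtain x where x: "x \<in> A" by auto
    have "A // r = {r `` {x}}" using a x cls by (auto simp: quotient_def)
    then show "card (A // r) = 1" by simp
  qed
  then show ?thesis unfolding connected_graph_def r_def A_def by auto
qed

text \<open>
  A set of arcs and vertices that is closed under the generating relation contains everything as
  soon as it is nonempty. All global arguments about connected graphs below have this form.
\<close>

lemma connected_induct:
  assumes G: "connected_graph G"
    and ex: "(\<exists>a\<in>Arcs G. P a) \<or> (\<exists>v\<in>Verts G. Q v)"
    and dg: "\<And>a. a \<in> Arcs G \<Longrightarrow> P a \<Longrightarrow> P (dag G a)"
    and at: "\<And>d. d \<in> Darts G \<Longrightarrow> P d \<longleftrightarrow> Q (att G d)"
  shows "(\<forall>a\<in>Arcs G. P a) \<and> (\<forall>v\<in>Verts G. Q v)"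
proof -
  have gr: "is_graph G" using G by (simp add: connected_graph_def)
  note g = is_graphD[OF gr]
  define S where "S = {Inl a |a. P a} \<union> {Inr v |v. Q v}"
  obtain x where x: "x \<in> Arcs G <+> Verts G" "x \<in> S" using ex by (auto simp: S_def)
  have dg': "P (dag G a) \<longleftrightarrow> P a" if "a \<in> Arcs G" for a
    using dg[OF that] dg[OF g(4)[OF that]] g(5)[OF that] by auto
  have stp: "z \<in> S" if "y \<in> S" "(y, z) \<in> incidence G \<union> (incidence G)\<inverse>" for y z
    using that(2) that(1) by (elim UnE) (auto simp: S_def incidence_def dg' at)
  have "y \<in> S" if "y \<in> Arcs G <+> Verts G" for y
  proof -
    have "(x, y) \<in> (incidence G \<union> (incidence G)\<inverse>)\<^sup>*" using G that x by (simp add: connected_graph_iff)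
    then show ?thesis
    proof (induction rule: rtrancl_induct)
      case base then show ?case by (rule x(2))
    next
      case (step y z) then show ?case using stp by blast
    qed
  qed
  then show ?thesis by (force simp: S_def)
qed

lemma connectedI:
  assumes gr: "is_graph G" and ne: "Arcs G \<noteq> {} \<or> Verts G \<noteq> {}"
    and ind: "\<And>P Q. (\<exists>a\<in>Arcs G. P a) \<or> (\<exists>v\<in>Verts G. Q v) \<Longrightarrow>
       (\<And>a. a \<in> Arcs G \<Longrightarrow> P a \<Longrightarrow> P (dag G a)) \<Longrightarrow>
       (\<And>d. d \<in> Darts G \<Longrightarrow> P d \<longleftrightarrow> Q (att G d)) \<Longrightarrow>
       (\<forall>a\<in>Arcs G. P a) \<and> (\<forall>v\<in>Verts G. Q v)"
  shows "connected_graph G"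
  unfolding connected_graph_iff
proof (intro conjI ballI)
  show "is_graph G" by fact
  show "Arcs G <+> Verts G \<noteq> {}" using ne by auto
next
  fix x y assume x: "x \<in> Arcs G <+> Verts G" and y: "y \<in> Arcs G <+> Verts G"
  define r where "r = (incidence G \<union> (incidence G)\<inverse>)"
  have "(\<forall>a\<in>Arcs G. (x, Inl a) \<in> r\<^sup>*) \<and> (\<forall>v\<in>Verts G. (x, Inr v) \<in> r\<^sup>*)"
  proof (rule ind)
    show "(\<exists>a\<in>Arcs G. (x, Inl a) \<in> r\<^sup>*) \<or> (\<exists>v\<in>Verts G. (x, Inr v) \<in> r\<^sup>*)" using x by auto
    show "(x, Inl (dag G a)) \<in> r\<^sup>*" if "a \<in> Arcs G" "(x, Inl a) \<in> r\<^sup>*" for a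
      using that by (rule_tac rtrancl_into_rtrancl) (auto simp: r_def incidence_def)
    fix d assume d: "d \<in> Darts G"
    have "(Inl d, Inr (att G d)) \<in> r" "(Inr (att G d), Inl d) \<in> r"
      using d by (auto simp: r_def incidence_def)
    then show "(x, Inl d) \<in> r\<^sup>* \<longleftrightarrow> (x, Inr (att G d)) \<in> r\<^sup>*"
      by (meson rtrancl_into_rtrancl)
  qed
  then show "(x, y) \<in> (incidence G \<union> (incidence G)\<inverse>)\<^sup>*" using y by (auto simp: r_def)
qed

lemma connected_is_graph: "connected_graph G \<Longrightarrow> is_graph G"
  by (simp add: connected_graph_def)

lemmas conn_graphD = is_graphD[OF connected_is_graph]

text \<open>
  An edge neither of whose arcs is attached to a vertex would be a component of its own.
\<close>

lemma dart_or_dag_dart: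
  assumes G: "connected_graph G" and V: "Verts G \<noteq> {}" and a: "a \<in> Arcs G"
  shows "a \<in> Darts G \<or> dag G a \<in> Darts G"
proof (rule ccontr)
  assume n: "\<not> ?thesis"
  have "(\<forall>c\<in>Arcs G. c = a \<or> c = dag G a) \<and> (\<forall>v\<in>Verts G. False)"
    by (rule connected_induct[OF G]) (use a n conn_graphD[OF G] in auto)
  then show False using V by auto
qed

lemma no_verts:
  assumes G: "connected_graph G" and V: "Verts G = {}"
  shows "Darts G = {}" "\<exists>a. Arcs G = {a, dag G a}"
    "a \<in> Arcs G \<Longrightarrow> Arcs G = {a, dag G a}"
proof -
  show D: "Darts G = {}" using conn_graphD[OF G] V by auto
  show *: "Arcs G = {a, dag G a}" if a: "a \<in> Arcs G" for a
  proof -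
    have "(\<forall>c\<in>Arcs G. c = a \<or> c = dag G a) \<and> (\<forall>v\<in>Verts G. False)"
      by (rule connected_induct[OF G]) (use a D conn_graphD[OF G] in auto)
    then show ?thesis using a conn_graphD[OF G] by auto
  qed
  have "Arcs G \<noteq> {}" using G V by (auto simp: connected_graph_iff)
  then show "\<exists>a. Arcs G = {a, dag G a}" using * by blast
qed

text \<open>
  Connectedness seen from the vertices alone: an arc inherits the property of the vertices at
  which its edge is attached.
\<close>

lemma vertex_induct:
  assumes G: "connected_graph G" and ex: "\<exists>v\<in>Verts G. Q v"
    and st: "\<And>d. d \<in> Darts G \<Longrightarrow> dag G d \<in> Darts G \<Longrightarrow> Q (att G d) \<Longrightarrow> Q (att G (dag G d))"
  shows "\<forall>v\<in>Verts G. Q v"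
proof -
  have st': "Q (att G d)" if "d \<in> Darts G" "dag G d \<in> Darts G" "Q (att G (dag G d))" for d
    using st[of "dag G d"] that conn_graphD[OF G] by auto
  have "(\<forall>a\<in>Arcs G. (a \<in> Darts G \<and> Q (att G a)) \<or> (dag G a \<in> Darts G \<and> Q (att G (dag G a)))) \<and>
    (\<forall>v\<in>Verts G. Q v)"
    by (rule connected_induct[OF G]) (use ex st st' conn_graphD[OF G] in auto)
  then show ?thesis by blast
qed

lemma vertex_connectedI:
  assumes gr: "is_graph G" and ne: "Verts G \<noteq> {}"
    and da: "\<And>a. a \<in> Arcs G \<Longrightarrow> a \<in> Darts G \<or> dag G a \<in> Darts G"
    and ind: "\<And>Q. \<exists>v\<in>Verts G. Q v \<Longrightarrow>
       (\<And>d. d \<in> Darts G \<Longrightarrow> dag G d \<in> Darts G \<Longrightarrow> Q (att G d) \<Longrightarrow> Q (att G (dag G d))) \<Longrightarrow>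
       (\<forall>v\<in>Verts G. Q v)"
  shows "connected_graph G"
proof (rule connectedI[OF gr])
  show "Arcs G \<noteq> {} \<or> Verts G \<noteq> {}" using ne by simp
  fix P Q
  assume ex: "(\<exists>a\<in>Arcs G. P a) \<or> (\<exists>v\<in>Verts G. Q v)"
    and dg: "\<And>a. a \<in> Arcs G \<Longrightarrow> P a \<Longrightarrow> P (dag G a)"
    and at: "\<And>d. d \<in> Darts G \<Longrightarrow> P d \<longleftrightarrow> Q (att G d)"
  note g = is_graphD[OF gr]
  have "\<exists>v\<in>Verts G. Q v"
    using ex
  proof
    assume "\<exists>a\<in>Arcs G. P a"
    then obtain a where a: "a \<in> Arcs G" "P a" by auto
    then show ?thesis using da[OF a(1)] dg[OF a] at g by blast
  qed
  then have V: "\<forall>v\<in>Verts G. Q v" by (rule ind) (use dg at g in blast)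
  moreover have "P a" if "a \<in> Arcs G" for a
    using da[OF that] at V g(7) dg[of "dag G a"] g(4,5) that by auto
  ultimately show "(\<forall>a\<in>Arcs G. P a) \<and> (\<forall>v\<in>Verts G. Q v)" by blast
qed

section \<open>Embeddings\<close>

definition darts_at :: "graph \<Rightarrow> nat set \<Rightarrow> nat set" where
  "darts_at G W = {d \<in> Darts G. att G d \<in> W}"

text \<open>
  The pullback condition on darts, split into uniqueness and existence. Uniqueness is plain
  injectivity on darts, because the attaching vertex is determined by injectivity on vertices.
\<close>

lemma is_embedding_iff:
  "is_embedding G h \<longleftrightarrow> connected_graph (edom h) \<and> connected_graph G \<and>
     earc h \<in> Arcs (edom h) \<rightarrow>\<^sub>E Arcs G \<and> evert h \<in> Verts (edom h) \<rightarrow>\<^sub>E Verts G \<and>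
     (\<forall>a\<in>Arcs (edom h). earc h (dag (edom h) a) = dag G (earc h a)) \<and>
     (\<forall>d\<in>Darts (edom h). earc h d \<in> Darts G \<and> evert h (att (edom h) d) = att G (earc h d)) \<and>
     inj_on (earc h) (Darts (edom h)) \<and>
     (\<forall>d\<in>Darts G. \<forall>v\<in>Verts (edom h). att G d = evert h v \<longrightarrow>
        (\<exists>d'\<in>Darts (edom h). att (edom h) d' = v \<and> earc h d' = d)) \<and>
     inj_on (evert h) (Verts (edom h))" (is "?L \<longleftrightarrow> ?R")
proof
  assume ?L
  then have h: "connected_graph (edom h)" and
    b: "bij_betw (\<lambda>d. (earc h d, att (edom h) d)) (Darts (edom h))
       {(d, v). d \<in> Darts G \<and> v \<in> Verts (edom h) \<and> att G d = evert h v}"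
    and e: "\<forall>d\<in>Darts (edom h). earc h d \<in> Darts G \<and> evert h (att (edom h) d) = att G (earc h d)"
    and i: "inj_on (evert h) (Verts (edom h))"
    by (auto simp: is_embedding_def)
  have "inj_on (earc h) (Darts (edom h))"
  proof (rule inj_onI)
    fix d d' assume d: "d \<in> Darts (edom h)" "d' \<in> Darts (edom h)" "earc h d = earc h d'"
    then have "att (edom h) d = att (edom h) d'"
      using e conn_graphD(7)[OF h] by - (rule inj_onD[OF i]; auto)
    with d show "d = d'" using inj_onD[OF bij_betw_imp_inj_on[OF b], of d d'] by simp
  qed
  moreover have "\<exists>d'\<in>Darts (edom h). att (edom h) d' = v \<and> earc h d' = d"
    if "d \<in> Darts G" "v \<in> Verts (edom h)" "att G d = evert h v" for d v
  proof -
    have "(d, v) \<in> (\<lambda>d. (earc h d, att (edom h) d)) ` Darts (edom h)"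
      unfolding bij_betw_imp_surj_on[OF b] using that by simp
    then show ?thesis by blast
  qed
  ultimately show ?R using \<open>?L\<close> unfolding is_embedding_def by blast
next
  assume R: ?R
  have "bij_betw (\<lambda>d. (earc h d, att (edom h) d)) (Darts (edom h))
       {(d, v). d \<in> Darts G \<and> v \<in> Verts (edom h) \<and> att G d = evert h v}"
    unfolding bij_betw_def
  proof
    show "inj_on (\<lambda>d. (earc h d, att (edom h) d)) (Darts (edom h))"
      by (rule inj_onI) (use R in \<open>blast dest: inj_onD\<close>)
    show "(\<lambda>d. (earc h d, att (edom h) d)) ` Darts (edom h) =
      {(d, v). d \<in> Darts G \<and> v \<in> Verts (edom h) \<and> att G d = evert h v}" 
    proof (intro equalityI subsetI)
      fix p assume "p \<in> (\<lambda>d. (earc h d, att (edom h) d)) ` Darts (edom h)"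
      then obtain d where d: "d \<in> Darts (edom h)" and p: "p = (earc h d, att (edom h) d)" by blast
      have "att (edom h) d \<in> Verts (edom h)" using conn_graphD(7)[of "edom h"] R d by blast
      then show "p \<in> {(d, v). d \<in> Darts G \<and> v \<in> Verts (edom h) \<and> att G d = evert h v}"
        using R d unfolding p by simp
    next
      fix p assume "p \<in> {(d, v). d \<in> Darts G \<and> v \<in> Verts (edom h) \<and> att G d = evert h v}"
      then obtain d v where p: "p = (d, v)" and d: "d \<in> Darts G" "v \<in> Verts (edom h)" "att G d = evert h v" by blast
      then obtain d' where "d' \<in> Darts (edom h)" "att (edom h) d' = v" "earc h d' = d" using R by blast
      then show "p \<in> (\<lambda>d. (earc h d, att (edom h) d)) ` Darts (edom h)" unfolding p by blast
    qed
  qed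
  then show ?L using R unfolding is_embedding_def by blast
qed

lemma embeddingD:
  assumes "is_embedding G h"
  shows "connected_graph (edom h)" "connected_graph G"
    "earc h \<in> Arcs (edom h) \<rightarrow>\<^sub>E Arcs G" "evert h \<in> Verts (edom h) \<rightarrow>\<^sub>E Verts G"
    "a \<in> Arcs (edom h) \<Longrightarrow> earc h a \<in> Arcs G"
    "v \<in> Verts (edom h) \<Longrightarrow> evert h v \<in> Verts G"
    "a \<in> Arcs (edom h) \<Longrightarrow> earc h (dag (edom h) a) = dag G (earc h a)"
    "d \<in> Darts (edom h) \<Longrightarrow> earc h d \<in> Darts G"
    "d \<in> Darts (edom h) \<Longrightarrow> evert h (att (edom h) d) = att G (earc h d)"
    "inj_on (earc h) (Darts (edom h))"
    "inj_on (evert h) (Verts (edom h))"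
    "d \<in> Darts G \<Longrightarrow> v \<in> Verts (edom h) \<Longrightarrow> att G d = evert h v \<Longrightarrow>
        (\<exists>d'\<in>Darts (edom h). att (edom h) d' = v \<and> earc h d' = d)"
  using assms unfolding is_embedding_iff by auto

definition vert_image :: "emb \<Rightarrow> nat set" where "vert_image h = evert h ` Verts (edom h)"
definition bdry_image :: "emb \<Rightarrow> nat set" where "bdry_image h = earc h ` graph_boundary (edom h)"

lemma embedding_darts:
  assumes "is_embedding G h"
  shows "earc h ` Darts (edom h) = darts_at G (vert_image h)"
proof (intro equalityI subsetI)
  fix e assume "e \<in> earc h ` Darts (edom h)"
  then obtain d where d: "d \<in> Darts (edom h)" "e = earc h d" by blast
  have "att G e = evert h (att (edom h) d)" using d embeddingD(9)[OF assms] by simp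
  then show "e \<in> darts_at G (vert_image h)"
    using d embeddingD(8)[OF assms] conn_graphD(7)[OF embeddingD(1)[OF assms]]
    by (simp add: darts_at_def vert_image_def)
next
  fix e assume "e \<in> darts_at G (vert_image h)"
  then obtain v where "e \<in> Darts G" "v \<in> Verts (edom h)" "att G e = evert h v"
    by (auto simp: darts_at_def vert_image_def)
  then show "e \<in> earc h ` Darts (edom h)" using embeddingD(12)[OF assms] by blast
qed

lemma embedding_arcs:
  assumes "is_embedding G h"
  shows "earc h ` Arcs (edom h) = darts_at G (vert_image h) \<union> bdry_image h"
proof -
  have "Arcs (edom h) = Darts (edom h) \<union> graph_boundary (edom h)"
    using conn_graphD(3)[OF embeddingD(1)[OF assms]] by (auto simp: graph_boundary_def)
  then show ?thesis using embedding_darts[OF assms] by (simp add: bdry_image_def image_Un)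
qed

lemma dag_boundary_dart:
  assumes "connected_graph G" "Verts G \<noteq> {}" "b \<in> graph_boundary G"
  shows "dag G b \<in> Darts G"
  using dart_or_dag_dart[OF assms(1,2)] assms(3) by (auto simp: graph_boundary_def)

text \<open>
  A boundary arc is opposite to a dart, and darts inject; an edge has no darts but its two arcs
  stay distinct because the involution of \<open>G\<close> has no fixed points. On all arcs
  injectivity can fail: a dart and a boundary arc may be identified.
\<close>

lemma embedding_inj_boundary:
  assumes e: "is_embedding G h"
  shows "inj_on (earc h) (graph_boundary (edom h))"
proof (cases "Verts (edom h) = {}")
  case True
  obtain a where a: "Arcs (edom h) = {a, dag (edom h) a}" using no_verts(2)[OF embeddingD(1)[OF e] True] by blast
  then have "a \<in> Arcs (edom h)" by blast
  then have "earc h (dag (edom h) a) \<noteq> earc h a"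
    using embeddingD(5,7)[OF e, of a] conn_graphD(6)[OF embeddingD(2)[OF e], of "earc h a"] by simp
  then have "inj_on (earc h) (Arcs (edom h))" unfolding a by auto
  then show ?thesis by (rule inj_on_subset) (auto simp: graph_boundary_def)
next
  case False
  show ?thesis
  proof (rule inj_onI)
    fix b c assume b: "b \<in> graph_boundary (edom h)" and c: "c \<in> graph_boundary (edom h)" and eq: "earc h b = earc h c"
    have ar: "b \<in> Arcs (edom h)" "c \<in> Arcs (edom h)" using b c by (auto simp: graph_boundary_def)
    have "earc h (dag (edom h) b) = earc h (dag (edom h) c)" using embeddingD(7)[OF e] ar eq by simp
    then have "dag (edom h) b = dag (edom h) c"
      using dag_boundary_dart[OF embeddingD(1)[OF e] False] b c by - (rule inj_onD[OF embeddingD(10)[OF e]]; simp)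
    then show "b = c" using conn_graphD(5)[OF embeddingD(1)[OF e]] ar by metis
  qed
qed

lemma embedding_verts_subset: "is_embedding G h \<Longrightarrow> vert_image h \<subseteq> Verts G"
  using embeddingD(6) by (auto simp: vert_image_def)

lemma embedding_boundary_subset: "is_embedding G h \<Longrightarrow> bdry_image h \<subseteq> Arcs G"
  using embeddingD(5) by (auto simp: bdry_image_def graph_boundary_def)

text \<open>
  The order in which \<open>h\<close> is below \<open>l\<close> if it factors through it, in
  terms of the vertex and boundary images \<open>(W, B)\<close> of \<open>h\<close> and
  \<open>(W', B')\<close> of \<open>l\<close>. A boundary arc of \<open>l\<close> opposite to a
  dart of \<open>h\<close> is an end of \<open>l\<close>, hence one of \<open>h\<close>. Only
  for an edge is it a further condition that it meets the image of \<open>l\<close>.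
\<close>

definition pair_le :: "graph \<Rightarrow> nat set \<Rightarrow> nat set \<Rightarrow> nat set \<Rightarrow> nat set \<Rightarrow> bool" where
  "pair_le G W B W' B' \<longleftrightarrow> W \<subseteq> W' \<and> B' \<inter> dag G ` darts_at G W \<subseteq> B \<and>
     (W = {} \<longrightarrow> B \<subseteq> darts_at G W' \<union> B')"

lemma vert_image_empty_iff: "vert_image h = {} \<longleftrightarrow> Verts (edom h) = {}" by (simp add: vert_image_def)

lemma factors_imp_pair_le:
  assumes h: "is_embedding G h" and l: "is_embedding G l" and f: "factors_by l h i"
  shows "pair_le G (vert_image h) (bdry_image h) (vert_image l) (bdry_image l)"
proof -
  have i: "is_embedding (edom l) i" and id: "edom i = edom h"
    and fa: "\<And>a. a \<in> Arcs (edom h) \<Longrightarrow> earc l (earc i a) = earc h a"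
    and fv: "\<And>v. v \<in> Verts (edom h) \<Longrightarrow> evert l (evert i v) = evert h v"
    using f by (auto simp: factors_by_def)
  have iV: "v \<in> Verts (edom h) \<Longrightarrow> evert i v \<in> Verts (edom l)" for v using embeddingD(6)[OF i] id by simp
  have iA: "a \<in> Arcs (edom h) \<Longrightarrow> earc i a \<in> Arcs (edom l)" for a using embeddingD(5)[OF i] id by simp
  have 1: "vert_image h \<subseteq> vert_image l"
    unfolding vert_image_def using fv iV by (force simp: image_iff)
  have 2: "bdry_image l \<inter> dag G ` darts_at G (vert_image h) \<subseteq> bdry_image h"
  proof
    fix b assume "b \<in> bdry_image l \<inter> dag G ` darts_at G (vert_image h)"
    then obtain \<beta> e where \<beta>: "\<beta> \<in> graph_boundary (edom l)" "b = earc l \<beta>" and e: "e \<in> darts_at G (vert_image h)" "b = dag G e"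
      by (auto simp: bdry_image_def)
    obtain d where d: "d \<in> Darts (edom h)" "e = earc h d" using e embedding_darts[OF h] by blast
    have dA: "d \<in> Arcs (edom h)" using d conn_graphD(3)[OF embeddingD(1)[OF h]] by simp
    have \<beta>A: "\<beta> \<in> Arcs (edom l)" using \<beta> by (simp add: graph_boundary_def)
    have id1: "earc i d \<in> Darts (edom l)" using embeddingD(8)[OF i] d id by simp
    then have ne: "Verts (edom l) \<noteq> {}" using conn_graphD(7)[OF embeddingD(1)[OF l]] by auto
    have \<beta>d: "dag (edom l) \<beta> \<in> Darts (edom l)" by (rule dag_boundary_dart[OF embeddingD(1)[OF l] ne \<beta>(1)])
    have "earc l (dag (edom l) \<beta>) = dag G b" using embeddingD(7)[OF l \<beta>A] \<beta> by simp
    also have "\<dots> = e" using e conn_graphD(5)[OF embeddingD(2)[OF h]] d embeddingD(5)[OF h dA] by simp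
    also have "\<dots> = earc l (earc i d)" using fa dA d by simp
    finally have "dag (edom l) \<beta> = earc i d" using \<beta>d id1 by - (rule inj_onD[OF embeddingD(10)[OF l]]; simp)
    then have bb: "earc i (dag (edom h) d) = \<beta>"
      using embeddingD(7)[OF i] dA id conn_graphD(5)[OF embeddingD(1)[OF l] \<beta>A] by simp
    have "dag (edom h) d \<notin> Darts (edom h)"
      using embeddingD(8)[OF i, of "dag (edom h) d"] bb \<beta> id by (auto simp: graph_boundary_def)
    then have "dag (edom h) d \<in> graph_boundary (edom h)"
      using conn_graphD(4)[OF embeddingD(1)[OF h] dA] by (simp add: graph_boundary_def)
    moreover have "earc h (dag (edom h) d) = b" using embeddingD(7)[OF h dA] d e by simp
    ultimately show "b \<in> bdry_image h" by (auto simp: bdry_image_def)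
  qed
  have "bdry_image h \<subseteq> earc l ` Arcs (edom l)"
  proof
    fix b assume "b \<in> bdry_image h"
    then obtain \<beta> where "\<beta> \<in> Arcs (edom h)" "b = earc h \<beta>" by (auto simp: bdry_image_def graph_boundary_def)
    then show "b \<in> earc l ` Arcs (edom l)" using fa iA by force
  qed
  then have 3: "bdry_image h \<subseteq> darts_at G (vert_image l) \<union> bdry_image l" using embedding_arcs[OF l] by simp
  show ?thesis using 1 2 3 by (simp add: pair_le_def)
qed

lemma pair_le_imp_factors_edge:
  assumes h: "is_embedding G h" and l: "is_embedding G l"
    and V: "Verts (edom h) = {}" and B: "bdry_image h \<subseteq> earc l ` Arcs (edom l)"
  shows "\<exists>i. factors_by l h i"
proof -
  note H = embeddingD(1)[OF h] and L = embeddingD(1)[OF l]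
  obtain a where a: "Arcs (edom h) = {a, dag (edom h) a}" using no_verts(2)[OF H V] by blast
  have D: "Darts (edom h) = {}" using no_verts(1)[OF H V] by simp
  then have "earc h a \<in> bdry_image h" using a by (simp add: bdry_image_def graph_boundary_def)
  then obtain \<alpha> where \<alpha>: "\<alpha> \<in> Arcs (edom l)" "earc l \<alpha> = earc h a" using B by force
  have ane: "dag (edom h) a \<noteq> a" "dag (edom h) (dag (edom h) a) = a" using conn_graphD(5,6)[OF H] a by auto
  define i where "i = \<lparr>edom = edom h, earc = (\<lambda>c\<in>Arcs (edom h). if c = a then \<alpha> else dag (edom l) \<alpha>),
     evert = (\<lambda>v\<in>{}. 0)\<rparr>"
  have "is_embedding (edom l) i"
    unfolding is_embedding_iff using H L D V a ane conn_graphD(4,5)[OF L \<alpha>(1)] \<alpha>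
    by (auto simp: i_def)
  moreover have "earc l (earc i c) = earc h c" if "c \<in> Arcs (edom h)" for c
    using that a ane \<alpha> embeddingD(7)[OF l \<alpha>(1)] embeddingD(7)[OF h, of a] by (auto simp: i_def)
  ultimately show ?thesis using V by (auto simp: factors_by_def i_def intro!: exI[of _ i])
qed

text \<open>
  Darts of the domain of \<open>h\<close> have unique lifts to darts of the domain of
  \<open>l\<close>, and the remaining arcs are opposite to darts. That the lift respects the
  involution on an edge with two darts is where the condition on boundaries enters: otherwise
  \<open>l\<close> would cut this edge.
\<close>

lemma pair_le_imp_factors:
  assumes h: "is_embedding G h" and l: "is_embedding G l"
    and le: "pair_le G (vert_image h) (bdry_image h) (vert_image l) (bdry_image l)"
  shows "\<exists>i. factors_by l h i"
proof (cases "Verts (edom h) = {}")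
  case True
  then show ?thesis using pair_le_imp_factors_edge[OF h l True] le embedding_arcs[OF l]
    by (simp add: pair_le_def vert_image_def)
next
  case V: False
  note H = embeddingD(1)[OF h] and L = embeddingD(1)[OF l]
  have VV: "vert_image h \<subseteq> vert_image l" and BB: "bdry_image l \<inter> dag G ` darts_at G (vert_image h) \<subseteq> bdry_image h" using le by (auto simp: pair_le_def)
  define vl where "vl = (\<lambda>v. inv_into (Verts (edom l)) (evert l) (evert h v))"
  have vl: "vl v \<in> Verts (edom l)" "evert l (vl v) = evert h v" if "v \<in> Verts (edom h)" for v
  proof -
    have "evert h v \<in> evert l ` Verts (edom l)" using VV that by (auto simp: vert_image_def)
    then show "vl v \<in> Verts (edom l)" "evert l (vl v) = evert h v"
      by (auto simp only: vl_def intro: inv_into_into f_inv_into_f)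
  qed
  define dl where "dl = (\<lambda>a. inv_into (Darts (edom l)) (earc l) (earc h a))"
  have dl: "dl d \<in> Darts (edom l)" "earc l (dl d) = earc h d" if "d \<in> Darts (edom h)" for d
  proof -
    have "earc h d \<in> darts_at G (vert_image l)" using embedding_darts[OF h] that VV by (auto simp: darts_at_def)
    then have "earc h d \<in> earc l ` Darts (edom l)" using embedding_darts[OF l] by simp
    then show "dl d \<in> Darts (edom l)" "earc l (dl d) = earc h d"
      by (auto simp only: dl_def intro: inv_into_into f_inv_into_f)
  qed
  have dl_eq: "dl d = e" if "d \<in> Darts (edom h)" "e \<in> Darts (edom l)" "earc l e = earc h d" for d e
    using dl[OF that(1)] that by - (rule inj_onD[OF embeddingD(10)[OF l]]; auto)
  define ia where "ia = (\<lambda>a. if a \<in> Darts (edom h) then dl a else dag (edom l) (dl (dag (edom h) a)))"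
  define i where "i = \<lparr>edom = edom h, earc = (\<lambda>a\<in>Arcs (edom h). ia a), evert = (\<lambda>v\<in>Verts (edom h). vl v)\<rparr>"
  note hD = conn_graphD[OF H] and lD = conn_graphD[OF L]
  have bd: "dag (edom h) a \<in> Darts (edom h)" if "a \<in> Arcs (edom h)" "a \<notin> Darts (edom h)" for a
    using dart_or_dag_dart[OF H V that(1)] that by auto
  have iaA: "ia a \<in> Arcs (edom l)" if "a \<in> Arcs (edom h)" for a
    using that bd dl lD by (auto simp: ia_def)
  have lia: "earc l (ia a) = earc h a" if "a \<in> Arcs (edom h)" for a
  proof (cases "a \<in> Darts (edom h)")
    case True then show ?thesis by (simp add: ia_def dl)
  next
    case False
    then have d: "dag (edom h) a \<in> Darts (edom h)" using bd that by simp
    have "earc l (ia a) = dag G (earc h (dag (edom h) a))"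
      using False embeddingD(7)[OF l] dl[OF d] lD by (simp add: ia_def)
    also have "\<dots> = earc h (dag (edom h) (dag (edom h) a))" using embeddingD(7)[OF h hD(4)[OF that]] by simp
    finally show ?thesis using hD(5)[OF that] by simp
  qed
  have iadag: "ia (dag (edom h) a) = dag (edom l) (ia a)" if a: "a \<in> Arcs (edom h)" for a
  proof -
    have *: "ia (dag (edom h) a) = dag (edom l) (ia a)" if d: "a \<in> Darts (edom h)" for a
    proof (cases "dag (edom h) a \<in> Darts (edom h)")
      case False then show ?thesis using d hD by (auto simp: ia_def)
    next
      case True
      have aA: "a \<in> Arcs (edom h)" using d hD by simp
      have lA: "dl a \<in> Arcs (edom l)" using dl[OF d] lD by simp
      have ov: "earc l (dag (edom l) (dl a)) = earc h (dag (edom h) a)"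
        using embeddingD(7)[OF l lA] embeddingD(7)[OF h aA] dl[OF d] by simp
      have "dag (edom l) (dl a) \<in> Darts (edom l)"
      proof (rule ccontr)
        assume "dag (edom l) (dl a) \<notin> Darts (edom l)"
        then have "earc h (dag (edom h) a) \<in> bdry_image l"
          using ov lD(4)[OF lA] by (force simp: bdry_image_def graph_boundary_def)
        moreover have "earc h (dag (edom h) a) \<in> dag G ` darts_at G (vert_image h)"
          using embeddingD(7)[OF h aA] embedding_darts[OF h] d by blast
        ultimately have "earc h (dag (edom h) a) \<in> bdry_image h" using BB by blast
        then obtain b where b: "b \<in> graph_boundary (edom h)" "earc h (dag (edom h) a) = earc h b" by (auto simp: bdry_image_def)
        have bA: "b \<in> Arcs (edom h)" using b by (simp add: graph_boundary_def)
        have "earc h (dag (edom h) b) = earc h (dag (edom h) (dag (edom h) a))"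
          using embeddingD(7)[OF h] bA hD(4)[OF aA] b by simp
        then have "dag (edom h) b = a"
          using dag_boundary_dart[OF H V b(1)] d hD(5)[OF aA] by - (rule inj_onD[OF embeddingD(10)[OF h]]; auto)
        then have "b = dag (edom h) a" using hD bA by auto
        then show False using b True by (simp add: graph_boundary_def)
      qed
      then show ?thesis using d True dl_eq[OF True _ ov] by (simp add: ia_def)
    qed
    show ?thesis
    proof (cases "a \<in> Darts (edom h)")
      case True then show ?thesis by (rule *)
    next
      case False
      then have "ia (dag (edom h) (dag (edom h) a)) = dag (edom l) (ia (dag (edom h) a))"
        using * bd[OF a] by simp
      then show ?thesis using hD a lD iaA by (metis)
    qed
  qed
  have iatt: "vl (att (edom h) d) = att (edom l) (ia d)" if d: "d \<in> Darts (edom h)" for d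
  proof -
    have "evert l (vl (att (edom h) d)) = evert l (att (edom l) (ia d))"
      using d vl hD embeddingD(9)[OF h d] embeddingD(9)[OF l] dl[OF d] by (simp add: ia_def)
    then show ?thesis using vl(1) hD(7)[OF d] lD(7) dl(1)[OF d] d
      by - (rule inj_onD[OF embeddingD(11)[OF l]]; auto simp: ia_def)
  qed
  have "is_embedding (edom l) i"
    unfolding is_embedding_iff
  proof (intro conjI ballI impI)
    show "connected_graph (edom i)" "connected_graph (edom l)" using H L by (auto simp: i_def)
    show "earc i \<in> Arcs (edom i) \<rightarrow>\<^sub>E Arcs (edom l)" using iaA by (auto simp: i_def)
    show "evert i \<in> Verts (edom i) \<rightarrow>\<^sub>E Verts (edom l)" using vl by (auto simp: i_def)
    show "earc i (dag (edom i) a) = dag (edom l) (earc i a)" if "a \<in> Arcs (edom i)" for a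
      using that hD iadag by (auto simp: i_def)
    show "earc i d \<in> Darts (edom l)" "evert i (att (edom i) d) = att (edom l) (earc i d)"
      if "d \<in> Darts (edom i)" for d
      using that hD dl iatt by (auto simp: i_def ia_def)
    show "inj_on (earc i) (Darts (edom i))"
    proof (rule inj_onI)
      fix c d assume c: "c \<in> Darts (edom i)" "d \<in> Darts (edom i)" "earc i c = earc i d"
      then have "earc l (ia c) = earc l (ia d)" using hD by (simp add: i_def)
      then have "earc h c = earc h d" using lia[of c] lia[of d] hD(3) c by (simp add: i_def)
      then show "c = d" using c embeddingD(10)[OF h] by (auto simp: i_def dest: inj_onD)
    qed
    show "inj_on (evert i) (Verts (edom i))"
    proof (rule inj_onI)
      fix u v assume u: "u \<in> Verts (edom i)" "v \<in> Verts (edom i)" "evert i u = evert i v"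
      then have "evert l (vl u) = evert l (vl v)" by (simp add: i_def)
      then have "evert h u = evert h v" using vl(2)[of u] vl(2)[of v] u by (simp add: i_def)
      then show "u = v" using u inj_onD[OF embeddingD(11)[OF h]] by (simp add: i_def)
    qed
    fix d v assume d: "d \<in> Darts (edom l)" and v: "v \<in> Verts (edom i)" and at: "att (edom l) d = evert i v"
    have v': "v \<in> Verts (edom h)" using v by (simp add: i_def)
    have "att G (earc l d) = evert h v" using embeddingD(9)[OF l d] at vl v' by (simp add: i_def)
    then obtain d' where d': "d' \<in> Darts (edom h)" "att (edom h) d' = v" "earc h d' = earc l d"
      using embeddingD(12)[OF h embeddingD(8)[OF l d] v'] by blast
    then have "dl d' = d" using d by (intro dl_eq) auto
    then show "\<exists>d'\<in>Darts (edom i). att (edom i) d' = v \<and> earc i d' = d"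
      using d' hD by (auto simp: i_def ia_def intro!: bexI[of _ d'])
  qed
  then show ?thesis using lia vl by (auto simp: factors_by_def i_def intro!: exI[of _ i])
qed

lemma factors_iff_pair_le:
  assumes "is_embedding G h" "is_embedding G l"
  shows "(\<exists>i. factors_by l h i) \<longleftrightarrow> pair_le G (vert_image h) (bdry_image h) (vert_image l) (bdry_image l)"
  using factors_imp_pair_le[OF assms] pair_le_imp_factors[OF assms] by blast

definition emb_unit :: "graph \<Rightarrow> emb" where
  "emb_unit G = \<lparr>edom = G, earc = (\<lambda>a\<in>Arcs G. a), evert = (\<lambda>v\<in>Verts G. v)\<rparr>"

definition emb_comp :: "emb \<Rightarrow> emb \<Rightarrow> emb" where
  "emb_comp l i = \<lparr>edom = edom i, earc = compose (Arcs (edom i)) (earc l) (earc i),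
     evert = compose (Verts (edom i)) (evert l) (evert i)\<rparr>"

lemma emb_unit_sel [simp]: "edom (emb_unit G) = G"
  "a \<in> Arcs G \<Longrightarrow> earc (emb_unit G) a = a" "v \<in> Verts G \<Longrightarrow> evert (emb_unit G) v = v"
  by (simp_all add: emb_unit_def)

lemma emb_comp_sel [simp]: "edom (emb_comp l i) = edom i"
  "a \<in> Arcs (edom i) \<Longrightarrow> earc (emb_comp l i) a = earc l (earc i a)"
  "v \<in> Verts (edom i) \<Longrightarrow> evert (emb_comp l i) v = evert l (evert i v)"
  by (simp_all add: emb_comp_def compose_def)

lemma emb_unit_embedding: "connected_graph G \<Longrightarrow> is_embedding G (emb_unit G)"
  using conn_graphD[of G] unfolding is_embedding_iff
  by (auto simp: emb_unit_def inj_on_def)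

lemma emb_comp_embedding:
  assumes l: "is_embedding G l" and i: "is_embedding (edom l) i"
  shows "is_embedding G (emb_comp l i)"
  unfolding is_embedding_iff
proof (intro conjI ballI impI)
  note H = embeddingD(1)[OF i] and g = conn_graphD[OF embeddingD(1)[OF i]]
  show "connected_graph (edom (emb_comp l i))" "connected_graph G"
    using H embeddingD(2)[OF l] by simp_all
  show "earc (emb_comp l i) \<in> Arcs (edom (emb_comp l i)) \<rightarrow>\<^sub>E Arcs G"
    "evert (emb_comp l i) \<in> Verts (edom (emb_comp l i)) \<rightarrow>\<^sub>E Verts G"
    using embeddingD(5,6)[OF l] embeddingD(5,6)[OF i] by (auto simp: emb_comp_def compose_def)
  show "earc (emb_comp l i) (dag (edom (emb_comp l i)) a) = dag G (earc (emb_comp l i) a)"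
    if "a \<in> Arcs (edom (emb_comp l i))" for a
    using that g(4)[of a] embeddingD(7)[OF i, of a] embeddingD(7)[OF l, of "earc i a"] embeddingD(5)[OF i, of a] by simp
  show "earc (emb_comp l i) d \<in> Darts G"
    "evert (emb_comp l i) (att (edom (emb_comp l i)) d) = att G (earc (emb_comp l i) d)"
    if "d \<in> Darts (edom (emb_comp l i))" for d
    using that g(3,7)[of d] embeddingD(8,9)[OF i, of d] embeddingD(8,9)[OF l, of "earc i d"] by simp_all
  show "inj_on (earc (emb_comp l i)) (Darts (edom (emb_comp l i)))"
  proof (rule inj_onI)
    fix c d assume "c \<in> Darts (edom (emb_comp l i))" "d \<in> Darts (edom (emb_comp l i))"
      and eq: "earc (emb_comp l i) c = earc (emb_comp l i) d"
    then have c: "c \<in> Darts (edom i)" and d: "d \<in> Darts (edom i)" by simp_all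
    have "earc l (earc i c) = earc l (earc i d)" using eq g(3) c d by simp
    then have "earc i c = earc i d"
      by (rule inj_onD[OF embeddingD(10)[OF l]]) (use c d embeddingD(8)[OF i] in auto)
    then show "c = d" by (rule inj_onD[OF embeddingD(10)[OF i]]) (use c d in auto)
  qed
  show "inj_on (evert (emb_comp l i)) (Verts (edom (emb_comp l i)))"
  proof (rule inj_onI)
    fix c d assume "c \<in> Verts (edom (emb_comp l i))" "d \<in> Verts (edom (emb_comp l i))"
      and eq: "evert (emb_comp l i) c = evert (emb_comp l i) d"
    then have c: "c \<in> Verts (edom i)" and d: "d \<in> Verts (edom i)" by simp_all
    have "evert l (evert i c) = evert l (evert i d)" using eq c d by simp
    then have "evert i c = evert i d"
      by (rule inj_onD[OF embeddingD(11)[OF l]]) (use c d embeddingD(6)[OF i] in auto)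
    then show "c = d" by (rule inj_onD[OF embeddingD(11)[OF i]]) (use c d in auto)
  qed
  fix d v assume d: "d \<in> Darts G" and "v \<in> Verts (edom (emb_comp l i))" and at: "att G d = evert (emb_comp l i) v"
  then have v: "v \<in> Verts (edom i)" by simp
  obtain d' where d': "d' \<in> Darts (edom l)" "att (edom l) d' = evert i v" "earc l d' = d"
    using embeddingD(12)[OF l d embeddingD(6)[OF i v]] at v by auto
  obtain e where "e \<in> Darts (edom i)" "att (edom i) e = v" "earc i e = d'"
    using embeddingD(12)[OF i d'(1) v d'(2)] by blast
  then show "\<exists>d'\<in>Darts (edom (emb_comp l i)). att (edom (emb_comp l i)) d' = v \<and> earc (emb_comp l i) d' = d"
    using d' g(3) by (intro bexI[of _ e]) auto
qed

lemma factors_by_comp: "is_embedding (edom l) i \<Longrightarrow> factors_by l (emb_comp l i) i"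
  by (simp add: factors_by_def)

lemma factors_images:
  assumes "factors_by l h i"
  shows "vert_image h = evert l ` vert_image i" "bdry_image h = earc l ` bdry_image i"
  using assms unfolding factors_by_def vert_image_def bdry_image_def by (force simp: graph_boundary_def)+

lemma comp_images:
  assumes "is_embedding (edom l) i"
  shows "vert_image (emb_comp l i) = evert l ` vert_image i" "bdry_image (emb_comp l i) = earc l ` bdry_image i"
  using factors_images[OF factors_by_comp[OF assms]] .

lemma unit_images: "vert_image (emb_unit G) = Verts G" "bdry_image (emb_unit G) = graph_boundary G"
  by (auto simp: vert_image_def bdry_image_def graph_boundary_def image_iff)

lemma arcs_split: "connected_graph G \<Longrightarrow> Arcs G = Darts G \<union> graph_boundary G"
  using conn_graphD(3)[of G] by (auto simp: graph_boundary_def)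

lemma darts_at_Verts: "connected_graph G \<Longrightarrow> darts_at G (Verts G) = Darts G"
  using conn_graphD(7)[of G] by (auto simp: darts_at_def)

text \<open>
  Embeddings with the same two images factor through each other, and the comparison map is
  bijective. What needs an argument is that it sends no boundary arc to a dart \<open>c\<close>:
  the image of \<open>c\<close> would also be that of a boundary arc \<open>c'\<close>, and then
  the opposites of \<open>c\<close> and \<open>c'\<close> would be darts with the same image, so
  \<open>c = c'\<close>.
\<close>

lemma emb_iso_iff:
  "(h, k) \<in> emb_iso G \<longleftrightarrow> is_embedding G h \<and> is_embedding G k \<and> vert_image h = vert_image k \<and> bdry_image h = bdry_image k"
proof
  assume "(h, k) \<in> emb_iso G"
  then obtain i where h: "is_embedding G h" and k: "is_embedding G k" and f: "factors_by k h i"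
    and ba: "bij_betw (earc i) (Arcs (edom h)) (Arcs (edom k))"
    and bv: "bij_betw (evert i) (Verts (edom h)) (Verts (edom k))"
    by (auto simp: emb_iso_def)
  have i: "is_embedding (edom k) i" and id: "edom i = edom h" using f by (auto simp: factors_by_def)
  have iV: "vert_image i = Verts (edom k)" using bij_betw_imp_surj_on[OF bv] id by (simp add: vert_image_def)
  have V: "vert_image h = vert_image k" using factors_images(1)[OF f] iV by (simp add: vert_image_def[of k])
  have "bdry_image i = earc i ` Arcs (edom h) - earc i ` Darts (edom h)"
    using inj_on_image_set_diff[OF bij_betw_imp_inj_on[OF ba], of "Arcs (edom h)" "Darts (edom h)"]
      conn_graphD(3)[OF embeddingD(1)[OF h]] id by (auto simp: bdry_image_def graph_boundary_def)
  also have "\<dots> = graph_boundary (edom k)"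
    using bij_betw_imp_surj_on[OF ba] embedding_darts[OF i] iV id
      darts_at_Verts[OF embeddingD(1)[OF k]] by (simp add: graph_boundary_def)
  finally have "bdry_image h = bdry_image k" using factors_images(2)[OF f] by (simp add: bdry_image_def[of k])
  then show "is_embedding G h \<and> is_embedding G k \<and> vert_image h = vert_image k \<and> bdry_image h = bdry_image k" using h k V by simp
next
  assume "is_embedding G h \<and> is_embedding G k \<and> vert_image h = vert_image k \<and> bdry_image h = bdry_image k"
  then have h: "is_embedding G h" and k: "is_embedding G k" and V: "vert_image h = vert_image k" and B: "bdry_image h = bdry_image k" by auto
  note H = embeddingD(1)[OF h] and K = embeddingD(1)[OF k]
  have "pair_le G (vert_image h) (bdry_image h) (vert_image k) (bdry_image k)" unfolding pair_le_def V B by blast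
  then obtain i where f: "factors_by k h i" using factors_iff_pair_le[OF h k] by blast
  have i: "is_embedding (edom k) i" and id: "edom i = edom h"
    and fa: "\<And>a. a \<in> Arcs (edom h) \<Longrightarrow> earc k (earc i a) = earc h a" using f by (auto simp: factors_by_def)
  have iV: "vert_image i = Verts (edom k)"
  proof -
    have "evert k ` vert_image i = evert k ` Verts (edom k)" using factors_images(1)[OF f] V by (simp add: vert_image_def[of k])
    then show ?thesis
      using inj_on_image_eq_iff[OF embeddingD(11)[OF k]] embedding_verts_subset[OF i] by blast
  qed
  have bv: "bij_betw (evert i) (Verts (edom h)) (Verts (edom k))"
    using embeddingD(11)[OF i] iV id by (simp add: bij_betw_def vert_image_def)
  have iD: "earc i ` Darts (edom h) = Darts (edom k)"
    using embedding_darts[OF i] iV darts_at_Verts[OF K] id by simp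
  have sub: "bdry_image i \<subseteq> graph_boundary (edom k)"
  proof (cases "Verts (edom k) = {}")
    case True
    then show ?thesis using embedding_boundary_subset[OF i] no_verts(1)[OF K] by (auto simp: graph_boundary_def)
  next
    case KV: False
    then have HV: "Verts (edom h) \<noteq> {}" using V by (auto simp: vert_image_def)
    show ?thesis
    proof
      fix c assume "c \<in> bdry_image i"
      then obtain b where b: "b \<in> graph_boundary (edom h)" "c = earc i b" using id by (auto simp: bdry_image_def)
      have bA: "b \<in> Arcs (edom h)" using b by (simp add: graph_boundary_def)
      have cA: "c \<in> Arcs (edom k)" using embeddingD(5)[OF i] bA b id by simp
      have "earc h b \<in> bdry_image k" using b B by (auto simp: bdry_image_def)
      then obtain c' where c': "c' \<in> graph_boundary (edom k)" "earc k c' = earc h b" by (auto simp: bdry_image_def)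
      have cA': "c' \<in> Arcs (edom k)" using c' by (simp add: graph_boundary_def)
      have bd: "dag (edom h) b \<in> Darts (edom h)" by (rule dag_boundary_dart[OF H HV b(1)])
      have ib: "earc i (dag (edom h) b) = dag (edom k) c" using embeddingD(7)[OF i] bA id b by simp
      have "earc k (dag (edom k) c) = earc k (dag (edom k) c')"
        using embeddingD(7)[OF k cA] embeddingD(7)[OF k cA'] c' fa[OF bA] b by simp
      then have "dag (edom k) c = dag (edom k) c'"
        by (rule inj_onD[OF embeddingD(10)[OF k]])
          (use ib bd embeddingD(8)[OF i, of "dag (edom h) b"] id dag_boundary_dart[OF K KV c'(1)] in auto)
      then have "c = c'" using conn_graphD(5)[OF K cA] conn_graphD(5)[OF K cA'] by metis
      then show "c \<in> graph_boundary (edom k)" using c' by simp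
    qed
  qed
  have iB: "bdry_image i = graph_boundary (edom k)"
  proof -
    have "earc k ` bdry_image i = earc k ` graph_boundary (edom k)" using factors_images(2)[OF f] B by (simp add: bdry_image_def[of k])
    then show ?thesis using inj_on_image_eq_iff[OF embedding_inj_boundary[OF k] sub] by blast
  qed
  have "bij_betw (earc i) (Arcs (edom h)) (Arcs (edom k))"
    unfolding bij_betw_def arcs_split[OF H] arcs_split[OF K]
  proof
    show "inj_on (earc i) (Darts (edom h) \<union> graph_boundary (edom h))"
      unfolding inj_on_Un using embeddingD(10)[OF i] embedding_inj_boundary[OF i] id iD iB
      by (auto simp: bdry_image_def graph_boundary_def)
    show "earc i ` (Darts (edom h) \<union> graph_boundary (edom h)) = Darts (edom k) \<union> graph_boundary (edom k)"
      using iD iB id by (simp add: image_Un bdry_image_def)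
  qed
  then show "(h, k) \<in> emb_iso G" using h k f bv by (auto simp: emb_iso_def)
qed

lemma emb_iso_equiv: "equiv {h. is_embedding G h} (emb_iso G)"
  by (rule equivI) (auto simp: emb_iso_iff refl_on_def sym_def trans_def)

definition emb_class :: "graph \<Rightarrow> emb \<Rightarrow> emb set" where
  "emb_class G h = emb_iso G `` {h}"

lemma emb_class_mem: "k \<in> emb_class G h \<longleftrightarrow> (h, k) \<in> emb_iso G"
  by (simp add: emb_class_def)

lemma emb_class_Emb: "is_embedding G h \<Longrightarrow> emb_class G h \<in> Emb G"
  by (simp add: emb_class_def Emb_def quotientI)

lemma Emb_rep: "x \<in> Emb G \<Longrightarrow> \<exists>h. is_embedding G h \<and> x = emb_class G h"
  by (auto simp: Emb_def emb_class_def elim!: quotientE)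

lemma emb_class_images:
  assumes "is_embedding G h"
  shows "emb_verts (emb_class G h) = vert_image h" "emb_boundary (emb_class G h) = bdry_image h"
proof -
  have "h \<in> emb_class G h" using assms by (simp add: emb_class_mem emb_iso_iff)
  then show "emb_verts (emb_class G h) = vert_image h" "emb_boundary (emb_class G h) = bdry_image h"
    unfolding emb_verts_def emb_boundary_def vert_image_def[symmetric] bdry_image_def[symmetric]
    using emb_class_mem[of _ G h] by (auto simp: emb_iso_iff)
qed

lemma Emb_memD:
  assumes "x \<in> Emb G" "h \<in> x"
  shows "is_embedding G h" "x = emb_class G h" "emb_verts x = vert_image h" "emb_boundary x = bdry_image h"
proof -
  obtain k where k: "is_embedding G k" "x = emb_class G k" using Emb_rep assms(1) by blast
  have kh: "(k, h) \<in> emb_iso G" using assms(2) k by (simp add: emb_class_mem)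
  then show h: "is_embedding G h" by (simp add: emb_iso_iff)
  show x: "x = emb_class G h" unfolding k(2) emb_class_def by (rule equiv_class_eq[OF emb_iso_equiv kh])
  show "emb_verts x = vert_image h" "emb_boundary x = bdry_image h" using emb_class_images[OF h] x by simp_all
qed

lemma Emb_E:
  assumes "x \<in> Emb G"
  obtains h where "is_embedding G h" "h \<in> x" "x = emb_class G h" "emb_verts x = vert_image h" "emb_boundary x = bdry_image h"
proof -
  obtain h where h: "is_embedding G h" "x = emb_class G h" using Emb_rep assms by blast
  then have "h \<in> x" by (simp add: emb_class_mem emb_iso_iff)
  then show thesis using that[OF h(1) _ h(2)] emb_class_images[OF h(1)] h(2) by simp
qed

lemma Emb_ext:
  assumes "x \<in> Emb G" "y \<in> Emb G" "emb_verts x = emb_verts y" "emb_boundary x = emb_boundary y"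
  shows "x = y"
proof -
  obtain h where h: "is_embedding G h" "x = emb_class G h" "emb_verts x = vert_image h" "emb_boundary x = bdry_image h"
    using assms(1) by (rule Emb_E)
  obtain k where k: "is_embedding G k" "y = emb_class G k" "emb_verts y = vert_image k" "emb_boundary y = bdry_image k"
    using assms(2) by (rule Emb_E)
  have "(h, k) \<in> emb_iso G" using h k assms by (simp add: emb_iso_iff)
  then show ?thesis using equiv_class_eq[OF emb_iso_equiv] h k by (simp add: emb_class_def)
qed

lemma Emb_connected: "x \<in> Emb G \<Longrightarrow> connected_graph G"
  by (erule Emb_E) (rule embeddingD(2))

lemma Emb_subset:
  assumes "x \<in> Emb G"
  shows "emb_verts x \<subseteq> Verts G" "emb_boundary x \<subseteq> Arcs G"
  using assms by (auto elim!: Emb_E dest: subsetD[OF embedding_verts_subset] subsetD[OF embedding_boundary_subset])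

lemma id_emb_class: "id_emb G = emb_class G (emb_unit G)"
  by (simp add: id_emb_def emb_class_def emb_unit_def)

lemma id_emb:
  assumes "connected_graph G"
  shows "id_emb G \<in> Emb G" "emb_verts (id_emb G) = Verts G" "emb_boundary (id_emb G) = graph_boundary G"
  using emb_class_Emb emb_class_images emb_unit_embedding[OF assms] unit_images
  by (auto simp: id_emb_class)

definition emb_le :: "graph \<Rightarrow> emb set \<Rightarrow> emb set \<Rightarrow> bool" where
  "emb_le G x y \<longleftrightarrow> pair_le G (emb_verts x) (emb_boundary x) (emb_verts y) (emb_boundary y)"

lemma emb_le_factors:
  assumes "x \<in> Emb G" "y \<in> Emb G" "h \<in> x" "l \<in> y"
  shows "emb_le G x y \<longleftrightarrow> (\<exists>i. factors_by l h i)"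
  using factors_iff_pair_le[OF Emb_memD(1)[OF assms(1,3)] Emb_memD(1)[OF assms(2,4)]]
    Emb_memD(3,4)[OF assms(1,3)] Emb_memD(3,4)[OF assms(2,4)]
  by (simp add: emb_le_def)

text \<open>
  Joint surjectivity on arcs is automatic. Every arc of the union is, up to the involution, a
  dart; its vertex comes from one of the two parts, and by the pullback condition so does the
  dart.
\<close>

lemma is_union_iff:
  assumes x: "x \<in> Emb G" and y: "y \<in> Emb G" and z: "z \<in> Emb G"
  shows "is_union x y z \<longleftrightarrow> emb_le G y x \<and> emb_le G z x \<and> emb_verts x = emb_verts y \<union> emb_verts z"
proof
  assume "is_union x y z"
  then obtain l h k i j where l: "l \<in> x" and h: "h \<in> y" and k: "k \<in> z"
    and f: "factors_by l h i" "factors_by l k j"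
    and V: "evert i ` Verts (edom h) \<union> evert j ` Verts (edom k) = Verts (edom l)"
    unfolding is_union_def by (elim bexE exE conjE) (rule that)
  have id: "edom i = edom h" "edom j = edom k" using f by (auto simp: factors_by_def)
  have "emb_verts x = evert l ` (vert_image i \<union> vert_image j)" using V id Emb_memD(3)[OF x l] by (simp add: vert_image_def)
  also have "\<dots> = emb_verts y \<union> emb_verts z"
    using factors_images(1)[OF f(1)] factors_images(1)[OF f(2)] Emb_memD(3)[OF y h] Emb_memD(3)[OF z k]
    by (simp add: image_Un)
  finally show "emb_le G y x \<and> emb_le G z x \<and> emb_verts x = emb_verts y \<union> emb_verts z"
    using emb_le_factors[OF y x h l] emb_le_factors[OF z x k l] f by blast
next
  assume a: "emb_le G y x \<and> emb_le G z x \<and> emb_verts x = emb_verts y \<union> emb_verts z"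
  obtain l where l: "is_embedding G l" "l \<in> x" "emb_verts x = vert_image l" using x by (rule Emb_E)
  obtain h where h: "is_embedding G h" "h \<in> y" "emb_verts y = vert_image h" using y by (rule Emb_E)
  obtain k where k: "is_embedding G k" "k \<in> z" "emb_verts z = vert_image k" using z by (rule Emb_E)
  obtain i where f: "factors_by l h i" using a emb_le_factors[OF y x h(2) l(2)] by blast
  obtain j where g: "factors_by l k j" using a emb_le_factors[OF z x k(2) l(2)] by blast
  have i: "is_embedding (edom l) i" "edom i = edom h" and j: "is_embedding (edom l) j" "edom j = edom k"
    using f g by (auto simp: factors_by_def)
  note L = embeddingD(1)[OF l(1)]
  have "evert l ` (vert_image i \<union> vert_image j) = evert l ` Verts (edom l)"
    using a l h k factors_images(1)[OF f] factors_images(1)[OF g] by (simp add: image_Un vert_image_def[of l])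
  then have V: "vert_image i \<union> vert_image j = Verts (edom l)"
    using inj_on_image_eq_iff[OF embeddingD(11)[OF l(1)]] embedding_verts_subset[OF i(1)] embedding_verts_subset[OF j(1)]
    by (metis Un_least subset_refl)
  let ?A = "earc i ` Arcs (edom h) \<union> earc j ` Arcs (edom k)"
  have As: "?A \<subseteq> Arcs (edom l)" using embeddingD(5)[OF i(1)] embeddingD(5)[OF j(1)] i j by auto
  have Ad: "dag (edom l) a \<in> ?A" if aA: "a \<in> ?A" for a
    using aA
  proof
    assume "a \<in> earc i ` Arcs (edom h)"
    then obtain b where b: "b \<in> Arcs (edom h)" "a = earc i b" by blast
    have "dag (edom l) a = earc i (dag (edom h) b)" using embeddingD(7)[OF i(1)] i b by simp
    then show ?thesis using conn_graphD(4)[OF embeddingD(1)[OF h(1)] b(1)] by simp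
  next
    assume "a \<in> earc j ` Arcs (edom k)"
    then obtain b where b: "b \<in> Arcs (edom k)" "a = earc j b" by blast
    have "dag (edom l) a = earc j (dag (edom k) b)" using embeddingD(7)[OF j(1)] j b by simp
    then show ?thesis using conn_graphD(4)[OF embeddingD(1)[OF k(1)] b(1)] by simp
  qed
  have AD: "Darts (edom l) \<subseteq> ?A"
  proof
    fix d assume d: "d \<in> Darts (edom l)"
    then have "d \<in> darts_at (edom l) (vert_image i) \<or> d \<in> darts_at (edom l) (vert_image j)"
      using V conn_graphD(7)[OF L d] by (auto simp: darts_at_def)
    then show "d \<in> ?A"
      using embedding_arcs[OF i(1)] embedding_arcs[OF j(1)] i(2) j(2) by auto
  qed
  have "Arcs (edom l) \<subseteq> ?A"
  proof (cases "Verts (edom l) = {}")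
    case True
    have "Arcs (edom h) \<noteq> {}"
    proof -
      have "Verts (edom h) = {}" using True V i(2) by (auto simp: vert_image_def)
      then show ?thesis using no_verts(2)[OF embeddingD(1)[OF h(1)]] by auto
    qed
    then obtain b where b: "b \<in> ?A" by auto
    then have "Arcs (edom l) = {b, dag (edom l) b}" using no_verts(3)[OF L True] As by blast
    then show ?thesis using b Ad[OF b] by (metis empty_subsetI insert_subset)
  next
    case False
    show ?thesis
    proof
      fix a assume aA: "a \<in> Arcs (edom l)"
      then have "a \<in> Darts (edom l) \<or> dag (edom l) a \<in> Darts (edom l)" by (rule dart_or_dag_dart[OF L False])
      then show "a \<in> ?A" using AD Ad[of "dag (edom l) a"] conn_graphD(5)[OF L aA] by auto
    qed
  qed
  then have "?A = Arcs (edom l)" using As by blast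
  moreover have "evert i ` Verts (edom h) \<union> evert j ` Verts (edom k) = Verts (edom l)"
    using V i(2) j(2) by (simp add: vert_image_def)
  ultimately show "is_union x y z"
    unfolding is_union_def
    by (intro bexI[OF _ l(2)] bexI[OF _ h(2)] bexI[OF _ k(2)] exI[of _ i] exI[of _ j] conjI f g)
qed

text \<open>
  The order is definable from unions, so that graph maps are monotone.
\<close>

lemma emb_le_iff_union:
  assumes "x \<in> Emb G" "y \<in> Emb G"
  shows "emb_le G x y \<longleftrightarrow> is_union y y x"
  using is_union_iff[OF assms(2,2,1)] by (auto simp: emb_le_def pair_le_def)

section \<open>Embeddings as regions\<close>

text \<open>
  The pairs \<open>(W, B)\<close> that come from embeddings with at least one vertex:
  \<open>B\<close> consists of arcs opposite to darts of \<open>W\<close>, contains those which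
  are not themselves darts of \<open>W\<close>, cuts edges inside \<open>W\<close> from both
  sides, and \<open>W\<close> is connected by the edges that are not cut.
\<close>

definition region :: "graph \<Rightarrow> nat set \<Rightarrow> nat set \<Rightarrow> bool" where
  "region G W B \<longleftrightarrow> W \<noteq> {} \<and> W \<subseteq> Verts G \<and> B \<subseteq> dag G ` darts_at G W \<and>
     (\<forall>d\<in>darts_at G W. dag G d \<notin> darts_at G W \<longrightarrow> dag G d \<in> B) \<and>
     (\<forall>d\<in>darts_at G W \<inter> B. dag G d \<in> B) \<and>
     (\<forall>Q. (\<exists>v\<in>W. Q v) \<longrightarrow>
        (\<forall>d\<in>darts_at G W. dag G d \<in> darts_at G W \<longrightarrow> dag G d \<notin> B \<longrightarrow> Q (att G d) \<longrightarrow> Q (att G (dag G d))) \<longrightarrow>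
        (\<forall>v\<in>W. Q v))"

text \<open>
  By injectivity on darts the edges inside the image are of two kinds: either both arcs come
  from the darts of one edge of the domain, or the edge is cut and both arcs are hit by the
  boundary as well.
\<close>

lemma embedding_region:
  assumes e: "is_embedding G h" and ne: "vert_image h \<noteq> {}"
  shows "region G (vert_image h) (bdry_image h)"
proof -
  note H = embeddingD(1)[OF e] and G = embeddingD(2)[OF e] and D = embedding_darts[OF e]
  have V: "Verts (edom h) \<noteq> {}" using ne by (simp add: vert_image_def)
  note hg = conn_graphD[OF H] and gg = conn_graphD[OF G]
  have bnd: "\<exists>\<delta>\<in>Darts (edom h). \<beta> = dag (edom h) \<delta> \<and> earc h \<beta> = dag G (earc h \<delta>) \<and> dag G (earc h \<beta>) = earc h \<delta>"
    if b: "\<beta> \<in> graph_boundary (edom h)" for \<beta>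
  proof -
    have bA: "\<beta> \<in> Arcs (edom h)" using b by (simp add: graph_boundary_def)
    show ?thesis
      using dag_boundary_dart[OF H V b] hg(5)[OF bA] embeddingD(7)[OF e bA] embeddingD(7)[OF e hg(4)[OF bA]]
      by (intro bexI[of _ "dag (edom h) \<beta>"]) auto
  qed
  have uncut: "dag G (earc h \<delta>) \<notin> bdry_image h" if d: "\<delta> \<in> Darts (edom h)" "dag (edom h) \<delta> \<in> Darts (edom h)" for \<delta>
  proof
    assume "dag G (earc h \<delta>) \<in> bdry_image h"
    then obtain \<beta> where \<beta>: "\<beta> \<in> graph_boundary (edom h)" "dag G (earc h \<delta>) = earc h \<beta>" by (auto simp: bdry_image_def)
    obtain \<epsilon> where \<epsilon>: "\<epsilon> \<in> Darts (edom h)" "\<beta> = dag (edom h) \<epsilon>" "dag G (earc h \<beta>) = earc h \<epsilon>" using bnd[OF \<beta>(1)] by blast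
    have "earc h \<epsilon> = earc h \<delta>" using \<epsilon>(3) \<beta>(2) gg(5)[OF embeddingD(5)[OF e hg(3)[OF d(1)]]] by simp
    then have "\<epsilon> = \<delta>" by (rule inj_onD[OF embeddingD(10)[OF e]]) (use \<epsilon> d in auto)
    then show False using \<epsilon>(2) \<beta>(1) d(2) by (simp add: graph_boundary_def)
  qed
  have dd: "dag (edom h) \<delta> \<in> Darts (edom h) \<or> dag G (earc h \<delta>) \<in> bdry_image h" if d: "\<delta> \<in> Darts (edom h)" for \<delta>
    using hg(4)[OF hg(3)[OF d]] embeddingD(7)[OF e hg(3)[OF d]] unfolding bdry_image_def graph_boundary_def by force
  have dag_in: "earc h (dag (edom h) \<delta>) = dag G (earc h \<delta>)" if d: "\<delta> \<in> Darts (edom h)" for \<delta>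
    using embeddingD(7)[OF e hg(3)[OF d]] .
  show ?thesis
    unfolding region_def
  proof (intro conjI)
    show "vert_image h \<noteq> {}" by fact
    show "vert_image h \<subseteq> Verts G" by (rule embedding_verts_subset[OF e])
    show "bdry_image h \<subseteq> dag G ` darts_at G (vert_image h)"
      unfolding D[symmetric] bdry_image_def using bnd by fastforce
    show "\<forall>d\<in>darts_at G (vert_image h). dag G d \<notin> darts_at G (vert_image h) \<longrightarrow> dag G d \<in> bdry_image h"
    proof (intro ballI impI)
      fix d assume d: "d \<in> darts_at G (vert_image h)" "dag G d \<notin> darts_at G (vert_image h)"
      then obtain \<delta> where \<delta>: "\<delta> \<in> Darts (edom h)" "d = earc h \<delta>" unfolding D[symmetric] by blast
      have "dag (edom h) \<delta> \<notin> Darts (edom h)"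
        using d(2) \<delta>(2) dag_in[OF \<delta>(1)] unfolding D[symmetric] by (metis imageI)
      then show "dag G d \<in> bdry_image h" using dd[OF \<delta>(1)] \<delta>(2) by simp
    qed
    show "\<forall>d\<in>darts_at G (vert_image h) \<inter> bdry_image h. dag G d \<in> bdry_image h"
    proof
      fix d assume d: "d \<in> darts_at G (vert_image h) \<inter> bdry_image h"
      then obtain \<delta> where \<delta>: "\<delta> \<in> Darts (edom h)" "d = earc h \<delta>" unfolding D[symmetric] by blast
      show "dag G d \<in> bdry_image h"
      proof (rule ccontr)
        assume n: "dag G d \<notin> bdry_image h"
        then have "dag (edom h) \<delta> \<in> Darts (edom h)" using dd[OF \<delta>(1)] \<delta> by simp
        then have "dag G (earc h (dag (edom h) \<delta>)) \<notin> bdry_image h"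
          using uncut[of "dag (edom h) \<delta>"] \<delta> hg(5)[OF hg(3)[OF \<delta>(1)]] by simp
        then show False using dag_in[OF \<delta>(1)] gg(5)[OF embeddingD(5)[OF e hg(3)[OF \<delta>(1)]]] d \<delta> by simp
      qed
    qed
    show "\<forall>Q. (\<exists>v\<in>vert_image h. Q v) \<longrightarrow>
        (\<forall>d\<in>darts_at G (vert_image h). dag G d \<in> darts_at G (vert_image h) \<longrightarrow> dag G d \<notin> bdry_image h \<longrightarrow> Q (att G d) \<longrightarrow> Q (att G (dag G d))) \<longrightarrow>
        (\<forall>v\<in>vert_image h. Q v)"
    proof (intro allI impI)
      fix Q assume ex: "\<exists>v\<in>vert_image h. Q v"
        and st: "\<forall>d\<in>darts_at G (vert_image h). dag G d \<in> darts_at G (vert_image h) \<longrightarrow> dag G d \<notin> bdry_image h \<longrightarrow> Q (att G d) \<longrightarrow> Q (att G (dag G d))"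
      have "\<forall>v\<in>Verts (edom h). Q (evert h v)"
      proof (rule vertex_induct[OF H])
        show "\<exists>v\<in>Verts (edom h). Q (evert h v)" using ex by (auto simp: vert_image_def)
        fix d assume d: "d \<in> Darts (edom h)" "dag (edom h) d \<in> Darts (edom h)" and q: "Q (evert h (att (edom h) d))"
        have "earc h d \<in> darts_at G (vert_image h)" "dag G (earc h d) \<in> darts_at G (vert_image h)"
          unfolding D[symmetric] dag_in[OF d(1), symmetric] using d by blast+
        then have "Q (att G (earc h d)) \<longrightarrow> Q (att G (dag G (earc h d)))" using st uncut[OF d] by blast
        then show "Q (evert h (att (edom h) (dag (edom h) d)))"
          using q embeddingD(9)[OF e d(1)] embeddingD(9)[OF e d(2)] dag_in[OF d(1)] by simp
      qed
      then show "\<forall>v\<in>vert_image h. Q v" by (auto simp: vert_image_def)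
    qed
  qed
qed

text \<open>
  The graph cut out by a region has the darts at \<open>W\<close> and one more arc for each
  element of \<open>B\<close>. An arc of \<open>G\<close> may be needed in both roles, so that
  the two kinds are kept apart as even and odd numbers.
\<close>

lemma region_realize:
  assumes G: "connected_graph G" and r: "region G W B"
  shows "\<exists>x\<in>Emb G. emb_verts x = W \<and> emb_boundary x = B"
proof -
  note g = conn_graphD[OF G]
  let ?D = "darts_at G W"
  have ne: "W \<noteq> {}" and WV: "W \<subseteq> Verts G" and BD: "B \<subseteq> dag G ` ?D"
    and out: "\<And>d. d \<in> ?D \<Longrightarrow> dag G d \<notin> ?D \<Longrightarrow> dag G d \<in> B"
    and cut: "\<And>d. d \<in> ?D \<Longrightarrow> d \<in> B \<Longrightarrow> dag G d \<in> B"
    using r unfolding region_def by auto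
  have ind: "\<forall>v\<in>W. Q v" if "\<exists>v\<in>W. Q v"
      "\<And>d. d \<in> ?D \<Longrightarrow> dag G d \<in> ?D \<Longrightarrow> dag G d \<notin> B \<Longrightarrow> Q (att G d) \<Longrightarrow> Q (att G (dag G d))" for Q
    using r that unfolding region_def by blast
  have DA: "d \<in> Darts G" "d \<in> Arcs G" "att G d \<in> W" if "d \<in> ?D" for d using that g(3) by (auto simp: darts_at_def)
  have BA: "b \<in> Arcs G" "dag G b \<in> ?D" if bB: "b \<in> B" for b
  proof -
    obtain d where "d \<in> ?D" "b = dag G d" using BD bB by blast
    then show "b \<in> Arcs G" "dag G b \<in> ?D" using g(4,5) DA by auto
  qed
  \<comment> \<open>A dart whose edge is cut is paired with the copy of its opposite arc in \<open>B\<close>, and with the opposite dart otherwise.\<close>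
  define dg where "dg = (\<lambda>n. if odd n then 2 * dag G (n div 2) else
     if dag G (n div 2) \<in> B then 2 * dag G (n div 2) + 1 else 2 * dag G (n div 2))"
  define K where "K = \<lparr>Arcs = (\<lambda>d. 2 * d) ` ?D \<union> (\<lambda>b. 2 * b + 1) ` B, Darts = (\<lambda>d. 2 * d) ` ?D, Verts = W,
     dag = (\<lambda>n\<in>(\<lambda>d. 2 * d) ` ?D \<union> (\<lambda>b. 2 * b + 1) ` B. dg n),
     att = (\<lambda>n\<in>(\<lambda>d. 2 * d) ` ?D. att G (n div 2))\<rparr>"
  have KA: "n \<in> Arcs K \<longleftrightarrow> (even n \<and> n div 2 \<in> ?D) \<or> (odd n \<and> n div 2 \<in> B)" for n
    by (auto simp: K_def image_iff Suc_double_not_eq_double double_not_eq_Suc_double elim!: evenE oddE)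
  have KD: "n \<in> Darts K \<longleftrightarrow> even n \<and> n div 2 \<in> ?D" for n
    by (auto simp: K_def image_iff elim!: evenE)
  have KV: "Verts K = W" by (simp add: K_def)
  have Kdag: "dag K n = dg n" if "n \<in> Arcs K" for n using that by (simp add: K_def)
  have Katt: "att K n = att G (n div 2)" if "n \<in> Darts K" for n using that by (simp add: K_def)
  have dgA: "dg n \<in> Arcs K" if n: "n \<in> Arcs K" for n
    using n BA out unfolding KA dg_def by auto
  have dgh: "dg n div 2 = dag G (n div 2)" for n by (simp add: dg_def)
  have nA: "n div 2 \<in> Arcs G" if "n \<in> Arcs K" for n using that BA DA unfolding KA by auto
  have dgdg: "dg (dg n) = n" if n: "n \<in> Arcs K" for n
  proof (cases "odd n")
    case True
    then have nB: "n div 2 \<in> B" using n by (simp add: KA)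
    have "dg n = 2 * dag G (n div 2)" using True by (simp add: dg_def)
    then have "dg (dg n) = 2 * (n div 2) + 1" using nB g(5)[OF BA(1)[OF nB]] by (simp add: dg_def)
    then show ?thesis using True by simp
  next
    case False
    then have nD: "n div 2 \<in> ?D" using n by (simp add: KA)
    note gg = g(5)[OF DA(2)[OF nD]]
    show ?thesis
    proof (cases "dag G (n div 2) \<in> B")
      case True then show ?thesis using False gg by (simp add: dg_def)
    next
      case n: False
      have "n div 2 \<notin> B" using cut[OF nD] n by blast
      then show ?thesis using False n gg by (simp add: dg_def)
    qed
  qed
  have fD: "finite ?D" using g(1) by (rule finite_subset[rotated]) (use g(3) in \<open>auto simp: darts_at_def\<close>)
  have fB: "finite B" using BD fD finite_surj by blast
  have KG: "is_graph K"
    unfolding is_graph_def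
  proof (intro conjI ballI)
    show "finite (Arcs K)" using fD fB by (simp add: K_def)
    show "finite (Verts K)" using WV g(2) finite_subset by (simp add: KV)
    show "Darts K \<subseteq> Arcs K" by (auto simp: KA KD)
    show "dag K \<in> Arcs K \<rightarrow>\<^sub>E Arcs K"
      by (rule PiE_I) (use dgA Kdag in \<open>auto simp: K_def\<close>)
    show "att K \<in> Darts K \<rightarrow>\<^sub>E Verts K"
      by (rule PiE_I) (use DA in \<open>auto simp: K_def\<close>)
    show "dag K (dag K a) = a" if "a \<in> Arcs K" for a using that Kdag dgA dgdg by simp
    show "dag K a \<noteq> a" if "a \<in> Arcs K" for a
      using Kdag[OF that] dgh[of a] g(6)[OF nA[OF that]] by metis
  qed
  have KC: "connected_graph K"
  proof (rule vertex_connectedI[OF KG])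
    show "Verts K \<noteq> {}" using ne KV by simp
    show "a \<in> Darts K \<or> dag K a \<in> Darts K" if "a \<in> Arcs K" for a
      using that dgh[of a] BA(2)[of "a div 2"] Kdag[OF that] by (auto simp: KA KD) (auto simp: dg_def)
    fix Q assume ex: "\<exists>v\<in>Verts K. Q v"
      and st: "\<And>d. d \<in> Darts K \<Longrightarrow> dag K d \<in> Darts K \<Longrightarrow> Q (att K d) \<Longrightarrow> Q (att K (dag K d))"
    have "\<forall>v\<in>W. Q v"
    proof (rule ind)
      show "\<exists>v\<in>W. Q v" using ex KV by simp
      fix d assume d: "d \<in> ?D" "dag G d \<in> ?D" "dag G d \<notin> B" and q: "Q (att G d)"
      have k: "2 * d \<in> Darts K" using d by (simp add: KD)
      then have kA: "2 * d \<in> Arcs K" by (auto simp: KA KD)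
      have kd: "dag K (2 * d) = 2 * dag G d" using Kdag[OF kA] d by (simp add: dg_def)
      have k2: "2 * dag G d \<in> Darts K" using d by (simp add: KD)
      show "Q (att G (dag G d))" using st[OF k] q Katt[OF k] Katt[OF k2] k2 kd by simp
    qed
    then show "\<forall>v\<in>Verts K. Q v" using KV by simp
  qed
  define e where "e = \<lparr>edom = K, earc = (\<lambda>n\<in>Arcs K. n div 2), evert = (\<lambda>v\<in>W. v)\<rparr>"
  have KDA: "n \<in> Darts K \<Longrightarrow> n \<in> Arcs K" for n by (auto simp: KA KD)
  have emb: "is_embedding G e"
    unfolding is_embedding_iff
  proof (intro conjI ballI impI)
    show "connected_graph (edom e)" "connected_graph G" using KC G by (auto simp: e_def)
    show "earc e \<in> Arcs (edom e) \<rightarrow>\<^sub>E Arcs G" using nA by (auto simp: e_def)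
    show "evert e \<in> Verts (edom e) \<rightarrow>\<^sub>E Verts G" using WV KV by (auto simp: e_def)
    show "earc e (dag (edom e) a) = dag G (earc e a)" if "a \<in> Arcs (edom e)" for a
      using that Kdag dgA dgh by (simp add: e_def)
    show "earc e d \<in> Darts G" "evert e (att (edom e) d) = att G (earc e d)" if "d \<in> Darts (edom e)" for d
      using that KDA Katt KD DA by (auto simp: e_def)
    show "inj_on (earc e) (Darts (edom e))"
    proof (rule inj_onI)
      fix c d assume "c \<in> Darts (edom e)" "d \<in> Darts (edom e)" "earc e c = earc e d"
      then show "c = d" using KDA KD by (auto simp: e_def elim!: evenE)
    qed
    show "inj_on (evert e) (Verts (edom e))" by (auto simp: e_def KV inj_on_def)
    fix d v assume d: "d \<in> Darts G" and v: "v \<in> Verts (edom e)" and at: "att G d = evert e v"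
    then have "2 * d \<in> Darts K" "att G d = v" by (auto simp: KD e_def KV darts_at_def)
    then show "\<exists>d'\<in>Darts (edom e). att (edom e) d' = v \<and> earc e d' = d"
      using Katt KDA by (intro bexI[of _ "2 * d"]) (auto simp: e_def)
  qed
  have "vert_image e = W" by (auto simp: vert_image_def e_def KV)
  moreover have "bdry_image e = B"
  proof -
    have bd: "n \<in> graph_boundary K \<longleftrightarrow> odd n \<and> n div 2 \<in> B" for n
      unfolding graph_boundary_def Diff_iff KA KD by blast
    have "bdry_image e = (\<lambda>n. n div 2) ` graph_boundary K"
      by (auto simp: bdry_image_def e_def graph_boundary_def)
    moreover have "b \<in> (\<lambda>n. n div 2) ` graph_boundary K" if "b \<in> B" for b
      using that by (intro image_eqI[of _ _ "2 * b + 1"]) (simp_all add: bd)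
    ultimately show ?thesis using bd by auto
  qed
  ultimately show ?thesis using emb_class_Emb[OF emb] emb_class_images[OF emb] by blast
qed

section \<open>Edges and stars\<close>

lemma Emb_region:
  assumes "x \<in> Emb G" "emb_verts x \<noteq> {}"
  shows "region G (emb_verts x) (emb_boundary x)"
  using assms(1) by (rule Emb_E) (use embedding_region assms(2) in auto)

lemma regionD:
  assumes "region G W B"
  shows "W \<noteq> {}" "W \<subseteq> Verts G" "B \<subseteq> dag G ` darts_at G W"
    "d \<in> darts_at G W \<Longrightarrow> dag G d \<notin> darts_at G W \<Longrightarrow> dag G d \<in> B"
    "d \<in> darts_at G W \<Longrightarrow> d \<in> B \<Longrightarrow> dag G d \<in> B"
  using assms unfolding region_def by simp_all

lemma region_induct:
  assumes "region G W B" "v \<in> W" "Q v"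
    "\<And>d. d \<in> darts_at G W \<Longrightarrow> dag G d \<in> darts_at G W \<Longrightarrow> dag G d \<notin> B \<Longrightarrow>
        Q (att G d) \<Longrightarrow> Q (att G (dag G d))" "w \<in> W"
  shows "Q w"
proof -
  have "(\<exists>v\<in>W. Q v) \<longrightarrow>
        (\<forall>d\<in>darts_at G W. dag G d \<in> darts_at G W \<longrightarrow> dag G d \<notin> B \<longrightarrow> Q (att G d) \<longrightarrow> Q (att G (dag G d))) \<longrightarrow>
        (\<forall>v\<in>W. Q v)"
    using assms(1) unfolding region_def by (elim conjE allE[of _ Q])
  then show ?thesis using assms(2-5) by blast
qed

lemma darts_at_mem: "d \<in> darts_at G W \<longleftrightarrow> d \<in> Darts G \<and> att G d \<in> W"
  by (simp add: darts_at_def)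

lemma darts_at_mono: "W \<subseteq> W' \<Longrightarrow> darts_at G W \<subseteq> darts_at G W'"
  by (auto simp: darts_at_def)

lemma emb_boundary_dag:
  assumes x: "x \<in> Emb G" and ne: "emb_verts x \<noteq> {}" and b: "b \<in> emb_boundary x"
  shows "dag G b \<in> darts_at G (emb_verts x)"
proof -
  obtain d where d: "d \<in> darts_at G (emb_verts x)" "b = dag G d" using regionD(3)[OF Emb_region[OF x ne]] b by blast
  have "d \<in> Arcs G" using d conn_graphD(3)[OF Emb_connected[OF x]] by (simp add: darts_at_mem)
  then show ?thesis using d conn_graphD(5)[OF Emb_connected[OF x]] by simp
qed

lemma Emb_no_verts:
  assumes x: "x \<in> Emb G" and e: "emb_verts x = {}"
  shows "\<exists>a\<in>Arcs G. emb_boundary x = {a, dag G a}"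
proof -
  obtain h where h: "is_embedding G h" "emb_verts x = vert_image h" "emb_boundary x = bdry_image h" using x by (rule Emb_E)
  note H = embeddingD(1)[OF h(1)]
  have V: "Verts (edom h) = {}" using h(2) e vert_image_empty_iff[of h] by simp
  obtain a where a: "Arcs (edom h) = {a, dag (edom h) a}" using no_verts(2)[OF H V] by blast
  then have aA: "a \<in> Arcs (edom h)" by blast
  have "bdry_image h = earc h ` Arcs (edom h)" using no_verts(1)[OF H V] by (simp add: bdry_image_def graph_boundary_def)
  also have "\<dots> = {earc h a, dag G (earc h a)}" using embeddingD(7)[OF h(1) aA] by (subst a) simp
  finally show ?thesis using embeddingD(5)[OF h(1) aA] h(3) by auto
qed

lemma edge_graph_connected: "connected_graph edge_graph"
proof (rule connectedI)
  show "is_graph edge_graph" by (auto simp: is_graph_def edge_graph_def)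
  show "Arcs edge_graph \<noteq> {} \<or> Verts edge_graph \<noteq> {}" by (simp add: edge_graph_def)
  fix P Q
  assume ex: "(\<exists>a\<in>Arcs edge_graph. P a) \<or> (\<exists>v\<in>Verts edge_graph. Q v)"
    and dg: "\<And>a. a \<in> Arcs edge_graph \<Longrightarrow> P a \<Longrightarrow> P (dag edge_graph a)"
  have "P 1 \<longrightarrow> P 2" "P 2 \<longrightarrow> P 1" using dg[of 1] dg[of 2] by (auto simp: edge_graph_def)
  then show "(\<forall>a\<in>Arcs edge_graph. P a) \<and> (\<forall>v\<in>Verts edge_graph. Q v)"
    using ex by (auto simp: edge_graph_def)
qed

lemma edge_exists:
  assumes G: "connected_graph G" and a: "a \<in> Arcs G"
  shows "\<exists>x\<in>edge_embs G. emb_verts x = {} \<and> emb_boundary x = {a, dag G a}"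
proof -
  define e where "e = \<lparr>edom = edge_graph, earc = (\<lambda>n\<in>{1, 2}. if n = 1 then a else dag G a), evert = (\<lambda>v\<in>{}. 0)\<rparr>"
  have em: "is_embedding G e"
    unfolding is_embedding_iff using G edge_graph_connected a conn_graphD(4,5)[OF G a]
    by (auto simp: e_def edge_graph_def)
  have "e \<in> emb_class G e" using em by (simp add: emb_class_mem emb_iso_iff)
  then have "emb_class G e \<in> edge_embs G"
    using emb_class_Emb[OF em] unfolding edge_embs_def
    by (intro CollectI conjI bexI[of _ e]) (simp_all add: e_def)
  moreover have "vert_image e = {}" by (simp add: vert_image_def e_def edge_graph_def)
  moreover have "bdry_image e = {a, dag G a}" by (auto simp: bdry_image_def e_def edge_graph_def graph_boundary_def)
  ultimately show ?thesis using emb_class_images[OF em] by auto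
qed

lemma edge_embs_iff: "x \<in> edge_embs G \<longleftrightarrow> x \<in> Emb G \<and> emb_verts x = {}"
proof
  assume "x \<in> edge_embs G"
  then obtain h where x: "x \<in> Emb G" and h: "h \<in> x" "edom h = edge_graph" by (auto simp: edge_embs_def)
  then show "x \<in> Emb G \<and> emb_verts x = {}" using Emb_memD(3)[OF x h(1)] by (simp add: vert_image_def edge_graph_def)
next
  assume x: "x \<in> Emb G \<and> emb_verts x = {}"
  then obtain a where a: "a \<in> Arcs G" "emb_boundary x = {a, dag G a}" using Emb_no_verts by blast
  obtain y where y: "y \<in> edge_embs G" "emb_verts y = {}" "emb_boundary y = {a, dag G a}"
    using edge_exists[OF Emb_connected a(1)] x by blast
  then have "x = y" using x a by (intro Emb_ext[of x G y]) (auto simp: edge_embs_def)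
  then show "x \<in> edge_embs G" using y by simp
qed

lemma star_graph_connected: "connected_graph (star_graph n)"
proof (rule vertex_connectedI)
  show "is_graph (star_graph n)" by (auto simp: is_graph_def star_graph_def)
  show "Verts (star_graph n) \<noteq> {}" by (simp add: star_graph_def)
  show "a \<in> Darts (star_graph n) \<or> dag (star_graph n) a \<in> Darts (star_graph n)" if "a \<in> Arcs (star_graph n)" for a
    using that by (auto simp: star_graph_def)
  show "\<forall>v\<in>Verts (star_graph n). Q v" if "\<exists>v\<in>Verts (star_graph n). Q v" for Q
    using that by (simp add: star_graph_def)
qed

text \<open>
  The second copy of \<open>{..<n}\<close> in the star is opposite to the darts, so the star has
  the largest possible boundary around its vertex: all edges at the vertex are cut.
\<close>

lemma star_embedding_boundary:
  assumes h: "is_embedding G h" and s: "edom h = star_graph n"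
  shows "\<exists>v\<in>Verts G. vert_image h = {v} \<and> bdry_image h = dag G ` darts_at G {v}"
proof -
  let ?v = "evert h 0"
  have V: "vert_image h = {?v}" using s by (simp add: vert_image_def star_graph_def)
  have bd: "graph_boundary (edom h) = dag (edom h) ` Darts (edom h)"
  proof -
    have "{..<n + n} - {..<n} = (\<lambda>a. a + n) ` {..<n}"
    proof (intro equalityI subsetI)
      fix x assume "x \<in> {..<n + n} - {..<n}"
      then show "x \<in> (\<lambda>a. a + n) ` {..<n}" by (intro image_eqI[of _ _ "x - n"]) auto
    qed auto
    then show ?thesis unfolding s graph_boundary_def by (simp add: star_graph_def image_def)
  qed
  have "bdry_image h = (\<lambda>d. earc h (dag (edom h) d)) ` Darts (edom h)" by (simp add: bdry_image_def bd image_image)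
  also have "\<dots> = (\<lambda>d. dag G (earc h d)) ` Darts (edom h)"
    using embeddingD(7)[OF h] conn_graphD(3)[OF embeddingD(1)[OF h]] by simp
  also have "\<dots> = dag G ` darts_at G {?v}" using embedding_darts[OF h] V by (simp add: image_image[symmetric])
  finally show ?thesis using V embedding_verts_subset[OF h] by auto
qed

lemma star_embsD:
  assumes "x \<in> star_embs G"
  shows "x \<in> Emb G" "\<exists>v\<in>Verts G. emb_verts x = {v} \<and> emb_boundary x = dag G ` darts_at G {v}"
proof -
  obtain h n where x: "x \<in> Emb G" and h: "h \<in> x" "edom h = star_graph n" using assms by (auto simp: star_embs_def)
  show "x \<in> Emb G" by fact
  show "\<exists>v\<in>Verts G. emb_verts x = {v} \<and> emb_boundary x = dag G ` darts_at G {v}"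
    using star_embedding_boundary[OF Emb_memD(1)[OF x h(1)] h(2)] Emb_memD(3,4)[OF x h(1)] by simp
qed

lemma star_exists:
  assumes G: "connected_graph G" and v: "v \<in> Verts G"
  shows "\<exists>x\<in>star_embs G. emb_verts x = {v}"
proof -
  note g = conn_graphD[OF G]
  let ?D = "darts_at G {v}"
  have fD: "finite ?D" using g(1) by (rule finite_subset[rotated]) (use g(3) in \<open>auto simp: darts_at_def\<close>)
  define n where "n = card ?D"
  obtain f where f: "bij_betw f {..<n} ?D"
    using ex_bij_betw_nat_finite[OF fD] by (auto simp: n_def atLeast0LessThan)
  have fD': "f i \<in> Darts G" "att G (f i) = v" "f i \<in> Arcs G" if "i < n" for i
    using bij_betwE[OF f] that g(3) by (auto simp: darts_at_def)
  define e where "e = \<lparr>edom = star_graph n, earc = (\<lambda>a\<in>{..<n + n}. if a < n then f a else dag G (f (a - n))),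
    evert = (\<lambda>u\<in>{0}. v)\<rparr>"
  have em: "is_embedding G e"
    unfolding is_embedding_iff
  proof (intro conjI ballI impI)
    show "connected_graph (edom e)" "connected_graph G" using G star_graph_connected by (auto simp: e_def)
    show "earc e \<in> Arcs (edom e) \<rightarrow>\<^sub>E Arcs G" using fD' g(4) by (auto simp: e_def star_graph_def)
    show "evert e \<in> Verts (edom e) \<rightarrow>\<^sub>E Verts G" using v by (auto simp: e_def star_graph_def)
    show "earc e (dag (edom e) a) = dag G (earc e a)" if "a \<in> Arcs (edom e)" for a
      using that fD'(3)[of "a - n"] g(5)[of "f (a - n)"] by (auto simp: e_def star_graph_def)
    show "earc e d \<in> Darts G" "evert e (att (edom e) d) = att G (earc e d)" if "d \<in> Darts (edom e)" for d
      using that fD' by (auto simp: e_def star_graph_def)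
    show "inj_on (earc e) (Darts (edom e))"
      using bij_betw_imp_inj_on[OF f] by (auto simp: e_def star_graph_def inj_on_def)
    show "inj_on (evert e) (Verts (edom e))" by (auto simp: e_def star_graph_def)
    fix d u assume d: "d \<in> Darts G" and u: "u \<in> Verts (edom e)" and at: "att G d = evert e u"
    have u0: "u = 0" using u by (simp add: e_def star_graph_def)
    then have "d \<in> ?D" using d at by (simp add: darts_at_def e_def)
    then obtain i where i: "i < n" "d = f i" using bij_betw_imp_surj_on[OF f] by auto
    show "\<exists>d'\<in>Darts (edom e). att (edom e) d' = u \<and> earc e d' = d"
      using i u0 by (intro bexI[of _ i]) (auto simp: e_def star_graph_def)
  qed
  have "e \<in> emb_class G e" using em by (simp add: emb_class_mem emb_iso_iff)
  then have "emb_class G e \<in> star_embs G"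
    using emb_class_Emb[OF em] unfolding star_embs_def
    by (intro CollectI conjI bexI[of _ e] exI[of _ n]) (simp_all add: e_def)
  moreover have "vert_image e = {v}" by (simp add: vert_image_def e_def star_graph_def)
  ultimately show ?thesis using emb_class_images[OF em] by auto
qed

text \<open>
  By its boundary a star is determined by its vertex, so the description defining
  \<open>vert_emb\<close> is unique.
\<close>

lemma vert_emb:
  assumes G: "connected_graph G" and v: "v \<in> Verts G"
  shows "vert_emb G v \<in> star_embs G" "vert_emb G v \<in> Emb G" "emb_verts (vert_emb G v) = {v}"
    "emb_boundary (vert_emb G v) = dag G ` darts_at G {v}"
proof -
  have "\<exists>!x. x \<in> star_embs G \<and> emb_verts x = {v}"
  proof (rule ex_ex1I)
    show "\<exists>x. x \<in> star_embs G \<and> emb_verts x = {v}" using star_exists[OF G v] by blast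
    fix x y assume x: "x \<in> star_embs G \<and> emb_verts x = {v}" and y: "y \<in> star_embs G \<and> emb_verts y = {v}"
    then have "emb_boundary x = dag G ` darts_at G {v}" "emb_boundary y = dag G ` darts_at G {v}"
      using star_embsD(2)[of x G] star_embsD(2)[of y G] by auto
    then show "x = y" using x y star_embsD(1) by (intro Emb_ext[of x G y]) auto
  qed
  then have *: "vert_emb G v \<in> star_embs G \<and> emb_verts (vert_emb G v) = {v}"
    unfolding vert_emb_def by (rule theI')
  then show "vert_emb G v \<in> star_embs G" "vert_emb G v \<in> Emb G" "emb_verts (vert_emb G v) = {v}"
    "emb_boundary (vert_emb G v) = dag G ` darts_at G {v}"
    using star_embsD[of "vert_emb G v" G] by auto
qed

text \<open>
  Stars are the smallest embeddings with at least one vertex.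
\<close>

lemma vert_emb_le:
  assumes x: "x \<in> Emb G" and v: "v \<in> emb_verts x"
  shows "emb_le G (vert_emb G v) x"
proof -
  have "v \<in> Verts G" using v Emb_subset(1)[OF x] by blast
  then show ?thesis using vert_emb[OF Emb_connected[OF x]] v by (simp add: emb_le_def pair_le_def)
qed

lemma eq_vert_embI:
  assumes x: "x \<in> Emb G" and V: "emb_verts x = {v}" and le: "emb_le G x (vert_emb G v)"
  shows "x = vert_emb G v"
proof -
  have v: "v \<in> Verts G" using V Emb_subset(1)[OF x] by blast
  note s = vert_emb[OF Emb_connected[OF x] v]
  have "dag G ` darts_at G {v} \<subseteq> emb_boundary x" using le s V by (simp add: emb_le_def pair_le_def)
  moreover have "emb_boundary x \<subseteq> dag G ` darts_at G {v}" using regionD(3)[OF Emb_region[OF x]] V by simp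
  ultimately show ?thesis using s V x by (intro Emb_ext[OF x s(2)]) auto
qed

lemma emb_le_antisym:
  assumes x: "x \<in> Emb G" and y: "y \<in> Emb G" and xy: "emb_le G x y" and yx: "emb_le G y x"
  shows "x = y"
proof (rule Emb_ext[OF x y])
  show V: "emb_verts x = emb_verts y" using xy yx unfolding emb_le_def pair_le_def by blast
  show "emb_boundary x = emb_boundary y"
  proof (cases "emb_verts x = {}")
    case True
    have Vy: "emb_verts y = {}" using True V by simp
    have D: "darts_at G {} = {}" by (simp add: darts_at_def)
    have "emb_boundary x \<subseteq> emb_boundary y" "emb_boundary y \<subseteq> emb_boundary x"
      using xy yx by (simp_all add: emb_le_def pair_le_def True Vy D)
    then show ?thesis by blast
  next
    case False
    have "emb_boundary x \<subseteq> dag G ` darts_at G (emb_verts x)" by (rule regionD(3)[OF Emb_region[OF x False]])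
    moreover have "emb_boundary y \<subseteq> dag G ` darts_at G (emb_verts x)"
      using regionD(3)[OF Emb_region[OF y]] False V by simp
    moreover have "emb_boundary y \<inter> dag G ` darts_at G (emb_verts x) \<subseteq> emb_boundary x"
      using xy by (simp add: emb_le_def pair_le_def)
    moreover have "emb_boundary x \<inter> dag G ` darts_at G (emb_verts x) \<subseteq> emb_boundary y"
      using yx by (simp add: emb_le_def pair_le_def V)
    ultimately show ?thesis by blast
  qed
qed

text \<open>
  The identity cuts nothing, hence is the largest embedding.
\<close>

lemma emb_le_id:
  assumes x: "x \<in> Emb G"
  shows "emb_le G x (id_emb G)"
proof -
  note G = Emb_connected[OF x]
  note i = id_emb[OF G]
  have "graph_boundary G \<inter> dag G ` darts_at G (emb_verts x) \<subseteq> emb_boundary x"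
  proof (cases "emb_verts x = {}")
    case False
    then show ?thesis using regionD(4)[OF Emb_region[OF x False]] by (auto simp: graph_boundary_def darts_at_mem)
  qed (simp add: darts_at_def)
  moreover have "emb_boundary x \<subseteq> darts_at G (Verts G) \<union> graph_boundary G"
    using Emb_subset[OF x] darts_at_Verts[OF G] arcs_split[OF G] by simp
  ultimately show ?thesis using i Emb_subset(1)[OF x] by (simp add: emb_le_def pair_le_def)
qed

lemma star_graph_id_emb: "id_emb (star_graph n) = vert_emb (star_graph n) 0"
proof -
  note S = star_graph_connected[of n]
  have V: "0 \<in> Verts (star_graph n)" by (simp add: star_graph_def)
  have m: "emb_unit (star_graph n) \<in> id_emb (star_graph n)"
    using emb_unit_embedding[OF S] by (simp add: id_emb_class emb_class_mem emb_iso_iff)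
  have "id_emb (star_graph n) \<in> star_embs (star_graph n)"
    using id_emb(1)[OF S] m unfolding star_embs_def by (auto intro!: bexI[OF _ m])
  then have "emb_boundary (id_emb (star_graph n)) = dag (star_graph n) ` darts_at (star_graph n) {0}"
    using star_embsD(2) id_emb(2)[OF S] by (fastforce simp: star_graph_def)
  then show ?thesis using vert_emb[OF S V] id_emb[OF S] by (intro Emb_ext[of _ "star_graph n"]) (auto simp: star_graph_def)
qed

section \<open>Graph maps and regions\<close>

definition gverts :: "graph_map \<Rightarrow> nat \<Rightarrow> nat set" where
  "gverts \<phi> v = emb_verts (gemb \<phi> (vert_emb (gsrc \<phi>) v))"

lemma graph_mapD:
  assumes "is_graph_map \<phi>"
  shows "connected_graph (gsrc \<phi>)" "connected_graph (gtgt \<phi>)"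
    "garc \<phi> \<in> Arcs (gsrc \<phi>) \<rightarrow>\<^sub>E Arcs (gtgt \<phi>)" "a \<in> Arcs (gsrc \<phi>) \<Longrightarrow> garc \<phi> a \<in> Arcs (gtgt \<phi>)"
    "a \<in> Arcs (gsrc \<phi>) \<Longrightarrow> garc \<phi> (dag (gsrc \<phi>) a) = dag (gtgt \<phi>) (garc \<phi> a)"
    "gemb \<phi> \<in> Emb (gsrc \<phi>) \<rightarrow>\<^sub>E Emb (gtgt \<phi>)" "x \<in> Emb (gsrc \<phi>) \<Longrightarrow> gemb \<phi> x \<in> Emb (gtgt \<phi>)"
    "x \<in> edge_embs (gsrc \<phi>) \<Longrightarrow> gemb \<phi> x \<in> edge_embs (gtgt \<phi>)"
    "x \<in> Emb (gsrc \<phi>) \<Longrightarrow> y \<in> Emb (gsrc \<phi>) \<Longrightarrow> z \<in> Emb (gsrc \<phi>) \<Longrightarrow> is_union x y z \<Longrightarrow>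
        is_union (gemb \<phi> x) (gemb \<phi> y) (gemb \<phi> z)"
    "x \<in> Emb (gsrc \<phi>) \<Longrightarrow> y \<in> Emb (gsrc \<phi>) \<Longrightarrow> emb_verts x \<inter> emb_verts y = {} \<Longrightarrow>
        emb_verts (gemb \<phi> x) \<inter> emb_verts (gemb \<phi> y) = {}"
    "x \<in> Emb (gsrc \<phi>) \<Longrightarrow> bij_betw (garc \<phi>) (emb_boundary x) (emb_boundary (gemb \<phi> x))"
  using assms unfolding is_graph_map_def by (blast dest: PiE_mem)+

lemma graph_map_mono:
  assumes "is_graph_map \<phi>" "x \<in> Emb (gsrc \<phi>)" "y \<in> Emb (gsrc \<phi>)" "emb_le (gsrc \<phi>) x y"
  shows "emb_le (gtgt \<phi>) (gemb \<phi> x) (gemb \<phi> y)"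
  using assms graph_mapD(7,9)[OF assms(1)] emb_le_iff_union by metis

text \<open>
  Embeddings with a vertex can be built up one vertex at a time: by connectedness some edge of
  \<open>x\<close> that is not cut leaves the vertices of \<open>y\<close>. Its far end
  \<open>w\<close> is added, and edges are cut only where \<open>x\<close> cuts them or where
  they leave the enlarged vertex set.
\<close>

lemma emb_grow:
  assumes x: "x \<in> Emb G" and y: "y \<in> Emb G" and le: "emb_le G y x"
    and ne: "emb_verts y \<noteq> {}" and neq: "emb_verts y \<noteq> emb_verts x"
  shows "\<exists>w\<in>emb_verts x - emb_verts y. \<exists>y'\<in>Emb G. emb_le G y' x \<and> emb_le G y y' \<and>
     emb_verts y' = insert w (emb_verts y)"
proof -
  note G = Emb_connected[OF x] and g = conn_graphD[OF Emb_connected[OF x]]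
  let ?V = "emb_verts x" and ?U = "emb_verts y"
  have UV: "?U \<subseteq> ?V" and BU: "emb_boundary x \<inter> dag G ` darts_at G ?U \<subseteq> emb_boundary y"
    using le by (auto simp: emb_le_def pair_le_def)
  have rx: "region G ?V (emb_boundary x)" using Emb_region[OF x] ne UV by auto
  have ry: "region G ?U (emb_boundary y)" using Emb_region[OF y] ne by auto
  obtain d0 where d0: "d0 \<in> darts_at G ?V" "dag G d0 \<in> darts_at G ?V" "dag G d0 \<notin> emb_boundary x"
    "att G d0 \<in> ?U" "att G (dag G d0) \<notin> ?U"
  proof (rule ccontr)
    assume n: "\<not> thesis"
    note dd = that
    obtain u where u: "u \<in> ?U" using ne by blast
    have "w \<in> ?U" if wV: "w \<in> ?V" for w
    proof (rule region_induct[OF rx, of u "\<lambda>v. v \<in> ?U" w])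
      show "u \<in> ?V" "u \<in> ?U" using u UV by auto
      fix d assume "d \<in> darts_at G ?V" "dag G d \<in> darts_at G ?V" "dag G d \<notin> emb_boundary x" "att G d \<in> ?U"
      then show "att G (dag G d) \<in> ?U" using dd[of d] n by blast
    qed (fact wV)
    then show False using UV neq by blast
  qed
  define w where "w = att G (dag G d0)"
  let ?S = "insert w ?U"
  have SV: "?S \<subseteq> ?V" using UV d0 by (auto simp: w_def darts_at_mem)
  define B where "B = {dag G d |d. d \<in> darts_at G ?S \<and> (dag G d \<notin> darts_at G ?S \<or> dag G d \<in> emb_boundary x)}"
  have DA: "d \<in> Arcs G" if "d \<in> darts_at G T" for d T using that g(3) by (simp add: darts_at_mem)
  have BI: "dag G d \<in> B \<longleftrightarrow> dag G d \<notin> darts_at G ?S \<or> dag G d \<in> emb_boundary x" if d: "d \<in> darts_at G ?S" for d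
  proof
    assume "dag G d \<in> B"
    then show "dag G d \<notin> darts_at G ?S \<or> dag G d \<in> emb_boundary x" by (auto simp: B_def)
  next
    assume "dag G d \<notin> darts_at G ?S \<or> dag G d \<in> emb_boundary x"
    then show "dag G d \<in> B" using d by (auto simp: B_def)
  qed
  have US: "darts_at G ?U \<subseteq> darts_at G ?S" and SVd: "darts_at G ?S \<subseteq> darts_at G ?V"
    using SV by (auto intro!: darts_at_mono)
  have cutx: "dag G d \<in> emb_boundary x" if "d \<in> darts_at G ?S" "d \<in> emb_boundary x" for d
    using regionD(5)[OF rx, of d] that SVd by blast
  have d0S: "d0 \<in> darts_at G ?S" "dag G d0 \<in> darts_at G ?S" using d0 by (auto simp: darts_at_mem w_def)
  have d0dd: "dag G (dag G d0) = d0" using g(5) DA[OF d0(1)] by simp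
  have region: "region G ?S B"
    unfolding region_def
  proof (intro conjI ballI impI allI)
    show "?S \<noteq> {}" by simp
    show "?S \<subseteq> Verts G" using SV regionD(2)[OF rx] by blast
    show "B \<subseteq> dag G ` darts_at G ?S" by (auto simp: B_def)
    show "dag G d \<in> B" if "d \<in> darts_at G ?S" "dag G d \<notin> darts_at G ?S" for d using that BI by blast
    show "dag G e \<in> B" if e: "e \<in> darts_at G ?S \<inter> B" for e
    proof -
      obtain d where d: "d \<in> darts_at G ?S" "e = dag G d" using e by (auto simp: B_def)
      then have "e \<in> emb_boundary x" using e BI[OF d(1)] by blast
      then show ?thesis using BI[of e] cutx e by blast
    qed
    fix Q v assume ex: "\<exists>v\<in>?S. Q v"
      and st: "\<forall>d\<in>darts_at G ?S. dag G d \<in> darts_at G ?S \<longrightarrow> dag G d \<notin> B \<longrightarrow> Q (att G d) \<longrightarrow> Q (att G (dag G d))"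
      and v: "v \<in> ?S"
    \<comment> \<open>The edge of \<open>d0\<close> is not cut, so \<open>Q\<close> passes along it in both directions.\<close>
    have uw: "Q (att G d0) \<longrightarrow> Q w" using st d0S BI[OF d0S(1)] d0(3) by (auto simp: w_def)
    have "d0 \<notin> emb_boundary x" using cutx[OF d0S(1)] d0(3) by blast
    then have wu: "Q w \<longrightarrow> Q (att G d0)"
      using st d0S BI[OF d0S(2)] d0dd by (auto simp: w_def)
    have "\<exists>u\<in>?U. Q u" using ex wu d0(4) by auto
    then obtain u where u: "u \<in> ?U" "Q u" by blast
    have U: "Q u'" if "u' \<in> ?U" for u'
    proof (rule region_induct[OF ry u(1) _ _ that])
      show "Q u" by fact
      fix d assume d: "d \<in> darts_at G ?U" "dag G d \<in> darts_at G ?U" "dag G d \<notin> emb_boundary y" "Q (att G d)"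
      have "dag G d \<notin> emb_boundary x" using BU d by blast
      then show "Q (att G (dag G d))" using st d US BI[of d] by blast
    qed
    show "Q v" using v U uw d0(4) by blast
  qed
  obtain y' where y': "y' \<in> Emb G" "emb_verts y' = ?S" "emb_boundary y' = B"
    using region_realize[OF G region] by blast
  have "emb_le G y' x" unfolding emb_le_def pair_le_def y' using SV by (auto simp: B_def)
  moreover have "emb_le G y y'"
    unfolding emb_le_def pair_le_def y'
  proof (intro conjI impI)
    show "?U \<subseteq> ?S" by blast
    show "B \<inter> dag G ` darts_at G ?U \<subseteq> emb_boundary y"
    proof
      fix c assume "c \<in> B \<inter> dag G ` darts_at G ?U"
      then obtain d where d: "d \<in> darts_at G ?U" "c = dag G d" "c \<in> B" by blast
      then have "c \<notin> darts_at G ?S \<or> c \<in> emb_boundary x" using BI[of d] US by blast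
      then show "c \<in> emb_boundary y" using regionD(4)[OF ry d(1)] d US BU by blast
    qed
  qed (use ne in blast)
  moreover have "w \<in> ?V - ?U" using d0 SV by (auto simp: w_def)
  ultimately show ?thesis using y' by blast
qed

text \<open>
  Vertices of the image are added up over the vertices of the embedding. Along the filtration of
  \<open>emb_grow\<close> each stage is the union of the preceding one and a star.
\<close>

lemma graph_map_verts:
  assumes \<phi>: "is_graph_map \<phi>" and x: "x \<in> Emb (gsrc \<phi>)"
  shows "emb_verts (gemb \<phi> x) = (\<Union>v\<in>emb_verts x. gverts \<phi> v)"
proof (cases "emb_verts x = {}")
  case True
  then have "x \<in> edge_embs (gsrc \<phi>)" using x by (simp add: edge_embs_iff)
  then show ?thesis using graph_mapD(8)[OF \<phi>] True by (simp add: edge_embs_iff)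
next
  case False
  let ?G = "gsrc \<phi>" and ?G' = "gtgt \<phi>"
  note G = graph_mapD(1)[OF \<phi>]
  have un: "emb_verts (gemb \<phi> p) = emb_verts (gemb \<phi> q) \<union> emb_verts (gemb \<phi> r)"
    if "p \<in> Emb ?G" "q \<in> Emb ?G" "r \<in> Emb ?G" "emb_le ?G q p" "emb_le ?G r p" "emb_verts p = emb_verts q \<union> emb_verts r" for p q r
    using graph_mapD(9)[OF \<phi> that(1-3)] is_union_iff[OF that(1-3)] that(4-6)
      is_union_iff[OF graph_mapD(7)[OF \<phi> that(1)] graph_mapD(7)[OF \<phi> that(2)] graph_mapD(7)[OF \<phi> that(3)]] by blast
  have fin: "finite (emb_verts x)" using Emb_subset(1)[OF x] conn_graphD(2)[OF G] finite_subset by blast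
  \<comment> \<open>Additivity is propagated from any part \<open>y\<close> to \<open>x\<close>, by induction on the number of missing vertices.\<close>
  have main: "emb_verts (gemb \<phi> x) = (\<Union>v\<in>emb_verts x. gverts \<phi> v)"
    if "y \<in> Emb ?G" "emb_verts y \<noteq> {}" "emb_le ?G y x" "emb_verts (gemb \<phi> y) = (\<Union>v\<in>emb_verts y. gverts \<phi> v)" for y
    using that
  proof (induction "card (emb_verts x - emb_verts y)" arbitrary: y rule: less_induct)
    case less
    show ?case
    proof (cases "emb_verts y = emb_verts x")
      case True
      then show ?thesis using un[OF x less.prems(1,1,3,3)] less.prems(4) by simp
    next
      case False
      obtain w y' where w: "w \<in> emb_verts x - emb_verts y" and y': "y' \<in> Emb ?G" "emb_le ?G y' x" "emb_le ?G y y'"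
        "emb_verts y' = insert w (emb_verts y)"
        using emb_grow[OF x less.prems(1,3,2) False] by blast
      have wV: "w \<in> Verts ?G" using w Emb_subset(1)[OF x] by blast
      have "emb_verts (gemb \<phi> y') = emb_verts (gemb \<phi> y) \<union> gverts \<phi> w"
        unfolding gverts_def
        by (rule un[OF y'(1) less.prems(1) vert_emb(2)[OF G wV] y'(3) vert_emb_le[OF y'(1)]])
          (use y' vert_emb(3)[OF G wV] in auto)
      then have "emb_verts (gemb \<phi> y') = (\<Union>v\<in>emb_verts y'. gverts \<phi> v)" using less.prems(4) y'(4) by auto
      moreover have "card (emb_verts x - emb_verts y') < card (emb_verts x - emb_verts y)"
        using fin w y'(4) by (intro psubset_card_mono) auto
      ultimately show ?thesis using less.hyps[of y'] y' by simp
    qed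
  qed
  obtain v where v: "v \<in> emb_verts x" using False by blast
  then have vV: "v \<in> Verts ?G" using Emb_subset(1)[OF x] by blast
  show ?thesis
    by (rule main[OF vert_emb(2)[OF G vV] _ vert_emb_le[OF x v]]) (use vert_emb(3)[OF G vV] in \<open>auto simp: gverts_def\<close>)
qed

lemma graph_map_disjoint:
  assumes "is_graph_map \<phi>" "v \<in> Verts (gsrc \<phi>)" "w \<in> Verts (gsrc \<phi>)" "v \<noteq> w"
  shows "gverts \<phi> v \<inter> gverts \<phi> w = {}"
  using graph_mapD(10)[OF assms(1)] vert_emb(2,3)[OF graph_mapD(1)[OF assms(1)]] assms(2-4)
  unfolding gverts_def by simp

lemma graph_map_boundary:
  assumes "is_graph_map \<phi>" "x \<in> Emb (gsrc \<phi>)"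
  shows "inj_on (garc \<phi>) (emb_boundary x)" "emb_boundary (gemb \<phi> x) = garc \<phi> ` emb_boundary x"
  using graph_mapD(11)[OF assms] by (auto simp: bij_betw_def)

text \<open>
  Vertices of \<open>gemb \<phi> x\<close> are determined by \<open>gverts\<close>, its boundary
  by \<open>garc\<close>, and these two sets determine the class.
\<close>

lemma graph_map_ext:
  assumes \<phi>: "is_graph_map \<phi>" and \<psi>: "is_graph_map \<psi>"
    and s: "gsrc \<phi> = gsrc \<psi>" and t: "gtgt \<phi> = gtgt \<psi>" and a: "garc \<phi> = garc \<psi>"
    and v: "\<And>v. v \<in> Verts (gsrc \<phi>) \<Longrightarrow> gverts \<phi> v = gverts \<psi> v"
  shows "\<phi> = \<psi>"
proof -
  have "gemb \<phi> = gemb \<psi>"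
  proof (rule PiE_ext[OF graph_mapD(6)[OF \<phi>]])
    show "gemb \<psi> \<in> Emb (gsrc \<phi>) \<rightarrow>\<^sub>E Emb (gtgt \<phi>)" using graph_mapD(6)[OF \<psi>] s t by simp
    fix x assume x: "x \<in> Emb (gsrc \<phi>)"
    then have x': "x \<in> Emb (gsrc \<psi>)" using s by simp
    show "gemb \<phi> x = gemb \<psi> x"
    proof (rule Emb_ext)
      show "gemb \<phi> x \<in> Emb (gtgt \<phi>)" "gemb \<psi> x \<in> Emb (gtgt \<phi>)"
        using graph_mapD(7)[OF \<phi> x] graph_mapD(7)[OF \<psi> x'] t by auto
      show "emb_verts (gemb \<phi> x) = emb_verts (gemb \<psi> x)"
        unfolding graph_map_verts[OF \<phi> x] graph_map_verts[OF \<psi> x']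
        by (rule SUP_cong[OF refl]) (use v Emb_subset(1)[OF x] in blast)
      show "emb_boundary (gemb \<phi> x) = emb_boundary (gemb \<psi> x)"
        using graph_map_boundary(2)[OF \<phi> x] graph_map_boundary(2)[OF \<psi> x'] a by simp
    qed
  qed
  then show ?thesis using s t a by (intro graph_map.equality) auto
qed

text \<open>
  A converse to \<open>graph_map_verts\<close>: additivity on vertices together with
  monotonicity gives back preservation of unions.
\<close>

lemma graph_mapI:
  assumes G: "connected_graph (gsrc \<phi>)" and G': "connected_graph (gtgt \<phi>)"
    and ar: "garc \<phi> \<in> Arcs (gsrc \<phi>) \<rightarrow>\<^sub>E Arcs (gtgt \<phi>)"
    and dg: "\<And>a. a \<in> Arcs (gsrc \<phi>) \<Longrightarrow> garc \<phi> (dag (gsrc \<phi>) a) = dag (gtgt \<phi>) (garc \<phi> a)"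
    and em: "gemb \<phi> \<in> Emb (gsrc \<phi>) \<rightarrow>\<^sub>E Emb (gtgt \<phi>)"
    and bij: "\<And>x. x \<in> Emb (gsrc \<phi>) \<Longrightarrow> bij_betw (garc \<phi>) (emb_boundary x) (emb_boundary (gemb \<phi> x))"
    and V: "\<And>x. x \<in> Emb (gsrc \<phi>) \<Longrightarrow> emb_verts (gemb \<phi> x) = (\<Union>v\<in>emb_verts x. F v)"
    and F: "\<And>v w. v \<in> Verts (gsrc \<phi>) \<Longrightarrow> w \<in> Verts (gsrc \<phi>) \<Longrightarrow> v \<noteq> w \<Longrightarrow> F v \<inter> F w = {}"
    and le: "\<And>x y. x \<in> Emb (gsrc \<phi>) \<Longrightarrow> y \<in> Emb (gsrc \<phi>) \<Longrightarrow> emb_le (gsrc \<phi>) x y \<Longrightarrow>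
       emb_le (gtgt \<phi>) (gemb \<phi> x) (gemb \<phi> y)"
  shows "is_graph_map \<phi>"
  unfolding is_graph_map_def
proof (intro conjI ballI impI)
  have emE: "gemb \<phi> x \<in> Emb (gtgt \<phi>)" if "x \<in> Emb (gsrc \<phi>)" for x using em that by (rule PiE_mem)
  show "gemb \<phi> x \<in> edge_embs (gtgt \<phi>)" if "x \<in> edge_embs (gsrc \<phi>)" for x
    using that V[of x] emE by (simp add: edge_embs_iff)
  show "is_union (gemb \<phi> x) (gemb \<phi> y) (gemb \<phi> z)"
    if "x \<in> Emb (gsrc \<phi>)" "y \<in> Emb (gsrc \<phi>)" "z \<in> Emb (gsrc \<phi>)" "is_union x y z" for x y z
  proof -
    have u: "emb_le (gsrc \<phi>) y x \<and> emb_le (gsrc \<phi>) z x \<and> emb_verts x = emb_verts y \<union> emb_verts z"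
      using is_union_iff[OF that(1-3)] that(4) by blast
    then show ?thesis
      unfolding is_union_iff[OF emE[OF that(1)] emE[OF that(2)] emE[OF that(3)]]
      using le[OF that(2,1)] le[OF that(3,1)] V[OF that(1)] V[OF that(2)] V[OF that(3)] by auto
  qed
  show "emb_verts (gemb \<phi> x) \<inter> emb_verts (gemb \<phi> y) = {}"
    if "x \<in> Emb (gsrc \<phi>)" "y \<in> Emb (gsrc \<phi>)" "emb_verts x \<inter> emb_verts y = {}" for x y
  proof -
    have "F v \<inter> F w = {}" if "v \<in> emb_verts x" "w \<in> emb_verts y" for v w
      using that F[of v w] Emb_subset(1)[of x "gsrc \<phi>"] Emb_subset(1)[of y "gsrc \<phi>"]
        \<open>x \<in> Emb (gsrc \<phi>)\<close> \<open>y \<in> Emb (gsrc \<phi>)\<close> \<open>emb_verts x \<inter> emb_verts y = {}\<close> by blast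
    then show ?thesis using V[OF that(1)] V[OF that(2)] by blast
  qed
qed (use assms in auto)

section \<open>Cutting an edge\<close>

definition cut_rel :: "graph \<Rightarrow> nat \<Rightarrow> (nat \<times> nat) set" where
  "cut_rel G a = {(u, v). \<exists>d\<in>Darts G. dag G d \<in> Darts G \<and> d \<noteq> a \<and> d \<noteq> dag G a \<and> att G d = u \<and> att G (dag G d) = v}"

text \<open>
  The vertices that remain connected to the base of \<open>dag G a\<close> when the edge of
  \<open>a\<close> is cut.
\<close>

definition cut_side :: "graph \<Rightarrow> nat \<Rightarrow> nat set" where
  "cut_side G a = {v. (att G (dag G a), v) \<in> (cut_rel G a)\<^sup>*}"

lemma cut_side_start: "att G (dag G a) \<in> cut_side G a"
  by (simp add: cut_side_def)

lemma cut_side_step: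
  assumes "d \<in> Darts G" "dag G d \<in> Darts G" "d \<noteq> a" "d \<noteq> dag G a" "att G d \<in> cut_side G a"
  shows "att G (dag G d) \<in> cut_side G a"
proof -
  have "(att G d, att G (dag G d)) \<in> cut_rel G a" using assms by (auto simp: cut_rel_def)
  then show ?thesis using assms(5) unfolding cut_side_def by (auto intro: rtrancl_into_rtrancl)
qed

lemma cut_side_induct:
  assumes "v \<in> cut_side G a" "P (att G (dag G a))"
    "\<And>d. d \<in> Darts G \<Longrightarrow> dag G d \<in> Darts G \<Longrightarrow> d \<noteq> a \<Longrightarrow> d \<noteq> dag G a \<Longrightarrow> att G d \<in> cut_side G a \<Longrightarrow> P (att G d) \<Longrightarrow>
       P (att G (dag G d))"
  shows "P v"
proof -
  have "(att G (dag G a), v) \<in> (cut_rel G a)\<^sup>*" using assms(1) by (simp add: cut_side_def)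
  then show ?thesis
  proof (induction rule: rtrancl_induct)
    case base then show ?case by (rule assms(2))
  next
    case (step y z)
    obtain d where d: "d \<in> Darts G" "dag G d \<in> Darts G" "d \<noteq> a" "d \<noteq> dag G a" "att G d = y" "att G (dag G d) = z"
      using step(2) by (auto simp: cut_rel_def)
    then show ?case using assms(3)[of d] step by (simp add: cut_side_def)
  qed
qed

lemma cut_side_verts:
  assumes G: "connected_graph G" and a: "dag G a \<in> Darts G"
  shows "cut_side G a \<subseteq> Verts G"
proof
  fix v assume "v \<in> cut_side G a"
  then show "v \<in> Verts G" by (rule cut_side_induct) (use conn_graphD(7)[OF G] a in auto)
qed

lemma cut_rel_sym:
  assumes G: "connected_graph G"  and a: "a \<in> Arcs G"
  shows "sym (cut_rel G a)"
proof (rule symI)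
  fix u v assume "(u, v) \<in> cut_rel G a"
  then obtain d where d: "d \<in> Darts G" "dag G d \<in> Darts G" "d \<noteq> a" "d \<noteq> dag G a" "att G d = u" "att G (dag G d) = v"
    by (auto simp: cut_rel_def)
  have dd: "dag G (dag G d) = d" using conn_graphD(3,5)[OF G] d by simp
  have "dag G d \<noteq> a" "dag G d \<noteq> dag G a" using dd d conn_graphD(5)[OF G a] by auto
  then show "(v, u) \<in> cut_rel G a" using d dd by (auto simp: cut_rel_def intro!: bexI[of _ "dag G d"])
qed

lemma cut_rel_dag:
  assumes G: "connected_graph G"  and a: "a \<in> Arcs G"
  shows "cut_rel G (dag G a) = cut_rel G a"
  using conn_graphD(5)[OF G a] by (auto simp: cut_rel_def)

text \<open>
  The two sides of a cut are classes of the same equivalence relation.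
\<close>

lemma cut_side_eq:
  assumes G: "connected_graph G" and a: "a \<in> Arcs G"
    and v: "v \<in> cut_side G a" "v \<in> cut_side G (dag G a)"
  shows "cut_side G (dag G a) = cut_side G a"
proof -
  let ?r = "(cut_rel G a)\<^sup>*" and ?s = "att G (dag G a)" and ?t = "att G (dag G (dag G a))"
  have 1: "(?s, v) \<in> ?r" "(?t, v) \<in> ?r" using v by (simp_all add: cut_side_def cut_rel_dag[OF G a])
  have sy: "sym ?r" by (rule sym_rtrancl[OF cut_rel_sym[OF G a]])
  have "(?s, ?t) \<in> ?r" "(?t, ?s) \<in> ?r"
    using 1 symD[OF sy] by (meson rtrancl_trans)+
  then have "(?t, w) \<in> ?r \<longleftrightarrow> (?s, w) \<in> ?r" for w by (meson rtrancl_trans)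
  then show ?thesis by (simp add: cut_side_def cut_rel_dag[OF G a])
qed

lemma cut_side_cover:
  assumes G: "connected_graph G" and a: "a \<in> Arcs G" and d: "dag G a \<in> Darts G" and v: "v \<in> Verts G"
  shows "v \<in> cut_side G a \<or> (a \<in> Darts G \<and> v \<in> cut_side G (dag G a))"
proof -
  note g = conn_graphD[OF G]
  let ?Q = "\<lambda>v. v \<in> cut_side G a \<or> (a \<in> Darts G \<and> v \<in> cut_side G (dag G a))"
  have "\<forall>v\<in>Verts G. ?Q v"
  proof (rule vertex_induct[OF G])
    show "\<exists>v\<in>Verts G. ?Q v" using cut_side_start[of G a] g(7)[OF d] by blast
    fix e assume e: "e \<in> Darts G" "dag G e \<in> Darts G" and q: "?Q (att G e)"
    consider "e = a" | "e = dag G a" | "e \<noteq> a" "e \<noteq> dag G a" by blast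
    then show "?Q (att G (dag G e))"
    proof cases
      case 1 then show ?thesis using cut_side_start[of G a] by simp
    next
      case 2 then show ?thesis using cut_side_start[of G "dag G a"] e g(5)[OF a] by simp
    next
      case 3
      then show ?thesis using q cut_side_step[OF e, of a] cut_side_step[OF e, of "dag G a"] g(5)[OF a] by auto
    qed
  qed
  then show ?thesis using v by blast
qed

text \<open>
  The component of the cut graph is an embedding, and its boundary consists of original boundary
  arcs and of ends of the cut edge. The arc \<open>a\<close> is always an end; its opposite is
  one exactly when the cut does not disconnect \<open>G\<close>.
\<close>

lemma component_exists:
  assumes G: "connected_graph G" and a: "a \<in> Arcs G" and d: "dag G a \<in> Darts G"
  shows "\<exists>x\<in>Emb G. emb_verts x = cut_side G a \<and> emb_boundary x =
    {c \<in> Arcs G. dag G c \<in> darts_at G (cut_side G a) \<and> (c \<in> graph_boundary G \<or> c = a \<or> c = dag G a)}"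
proof (rule region_realize[OF G])
  note g = conn_graphD[OF G]
  let ?W = "cut_side G a"
  let ?B = "{c \<in> Arcs G. dag G c \<in> darts_at G ?W \<and> (c \<in> graph_boundary G \<or> c = a \<or> c = dag G a)}"
  have DA: "d \<in> Arcs G" if "d \<in> darts_at G T" for d T using that g(3) by (simp add: darts_at_mem)
  show "region G ?W ?B"
    unfolding region_def
  proof (intro conjI ballI impI allI)
    show "?W \<noteq> {}" using cut_side_start by blast
    show "?W \<subseteq> Verts G" by (rule cut_side_verts[OF G d])
    show "?B \<subseteq> dag G ` darts_at G ?W"
    proof
      fix c assume c: "c \<in> ?B"
      then show "c \<in> dag G ` darts_at G ?W" using g(5)[of c] by (intro image_eqI[of _ _ "dag G c"]) auto
    qed
    show "dag G e \<in> ?B" if e: "e \<in> darts_at G ?W" "dag G e \<notin> darts_at G ?W" for e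
    proof -
      have eA: "e \<in> Arcs G" by (rule DA[OF e(1)])
      have "dag G e \<in> graph_boundary G \<or> dag G e = a \<or> dag G e = dag G a"
      proof (rule ccontr)
        assume n: "\<not> ?thesis"
        then have "dag G e \<in> Darts G" using g(4)[OF eA] by (auto simp: graph_boundary_def)
        moreover have "e \<noteq> a" "e \<noteq> dag G a" using n g(5)[OF a] by auto
        ultimately have "att G (dag G e) \<in> ?W" using e(1) by (intro cut_side_step) (auto simp: darts_at_mem)
        then show False using e(2) \<open>dag G e \<in> Darts G\<close> by (simp add: darts_at_mem)
      qed
      then show ?thesis using e(1) g(4,5)[OF eA] by auto
    qed
    show "dag G e \<in> ?B" if e: "e \<in> darts_at G ?W \<inter> ?B" for e
    proof -
      have "e = a \<or> e = dag G a" using e by (auto simp: graph_boundary_def darts_at_mem)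
      then show ?thesis using e g(5)[OF a] g(4)[OF a] a by auto
    qed
    fix Q v
    assume ex: "\<exists>v\<in>?W. Q v"
      and st: "\<forall>d\<in>darts_at G ?W. dag G d \<in> darts_at G ?W \<longrightarrow> dag G d \<notin> ?B \<longrightarrow> Q (att G d) \<longrightarrow> Q (att G (dag G d))"
      and v: "v \<in> ?W"
    obtain u where u: "u \<in> ?W" "Q u" using ex by blast
    have stp: "Q (att G (dag G e))"
      if e: "e \<in> Darts G" "dag G e \<in> Darts G" "e \<noteq> a" "e \<noteq> dag G a" "att G e \<in> ?W" "Q (att G e)" for e
    proof -
      have eA: "e \<in> Arcs G" using e g(3) by simp
      have "dag G e \<noteq> a" "dag G e \<noteq> dag G a" using e g(5)[OF eA] g(5)[OF a] by metis+
      then have "dag G e \<notin> ?B" using e(2) by (auto simp: graph_boundary_def)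
      then show ?thesis using st e cut_side_step[OF e(1-5)] by (auto simp: darts_at_mem)
    qed
    have sy: "sym ((cut_rel G a)\<^sup>*)" by (rule sym_rtrancl[OF cut_rel_sym[OF G a]])
    have "(u, v) \<in> (cut_rel G a)\<^sup>*"
      using u(1) v symD[OF sy] unfolding cut_side_def by (auto intro: rtrancl_trans)
    then have "v \<in> ?W \<and> Q v"
    proof (induction rule: rtrancl_induct)
      case base then show ?case using u by blast
    next
      case (step y z)
      obtain e where e: "e \<in> Darts G" "dag G e \<in> Darts G" "e \<noteq> a" "e \<noteq> dag G a" "att G e = y" "att G (dag G e) = z"
        using step(2) by (auto simp: cut_rel_def)
      then show ?case using stp[of e] cut_side_step[of e G a] step(3) by simp
    qed
    then show "Q v" by blast
  qed
qed

text \<open>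
  An embedding that ends at \<open>a\<close> never crosses the edge of \<open>a\<close>.
\<close>

lemma cut_side_contains:
  assumes x: "x \<in> Emb G" and a: "a \<in> emb_boundary x" and ne: "emb_verts x \<noteq> {}"
  shows "emb_verts x \<subseteq> cut_side G a"
proof
  note r = Emb_region[OF x ne] and G = Emb_connected[OF x]
  note g = conn_graphD[OF G]
  have aA: "a \<in> Arcs G" using a Emb_subset(2)[OF x] by blast
  have ad: "dag G a \<in> darts_at G (emb_verts x)" by (rule emb_boundary_dag[OF x ne a])
  fix v assume v: "v \<in> emb_verts x"
  show "v \<in> cut_side G a"
  proof (rule region_induct[OF r, of "att G (dag G a)" "\<lambda>v. v \<in> cut_side G a"])
    show "att G (dag G a) \<in> emb_verts x" using ad by (simp add: darts_at_mem)
    show "att G (dag G a) \<in> cut_side G a" by (rule cut_side_start)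
    show "v \<in> emb_verts x" by fact
    fix d assume d: "d \<in> darts_at G (emb_verts x)" "dag G d \<in> darts_at G (emb_verts x)"
      "dag G d \<notin> emb_boundary x" "att G d \<in> cut_side G a"
    have "d \<noteq> dag G a" using d(3) a g(5)[OF aA] by auto
    moreover have "d \<noteq> a" using regionD(5)[OF r, of a] d a by auto
    ultimately show "att G (dag G d) \<in> cut_side G a" using d by (intro cut_side_step) (auto simp: darts_at_mem)
  qed
qed

section \<open>Live arcs of a graph map\<close>

text \<open>
  An embedding counts as collapsed if \<open>\<phi>\<close> sends it to an edge. At live arcs
  the value of a lift of \<open>\<phi>\<close> along an embedding is forced, because the
  opposite arc goes to a dart.
\<close>

definition live :: "graph_map \<Rightarrow> nat \<Rightarrow> bool" where
  "live \<phi> a \<longleftrightarrow> (\<exists>x\<in>Emb (gsrc \<phi>). a \<in> emb_boundary x \<and> emb_verts (gemb \<phi> x) \<noteq> {})"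

text \<open>
  Boundary compatibility at a live arc: the opposite arc is sent to a dart.
\<close>

lemma noncollapsed_boundary:
  assumes \<phi>: "is_graph_map \<phi>" and x: "x \<in> Emb (gsrc \<phi>)" and a: "a \<in> emb_boundary x"
    and ne: "emb_verts (gemb \<phi> x) \<noteq> {}"
  shows "a \<in> Arcs (gsrc \<phi>)" "dag (gsrc \<phi>) a \<in> darts_at (gsrc \<phi>) (emb_verts x)"
    "garc \<phi> (dag (gsrc \<phi>) a) \<in> darts_at (gtgt \<phi>) (emb_verts (gemb \<phi> x))" "emb_verts x \<noteq> {}"
proof -
  show aA: "a \<in> Arcs (gsrc \<phi>)" using a Emb_subset(2)[OF x] by blast
  show xne: "emb_verts x \<noteq> {}" using graph_map_verts[OF \<phi> x] ne by auto
  show "dag (gsrc \<phi>) a \<in> darts_at (gsrc \<phi>) (emb_verts x)" by (rule emb_boundary_dag[OF x xne a])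
  have "garc \<phi> a \<in> emb_boundary (gemb \<phi> x)" using graph_map_boundary(2)[OF \<phi> x] a by simp
  then show "garc \<phi> (dag (gsrc \<phi>) a) \<in> darts_at (gtgt \<phi>) (emb_verts (gemb \<phi> x))"
    using emb_boundary_dag[OF graph_mapD(7)[OF \<phi> x] ne] graph_mapD(5)[OF \<phi> aA] by simp
qed

text \<open>
  An arc is live if and only if some vertex behind it is not collapsed, since the component of
  the cut at the arc is the largest embedding that ends there.
\<close>

lemma live_cut:
  assumes \<phi>: "is_graph_map \<phi>"
  shows "live \<phi> a \<longleftrightarrow> a \<in> Arcs (gsrc \<phi>) \<and> dag (gsrc \<phi>) a \<in> Darts (gsrc \<phi>) \<and>
    (\<exists>v\<in>cut_side (gsrc \<phi>) a. gverts \<phi> v \<noteq> {})"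
proof
  assume "live \<phi> a"
  then obtain x where x: "x \<in> Emb (gsrc \<phi>)" "a \<in> emb_boundary x" "emb_verts (gemb \<phi> x) \<noteq> {}"
    by (auto simp: live_def)
  note n = noncollapsed_boundary[OF \<phi> x]
  obtain v where "v \<in> emb_verts x" "gverts \<phi> v \<noteq> {}" using x(3) graph_map_verts[OF \<phi> x(1)] by auto
  then show "a \<in> Arcs (gsrc \<phi>) \<and> dag (gsrc \<phi>) a \<in> Darts (gsrc \<phi>) \<and> (\<exists>v\<in>cut_side (gsrc \<phi>) a. gverts \<phi> v \<noteq> {})"
    using n cut_side_contains[OF x(1,2) n(4)] by (auto simp: darts_at_mem)
next
  assume r: "a \<in> Arcs (gsrc \<phi>) \<and> dag (gsrc \<phi>) a \<in> Darts (gsrc \<phi>) \<and> (\<exists>v\<in>cut_side (gsrc \<phi>) a. gverts \<phi> v \<noteq> {})"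
  obtain x where x: "x \<in> Emb (gsrc \<phi>)" "emb_verts x = cut_side (gsrc \<phi>) a" "emb_boundary x =
    {c \<in> Arcs (gsrc \<phi>). dag (gsrc \<phi>) c \<in> darts_at (gsrc \<phi>) (cut_side (gsrc \<phi>) a) \<and>
      (c \<in> graph_boundary (gsrc \<phi>) \<or> c = a \<or> c = dag (gsrc \<phi>) a)}"
    using component_exists[OF graph_mapD(1)[OF \<phi>], of a] r by blast
  have "a \<in> emb_boundary x" using x(3) r cut_side_start by (simp add: darts_at_mem)
  moreover have "emb_verts (gemb \<phi> x) \<noteq> {}" using graph_map_verts[OF \<phi> x(1)] x(2) r by auto
  ultimately show "live \<phi> a" using x(1) by (auto simp: live_def)
qed

text \<open>
  The two sides of a cut cover all vertices, and one vertex is not collapsed.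
\<close>

lemma live_cases:
  assumes \<phi>: "is_graph_map \<phi>" and ne: "emb_verts (gemb \<phi> (id_emb (gsrc \<phi>))) \<noteq> {}" and a: "a \<in> Arcs (gsrc \<phi>)"
  shows "live \<phi> a \<or> live \<phi> (dag (gsrc \<phi>) a)"
proof -
  note G = graph_mapD(1)[OF \<phi>]
  note g = conn_graphD[OF G]
  obtain v where v: "v \<in> Verts (gsrc \<phi>)" "gverts \<phi> v \<noteq> {}"
    using ne graph_map_verts[OF \<phi> id_emb(1)[OF G]] id_emb(2)[OF G] by auto
  have V: "Verts (gsrc \<phi>) \<noteq> {}" using v by auto
  have *: "live \<phi> a \<or> live \<phi> (dag (gsrc \<phi>) a)" if a: "a \<in> Arcs (gsrc \<phi>)" "dag (gsrc \<phi>) a \<in> Darts (gsrc \<phi>)" for a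
    using cut_side_cover[OF G a v(1)] a v(2) g(4,5)[OF a(1)] unfolding live_cut[OF \<phi>] by auto
  show ?thesis using dart_or_dag_dart[OF G V a] *[OF a] *[of "dag (gsrc \<phi>) a"] g(4,5)[OF a] by auto
qed

section \<open>The category of graphs\<close>

lemma U_cat_sel [simp]: "Obj U_cat = {G. connected_graph G}" "Arr U_cat = {\<phi>. is_graph_map \<phi>}"
  "Src U_cat = gsrc" "Tgt U_cat = gtgt"
  by (simp_all add: U_cat_def)

abbreviation gcomp :: "graph_map \<Rightarrow> graph_map \<Rightarrow> graph_map" where "gcomp \<equiv> Cmp U_cat"
abbreviation gid :: "graph \<Rightarrow> graph_map" where "gid \<equiv> Idn U_cat"

lemma gid_sel [simp]: "gsrc (gid G) = G" "gtgt (gid G) = G" "a \<in> Arcs G \<Longrightarrow> garc (gid G) a = a"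
  "x \<in> Emb G \<Longrightarrow> gemb (gid G) x = x"
  by (simp_all add: U_cat_def)

lemma gcomp_sel [simp]: "gsrc (gcomp \<psi> \<phi>) = gsrc \<phi>" "gtgt (gcomp \<psi> \<phi>) = gtgt \<psi>"
  "a \<in> Arcs (gsrc \<phi>) \<Longrightarrow> garc (gcomp \<psi> \<phi>) a = garc \<psi> (garc \<phi> a)"
  "x \<in> Emb (gsrc \<phi>) \<Longrightarrow> gemb (gcomp \<psi> \<phi>) x = gemb \<psi> (gemb \<phi> x)"
  by (simp_all add: U_cat_def compose_def)

lemma gid_map:
  assumes G: "connected_graph G"
  shows "is_graph_map (gid G)"
proof (rule graph_mapI[where F = "\<lambda>v. {v}"])
  show "garc (gid G) \<in> Arcs (gsrc (gid G)) \<rightarrow>\<^sub>E Arcs (gtgt (gid G))"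
    "gemb (gid G) \<in> Emb (gsrc (gid G)) \<rightarrow>\<^sub>E Emb (gtgt (gid G))"
    by (auto simp: U_cat_def)
  show "bij_betw (garc (gid G)) (emb_boundary x) (emb_boundary (gemb (gid G) x))" if "x \<in> Emb (gsrc (gid G))" for x
  proof -
    have x: "x \<in> Emb G" using that by simp
    have "bij_betw (garc (gid G)) (emb_boundary x) (emb_boundary x) \<longleftrightarrow>
        bij_betw (\<lambda>a. a) (emb_boundary x) (emb_boundary x)"
      by (rule bij_betw_cong) (use Emb_subset(2)[OF x] in auto)
    then show ?thesis using x by (simp add: bij_betw_def)
  qed
qed (use G conn_graphD(4)[OF G] in auto)

lemma gcomp_map:
  assumes \<phi>: "is_graph_map \<phi>" and \<psi>: "is_graph_map \<psi>" and e: "gtgt \<phi> = gsrc \<psi>"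
  shows "is_graph_map (gcomp \<psi> \<phi>)"
proof (rule graph_mapI[where F = "\<lambda>v. \<Union>w\<in>gverts \<phi> v. gverts \<psi> w"])
  let ?c = "gcomp \<psi> \<phi>"
  note p = graph_mapD[OF \<phi>] and q = graph_mapD[OF \<psi>]
  have p4: "garc \<phi> a \<in> Arcs (gsrc \<psi>)" if "a \<in> Arcs (gsrc \<phi>)" for a using p(4)[OF that] e by simp
  have p7: "gemb \<phi> x \<in> Emb (gsrc \<psi>)" if "x \<in> Emb (gsrc \<phi>)" for x using p(7)[OF that] e by simp
  show "connected_graph (gsrc ?c)" "connected_graph (gtgt ?c)" using p(1) q(2) by simp_all
  show "garc ?c \<in> Arcs (gsrc ?c) \<rightarrow>\<^sub>E Arcs (gtgt ?c)"
    using p4 q(4) by (auto simp: U_cat_def compose_def)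
  show "gemb ?c \<in> Emb (gsrc ?c) \<rightarrow>\<^sub>E Emb (gtgt ?c)"
    using p7 q(7) by (auto simp: U_cat_def compose_def)
  show "garc ?c (dag (gsrc ?c) a) = dag (gtgt ?c) (garc ?c a)" if "a \<in> Arcs (gsrc ?c)" for a
    using that p(5)[of a] q(5)[OF p4, of a] conn_graphD(4)[OF p(1), of a] e by simp
  show "bij_betw (garc ?c) (emb_boundary x) (emb_boundary (gemb ?c x))" if "x \<in> Emb (gsrc ?c)" for x
  proof -
    have x: "x \<in> Emb (gsrc \<phi>)" using that by simp
    have "bij_betw (garc \<psi> \<circ> garc \<phi>) (emb_boundary x) (emb_boundary (gemb \<psi> (gemb \<phi> x)))"
      by (rule bij_betw_trans[OF p(11)[OF x] q(11)[OF p7[OF x]]])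
    moreover have "(garc \<psi> \<circ> garc \<phi>) a = garc ?c a" if "a \<in> emb_boundary x" for a
      using that Emb_subset(2)[OF x] by auto
    ultimately show ?thesis using x bij_betw_cong[of "emb_boundary x" "garc ?c" "garc \<psi> \<circ> garc \<phi>"] by simp
  qed
  have sub: "gverts \<phi> v \<subseteq> Verts (gsrc \<psi>)" if "v \<in> Verts (gsrc \<phi>)" for v
    using Emb_subset(1)[OF p7[OF vert_emb(2)[OF p(1) that]]] by (simp add: gverts_def)
  show "emb_verts (gemb ?c x) = (\<Union>v\<in>emb_verts x. \<Union>w\<in>gverts \<phi> v. gverts \<psi> w)" if "x \<in> Emb (gsrc ?c)" for x
    using that graph_map_verts[OF \<psi> p7, of x] graph_map_verts[OF \<phi>, of x] by simp
  show "(\<Union>w\<in>gverts \<phi> u. gverts \<psi> w) \<inter> (\<Union>w\<in>gverts \<phi> v. gverts \<psi> w) = {}"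
    if u: "u \<in> Verts (gsrc ?c)" "v \<in> Verts (gsrc ?c)" "u \<noteq> v" for u v
  proof -
    have "gverts \<psi> w \<inter> gverts \<psi> w' = {}" if w: "w \<in> gverts \<phi> u" "w' \<in> gverts \<phi> v" for w w'
    proof -
      have "w \<noteq> w'" using graph_map_disjoint[OF \<phi>, of u v] u w by auto
      then show ?thesis using graph_map_disjoint[OF \<psi>, of w w'] w sub[of u] sub[of v] u by auto
    qed
    then show ?thesis by blast
  qed
  show "emb_le (gtgt ?c) (gemb ?c x) (gemb ?c y)"
    if "x \<in> Emb (gsrc ?c)" "y \<in> Emb (gsrc ?c)" "emb_le (gsrc ?c) x y" for x y
  proof -
    have "emb_le (gsrc \<psi>) (gemb \<phi> x) (gemb \<phi> y)" using graph_map_mono[OF \<phi>, of x y] that e by simp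
    then show ?thesis using graph_map_mono[OF \<psi>, of "gemb \<phi> x" "gemb \<phi> y"] p7 that by simp
  qed
qed

lemma gverts_gcomp:
  assumes \<phi>: "is_graph_map \<phi>" and \<psi>: "is_graph_map \<psi>" and e: "gtgt \<phi> = gsrc \<psi>" and v: "v \<in> Verts (gsrc \<phi>)"
  shows "gverts (gcomp \<psi> \<phi>) v = (\<Union>w\<in>gverts \<phi> v. gverts \<psi> w)"
proof -
  note ve = vert_emb(2)[OF graph_mapD(1)[OF \<phi>] v]
  have "gemb \<phi> (vert_emb (gsrc \<phi>) v) \<in> Emb (gsrc \<psi>)" using graph_mapD(7)[OF \<phi> ve] e by simp
  then show ?thesis using graph_map_verts[OF \<psi>] ve by (simp add: gverts_def)
qed

lemma gverts_gid: "connected_graph G \<Longrightarrow> v \<in> Verts G \<Longrightarrow> gverts (gid G) v = {v}"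
  using vert_emb(2,3) by (simp add: gverts_def)

lemma gverts_subset:
  assumes "is_graph_map \<phi>" "v \<in> Verts (gsrc \<phi>)"
  shows "gverts \<phi> v \<subseteq> Verts (gtgt \<phi>)"
  unfolding gverts_def
  using Emb_subset(1)[OF graph_mapD(7)[OF assms(1) vert_emb(2)[OF graph_mapD(1)[OF assms(1)] assms(2)]]] .

lemma gcomp_assoc:
  assumes "is_graph_map f" "is_graph_map g" "is_graph_map h" "gtgt f = gsrc g" "gtgt g = gsrc h"
  shows "gcomp h (gcomp g f) = gcomp (gcomp h g) f"
proof (rule graph_map.equality)
  have a: "garc f a \<in> Arcs (gsrc g)" if "a \<in> Arcs (gsrc f)" for a using graph_mapD(4)[OF assms(1) that] assms(4) by simp
  have b: "gemb f x \<in> Emb (gsrc g)" if "x \<in> Emb (gsrc f)" for x using graph_mapD(7)[OF assms(1) that] assms(4) by simp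
  show "garc (gcomp h (gcomp g f)) = garc (gcomp (gcomp h g) f)"
    using a by (auto simp: U_cat_def compose_def fun_eq_iff)
  show "gemb (gcomp h (gcomp g f)) = gemb (gcomp (gcomp h g) f)"
    using b by (auto simp: U_cat_def compose_def fun_eq_iff)
qed simp_all

lemma gcomp_gid:
  assumes "is_graph_map f"
  shows "gcomp f (gid (gsrc f)) = f" "gcomp (gid (gtgt f)) f = f"
proof -
  note p = graph_mapD[OF assms]
  have e: "garc f \<in> extensional (Arcs (gsrc f))" "gemb f \<in> extensional (Emb (gsrc f))"
    "garc f \<in> Arcs (gsrc f) \<rightarrow> Arcs (gtgt f)" "gemb f \<in> Emb (gsrc f) \<rightarrow> Emb (gtgt f)"
    using p(3,6) by (simp_all add: PiE_def)
  show "gcomp f (gid (gsrc f)) = f"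
    by (rule graph_map.equality) (simp_all add: U_cat_def compose_Id[OF e(3,1)] compose_Id[OF e(4,2)])
  show "gcomp (gid (gtgt f)) f = f"
    by (rule graph_map.equality) (simp_all add: U_cat_def Id_compose[OF e(3,1)] Id_compose[OF e(4,2)])
qed

lemma U_cat_category: "is_category U_cat"
  unfolding is_category_def
proof (intro conjI ballI impI)
  show "gcomp h (gcomp g f) = gcomp (gcomp h g) f"
    if "f \<in> Arr U_cat" "g \<in> Arr U_cat" "h \<in> Arr U_cat" "Tgt U_cat f = Src U_cat g" "Tgt U_cat g = Src U_cat h" for f g h
    using that by (intro gcomp_assoc) simp_all
qed (simp_all add: graph_mapD(1,2) gid_map gcomp_map gcomp_gid)

definition gactive :: "graph_map \<Rightarrow> bool" where
  "gactive \<phi> \<longleftrightarrow> is_graph_map \<phi> \<and> gemb \<phi> (id_emb (gsrc \<phi>)) = id_emb (gtgt \<phi>)"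

definition ginert :: "graph_map \<Rightarrow> bool" where
  "ginert \<phi> \<longleftrightarrow> is_graph_map \<phi> \<and>
     (\<forall>v\<in>Verts (gsrc \<phi>). gemb \<phi> (vert_emb (gsrc \<phi>) v) \<in> vert_emb (gtgt \<phi>) ` Verts (gtgt \<phi>))"

lemma U_active_eq: "U_active = Collect gactive" by (auto simp: U_active_def gactive_def)
lemma U_inert_eq: "U_inert = Collect ginert" by (auto simp: U_inert_def ginert_def)

lemma gactive_gcomp:
  assumes "gactive \<phi>" "gactive \<psi>" "gtgt \<phi> = gsrc \<psi>"
  shows "gactive (gcomp \<psi> \<phi>)"
  using assms id_emb(1)[OF graph_mapD(1), of \<phi>] by (auto simp: gactive_def gcomp_map)

lemma ginert_gcomp:
  assumes \<phi>: "ginert \<phi>" and \<psi>: "ginert \<psi>" and e: "gtgt \<phi> = gsrc \<psi>"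
  shows "ginert (gcomp \<psi> \<phi>)"
proof -
  have p: "is_graph_map \<phi>" and q: "is_graph_map \<psi>" using \<phi> \<psi> by (simp_all add: ginert_def)
  have "gemb (gcomp \<psi> \<phi>) (vert_emb (gsrc \<phi>) v) \<in> vert_emb (gtgt \<psi>) ` Verts (gtgt \<psi>)" if v: "v \<in> Verts (gsrc \<phi>)" for v
  proof -
    obtain w where w: "w \<in> Verts (gtgt \<phi>)" "gemb \<phi> (vert_emb (gsrc \<phi>) v) = vert_emb (gtgt \<phi>) w"
      using \<phi> v by (auto simp: ginert_def)
    then show ?thesis using \<psi> e vert_emb(2)[OF graph_mapD(1)[OF p] v] by (auto simp: ginert_def)
  qed
  then show ?thesis using gcomp_map[OF p q e] by (simp add: ginert_def)
qed

lemma iso_U_iff: "is_iso U_cat f \<longleftrightarrow> is_graph_map f \<and> (\<exists>g. is_graph_map g \<and> gsrc g = gtgt f \<and> gtgt g = gsrc f \<and>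
   gcomp g f = gid (gsrc f) \<and> gcomp f g = gid (gtgt f))"
  by (auto simp: is_iso_def)

text \<open>
  The identity is the largest element, and isomorphisms preserve the order in both directions.
\<close>

lemma iso_gactive:
  assumes "is_iso U_cat f"
  shows "gactive f"
proof -
  obtain g where f: "is_graph_map f" and g: "is_graph_map g" "gsrc g = gtgt f" "gtgt g = gsrc f"
    and fg: "gcomp f g = gid (gtgt f)" using assms by (auto simp: iso_U_iff)
  note i = id_emb(1)[OF graph_mapD(1)[OF f]] and j = id_emb(1)[OF graph_mapD(2)[OF f]]
  have gj: "gemb g (id_emb (gtgt f)) \<in> Emb (gsrc f)" using graph_mapD(7)[OF g(1)] g j by metis
  have "gemb f (gemb g (id_emb (gtgt f))) = gemb (gcomp f g) (id_emb (gtgt f))" using j g(2) by simp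
  also have "\<dots> = id_emb (gtgt f)" using j fg by simp
  finally have "emb_le (gtgt f) (id_emb (gtgt f)) (gemb f (id_emb (gsrc f)))"
    using graph_map_mono[OF f gj i emb_le_id[OF gj]] by simp
  then have "gemb f (id_emb (gsrc f)) = id_emb (gtgt f)"
    using emb_le_antisym[OF graph_mapD(7)[OF f i] j emb_le_id[OF graph_mapD(7)[OF f i]]] by blast
  then show ?thesis using f by (simp add: gactive_def)
qed

text \<open>
  An isomorphism matches vertices with vertices, as disjoint nonempty sets have a singleton as
  their union only in the trivial way; and it matches the smallest embeddings around
  corresponding vertices.
\<close>

lemma iso_ginert:
  assumes "is_iso U_cat f"
  shows "ginert f"
proof -
  obtain g where f: "is_graph_map f" and g: "is_graph_map g" "gsrc g = gtgt f" "gtgt g = gsrc f"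
    and gf: "gcomp g f = gid (gsrc f)" and fg: "gcomp f g = gid (gtgt f)" using assms by (auto simp: iso_U_iff)
  note G = graph_mapD(1)[OF f] and H = graph_mapD(2)[OF f]
  have "gemb f (vert_emb (gsrc f) v) \<in> vert_emb (gtgt f) ` Verts (gtgt f)" if v: "v \<in> Verts (gsrc f)" for v
  proof -
    note vE = vert_emb(2)[OF G v]
    have 1: "(\<Union>w\<in>gverts f v. gverts g w) = {v}"
      using gverts_gcomp[OF f g(1) g(2)[symmetric] v] gverts_gid[OF G v] gf by simp
    then obtain w where w: "w \<in> gverts f v" "v \<in> gverts g w" by auto
    have wV: "w \<in> Verts (gtgt f)" using gverts_subset[OF f v] w by blast
    have ne: "gverts g u \<noteq> {}" if u: "u \<in> Verts (gtgt f)" for u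
      using gverts_gcomp[OF g(1) f g(3), of u] gverts_gid[OF H u] fg u g(2) by auto
    \<comment> \<open>Any other vertex of the image would be sent back to \<open>v\<close> as well.\<close>
    have Fv: "gverts f v = {w}"
    proof -
      have "u = w" if u: "u \<in> gverts f v" for u
      proof (rule ccontr)
        assume "u \<noteq> w"
        have uV: "u \<in> Verts (gtgt f)" using gverts_subset[OF f v] u by blast
        have "gverts g u \<subseteq> {v}" using 1 u by blast
        then have "v \<in> gverts g u" using ne[OF uV] by blast
        then show False using graph_map_disjoint[OF g(1), of u w] uV wV w \<open>u \<noteq> w\<close> g(2) by auto
      qed
      then show ?thesis using w by blast
    qed
    have gw: "gverts g w = {v}" using 1 Fv by simp
    note wE = vert_emb(2)[OF H wV]
    have wE': "vert_emb (gtgt f) w \<in> Emb (gsrc g)" using wE g by simp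
    have gwE: "gemb g (vert_emb (gtgt f) w) \<in> Emb (gsrc f)" using graph_mapD(7)[OF g(1) wE'] g by simp
    have fv: "gemb f (vert_emb (gsrc f) v) \<in> Emb (gtgt f)" by (rule graph_mapD(7)[OF f vE])
    have le1: "emb_le (gtgt f) (vert_emb (gtgt f) w) (gemb f (vert_emb (gsrc f) v))"
      by (rule vert_emb_le[OF fv]) (use w in \<open>simp add: gverts_def\<close>)
    have "emb_le (gtgt g) (gemb g (vert_emb (gtgt f) w)) (gemb g (gemb f (vert_emb (gsrc f) v)))"
      by (rule graph_map_mono[OF g(1)]) (use wE fv le1 g in simp_all)
    moreover have "gemb g (gemb f (vert_emb (gsrc f) v)) = vert_emb (gsrc f) v"
      using gcomp_sel(4)[OF vE, of g] gf vE by simp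
    ultimately have "emb_le (gsrc f) (gemb g (vert_emb (gtgt f) w)) (vert_emb (gsrc f) v)" using g by simp
    then have "gemb g (vert_emb (gtgt f) w) = vert_emb (gsrc f) v"
      by (rule eq_vert_embI[OF gwE, rotated]) (use gw g in \<open>simp add: gverts_def\<close>)
    then have "gemb f (vert_emb (gsrc f) v) = gemb (gcomp f g) (vert_emb (gtgt f) w)" using wE' by simp
    also have "\<dots> = vert_emb (gtgt f) w" using fg wE by simp
    finally show ?thesis using wV by blast
  qed
  then show ?thesis using f by (simp add: ginert_def)
qed

section \<open>Inert maps are embeddings\<close>

lemma dag_inj:
  assumes "connected_graph G" "a \<in> Arcs G" "b \<in> Arcs G" "dag G a = dag G b"
  shows "a = b"
  using conn_graphD(5)[OF assms(1,2)] conn_graphD(5)[OF assms(1,3)] assms(4) by metis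

definition the_emb :: "graph \<Rightarrow> nat set \<Rightarrow> nat set \<Rightarrow> emb set" where
  "the_emb G W B = (THE z. z \<in> Emb G \<and> emb_verts z = W \<and> emb_boundary z = B)"

lemma the_emb:
  assumes "z \<in> Emb G" "emb_verts z = W" "emb_boundary z = B"
  shows "the_emb G W B = z"
  unfolding the_emb_def by (rule the_equality) (use assms Emb_ext in auto)

text \<open>
  Composition with \<open>l\<close>, described by its effect on vertices and boundaries.
\<close>

definition inert_of :: "graph \<Rightarrow> emb \<Rightarrow> graph_map" where
  "inert_of G l = \<lparr>gsrc = edom l, gtgt = G, garc = earc l,
     gemb = (\<lambda>x\<in>Emb (edom l). the_emb G (evert l ` emb_verts x) (earc l ` emb_boundary x))\<rparr>"

lemma inert_of_sel [simp]: "gsrc (inert_of G l) = edom l" "gtgt (inert_of G l) = G"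
  "garc (inert_of G l) = earc l"
  by (simp_all add: inert_of_def)

lemma inert_of_emb:
  assumes l: "is_embedding G l" and x: "x \<in> Emb (edom l)"
  shows "gemb (inert_of G l) x \<in> Emb G"
    "emb_verts (gemb (inert_of G l) x) = evert l ` emb_verts x"
    "emb_boundary (gemb (inert_of G l) x) = earc l ` emb_boundary x"
    "k \<in> x \<Longrightarrow> emb_comp l k \<in> gemb (inert_of G l) x"
    "inj_on (earc l) (emb_boundary x)"
proof -
  have main: "gemb (inert_of G l) x = emb_class G (emb_comp l k)"
    "emb_verts (emb_class G (emb_comp l k)) = evert l ` emb_verts x"
    "emb_boundary (emb_class G (emb_comp l k)) = earc l ` emb_boundary x"
    "is_embedding G (emb_comp l k)" "inj_on (earc l) (emb_boundary x)" if k: "k \<in> x" for k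
  proof -
    note km = Emb_memD[OF x k]
    show c: "is_embedding G (emb_comp l k)" by (rule emb_comp_embedding[OF l km(1)])
    note ci = emb_class_images[OF c]
    show 1: "emb_verts (emb_class G (emb_comp l k)) = evert l ` emb_verts x"
      "emb_boundary (emb_class G (emb_comp l k)) = earc l ` emb_boundary x"
      using ci comp_images[OF km(1)] km(3,4) by simp_all
    show "gemb (inert_of G l) x = emb_class G (emb_comp l k)"
      using the_emb[OF emb_class_Emb[OF c] 1] x by (simp add: inert_of_def)
    have "inj_on (earc l \<circ> earc k) (graph_boundary (edom k))"
    proof (rule inj_onI)
      fix a b assume ab: "a \<in> graph_boundary (edom k)" "b \<in> graph_boundary (edom k)" "(earc l \<circ> earc k) a = (earc l \<circ> earc k) b"
      have "earc (emb_comp l k) a = earc (emb_comp l k) b" using ab by (simp add: graph_boundary_def)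
      then show "a = b" by (rule inj_onD[OF embedding_inj_boundary[OF c]]) (use ab in simp_all)
    qed
    then show "inj_on (earc l) (emb_boundary x)" unfolding km(4) bdry_image_def by (rule inj_on_imageI)
  qed
  obtain k' where k: "k' \<in> x" using x by (rule Emb_E)
  show "gemb (inert_of G l) x \<in> Emb G" using main(1)[OF k] emb_class_Emb[OF main(4)[OF k]] by simp
  show "emb_verts (gemb (inert_of G l) x) = evert l ` emb_verts x"
    "emb_boundary (gemb (inert_of G l) x) = earc l ` emb_boundary x"
    using main(1,2,3)[OF k] by simp_all
  show "inj_on (earc l) (emb_boundary x)" by (rule main(5)[OF k])
  show "emb_comp l k \<in> gemb (inert_of G l) x" if "k \<in> x"
    using main(1,4)[OF that] by (simp add: emb_class_mem emb_iso_iff)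
qed

lemma factors_by_comp_mono:
  assumes "factors_by l h i" "is_embedding K l" "is_embedding K h"
  shows "factors_by (emb_comp m l) (emb_comp m h) i"
  using assms embeddingD(5,6)[of "edom l" i] by (auto simp: factors_by_def)

text \<open>
  A factorization of \<open>h\<close> through \<open>k\<close> also factors the composites with
  \<open>l\<close>, which gives monotonicity.
\<close>

lemma inert_of_map:
  assumes l: "is_embedding G l"
  shows "is_graph_map (inert_of G l)"
proof (rule graph_mapI[where F = "\<lambda>v. {evert l v}"])
  let ?i = "inert_of G l"
  show "connected_graph (gsrc ?i)" "connected_graph (gtgt ?i)" using embeddingD(1,2)[OF l] by simp_all
  show "garc ?i \<in> Arcs (gsrc ?i) \<rightarrow>\<^sub>E Arcs (gtgt ?i)" using embeddingD(3)[OF l] by simp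
  show "garc ?i (dag (gsrc ?i) a) = dag (gtgt ?i) (garc ?i a)" if "a \<in> Arcs (gsrc ?i)" for a
    using embeddingD(7)[OF l] that by simp
  show "gemb ?i \<in> Emb (gsrc ?i) \<rightarrow>\<^sub>E Emb (gtgt ?i)"
    by (rule PiE_I) (use inert_of_emb(1)[OF l] in \<open>auto simp: inert_of_def\<close>)
  show "bij_betw (garc ?i) (emb_boundary x) (emb_boundary (gemb ?i x))" if "x \<in> Emb (gsrc ?i)" for x
    using inert_of_emb(3,5)[OF l, of x] that by (simp add: bij_betw_def)
  show "emb_verts (gemb ?i x) = (\<Union>v\<in>emb_verts x. {evert l v})" if "x \<in> Emb (gsrc ?i)" for x
    using inert_of_emb(2)[OF l, of x] that by auto
  show "{evert l v} \<inter> {evert l w} = {}" if "v \<in> Verts (gsrc ?i)" "w \<in> Verts (gsrc ?i)" "v \<noteq> w" for v w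
    using inj_onD[OF embeddingD(11)[OF l], of v w] that by auto
  show "emb_le (gtgt ?i) (gemb ?i x) (gemb ?i y)"
    if "x \<in> Emb (gsrc ?i)" "y \<in> Emb (gsrc ?i)" and le: "emb_le (gsrc ?i) x y" for x y
  proof -
    have x: "x \<in> Emb (edom l)" and y: "y \<in> Emb (edom l)" using that by simp_all
    obtain h where h: "h \<in> x" using x by (rule Emb_E)
    obtain k where k: "k \<in> y" using y by (rule Emb_E)
    obtain j where "factors_by k h j" using le emb_le_factors[OF x y h k] by auto
    then have "factors_by (emb_comp l k) (emb_comp l h) j"
      using factors_by_comp_mono[OF _ Emb_memD(1)[OF y k] Emb_memD(1)[OF x h]] by blast
    then show ?thesis
      using emb_le_factors[OF inert_of_emb(1)[OF l x] inert_of_emb(1)[OF l y] inert_of_emb(4)[OF l x h] inert_of_emb(4)[OF l y k]]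
      by auto
  qed
qed

lemma gverts_inert_of:
  assumes l: "is_embedding G l" and v: "v \<in> Verts (edom l)"
  shows "gverts (inert_of G l) v = {evert l v}"
  using inert_of_emb(2)[OF l vert_emb(2)[OF embeddingD(1)[OF l] v]] vert_emb(3)[OF embeddingD(1)[OF l] v]
  by (simp add: gverts_def)

lemma inert_of_id:
  assumes l: "is_embedding G l"
  shows "gemb (inert_of G l) (id_emb (edom l)) = emb_class G l"
proof -
  note i = id_emb[OF embeddingD(1)[OF l]]
  show ?thesis
    by (rule Emb_ext[OF inert_of_emb(1)[OF l i(1)] emb_class_Emb[OF l]])
      (use inert_of_emb(2,3)[OF l i(1)] i emb_class_images[OF l] in \<open>simp_all add: vert_image_def bdry_image_def\<close>)
qed

lemma inert_of_vert:
  assumes l: "is_embedding G l" and v: "v \<in> Verts (edom l)"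
  shows "gemb (inert_of G l) (vert_emb (edom l) v) = vert_emb G (evert l v)"
proof -
  note H = embeddingD(1)[OF l] and G = embeddingD(2)[OF l]
  note a = vert_emb[OF H v] and b = vert_emb[OF G embeddingD(6)[OF l v]]
  have D: "earc l ` darts_at (edom l) {v} = darts_at G {evert l v}"
  proof (intro equalityI subsetI)
    fix e assume "e \<in> earc l ` darts_at (edom l) {v}"
    then obtain d where d: "d \<in> Darts (edom l)" "att (edom l) d = v" "e = earc l d" by (auto simp: darts_at_mem)
    then show "e \<in> darts_at G {evert l v}" using embeddingD(8,9)[OF l d(1)] by (simp add: darts_at_mem)
  next
    fix e assume "e \<in> darts_at G {evert l v}"
    then have "e \<in> Darts G" "att G e = evert l v" by (simp_all add: darts_at_mem)
    then obtain d where "d \<in> Darts (edom l)" "att (edom l) d = v" "earc l d = e" using embeddingD(12)[OF l _ v] by blast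
    then show "e \<in> earc l ` darts_at (edom l) {v}" by (auto simp: darts_at_mem)
  qed
  have "earc l ` dag (edom l) ` darts_at (edom l) {v} = (\<lambda>d. dag G (earc l d)) ` darts_at (edom l) {v}"
    unfolding image_image using embeddingD(7)[OF l] conn_graphD(3)[OF H] by (intro image_cong) (auto simp: darts_at_mem)
  also have "\<dots> = dag G ` darts_at G {evert l v}" unfolding D[symmetric] image_image ..
  finally show ?thesis
    using inert_of_emb(1-3)[OF l a(2)] a(3,4) b by (intro Emb_ext[OF _ b(2)]) simp_all
qed

lemma inert_of_ginert: "is_embedding G l \<Longrightarrow> ginert (inert_of G l)"
  using inert_of_map[of G l] inert_of_vert[of G l] embeddingD(6)[of G l] by (auto simp: ginert_def)

text \<open>
  An inert map sends the star at \<open>v\<close> to the star at a vertex \<open>w v\<close>.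
  Boundary compatibility for these stars identifies the darts at \<open>v\<close> with the darts
  at \<open>w v\<close>, which is the pullback condition, and disjointness makes
  \<open>w\<close> injective.
\<close>

lemma ginert_inert_of:
  assumes f: "ginert f"
  obtains l where "is_embedding (gtgt f) l" "edom l = gsrc f" "earc l = garc f" "f = inert_of (gtgt f) l"
proof -
  let ?H = "gsrc f" and ?G = "gtgt f"
  have m: "is_graph_map f" using f by (simp add: ginert_def)
  note p = graph_mapD[OF m]
  have "\<forall>v\<in>Verts ?H. \<exists>w. w \<in> Verts ?G \<and> gemb f (vert_emb ?H v) = vert_emb ?G w"
    using f by (auto simp: ginert_def)
  then obtain w where w: "\<And>v. v \<in> Verts ?H \<Longrightarrow> w v \<in> Verts ?G"
    "\<And>v. v \<in> Verts ?H \<Longrightarrow> gemb f (vert_emb ?H v) = vert_emb ?G (w v)" by metis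
  have gv: "gverts f v = {w v}" if "v \<in> Verts ?H" for v
    using w[OF that] vert_emb(3)[OF p(2)] by (simp add: gverts_def)
  note hg = conn_graphD[OF p(1)] and gg = conn_graphD[OF p(2)]
  have bd: "garc f ` dag ?H ` darts_at ?H {v} = dag ?G ` darts_at ?G {w v}" if v: "v \<in> Verts ?H" for v
    using graph_map_boundary(2)[OF m vert_emb(2)[OF p(1) v]] vert_emb(4)[OF p(1) v] w[OF v] vert_emb(4)[OF p(2) w(1)[OF v]] by simp
  have inj_bd: "inj_on (garc f) (dag ?H ` darts_at ?H {v})" if v: "v \<in> Verts ?H" for v
    using graph_map_boundary(1)[OF m vert_emb(2)[OF p(1) v]] vert_emb(4)[OF p(1) v] by simp
  have dart: "garc f d \<in> Darts ?G \<and> att ?G (garc f d) = w (att ?H d)" if d: "d \<in> Darts ?H" for d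
  proof -
    have v: "att ?H d \<in> Verts ?H" and dA: "d \<in> Arcs ?H" using hg d by auto
    have "garc f (dag ?H d) \<in> dag ?G ` darts_at ?G {w (att ?H d)}"
      unfolding bd[OF v, symmetric] using d by (simp add: darts_at_mem)
    then obtain e where e: "e \<in> darts_at ?G {w (att ?H d)}" "garc f (dag ?H d) = dag ?G e" by blast
    have "dag ?G (garc f d) = dag ?G e" using e(2) p(5)[OF dA] by simp
    then have "garc f d = e"
      by (rule dag_inj[OF p(2) p(4)[OF dA], rotated]) (use e(1) gg(3) in \<open>simp add: darts_at_mem\<close>)
    then show ?thesis using e by (simp add: darts_at_mem)
  qed
  have winj: "u = v" if "u \<in> Verts ?H" "v \<in> Verts ?H" "w u = w v" for u v
    using graph_map_disjoint[OF m, of u v] gv that by auto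
  define l where "l = \<lparr>edom = ?H, earc = garc f, evert = (\<lambda>v\<in>Verts ?H. w v)\<rparr>"
  have l: "is_embedding ?G l"
    unfolding is_embedding_iff
  proof (intro conjI ballI impI)
    show "connected_graph (edom l)" "connected_graph ?G" using p by (simp_all add: l_def)
    show "earc l \<in> Arcs (edom l) \<rightarrow>\<^sub>E Arcs ?G" using p(3) by (simp add: l_def)
    show "evert l \<in> Verts (edom l) \<rightarrow>\<^sub>E Verts ?G" using w(1) by (auto simp: l_def)
    show "earc l (dag (edom l) a) = dag ?G (earc l a)" if "a \<in> Arcs (edom l)" for a using p(5) that by (simp add: l_def)
    show "earc l d \<in> Darts ?G" "evert l (att (edom l) d) = att ?G (earc l d)" if "d \<in> Darts (edom l)" for d
      using dart[of d] that hg(7) by (auto simp: l_def)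
    show "inj_on (earc l) (Darts (edom l))"
    proof (rule inj_onI)
      fix c d assume "c \<in> Darts (edom l)" "d \<in> Darts (edom l)" "earc l c = earc l d"
      then have c: "c \<in> Darts ?H" and d: "d \<in> Darts ?H" and eq: "garc f c = garc f d" by (simp_all add: l_def)
      have at: "att ?H c = att ?H d" using dart[OF c] dart[OF d] eq winj[OF hg(7)[OF c] hg(7)[OF d]] by simp
      have cA: "c \<in> Arcs ?H" and dA: "d \<in> Arcs ?H" using c d hg(3) by auto
      have "garc f (dag ?H c) = garc f (dag ?H d)" using eq p(5)[OF cA] p(5)[OF dA] by simp
      then have "dag ?H c = dag ?H d"
        by (rule inj_onD[OF inj_bd[OF hg(7)[OF d]]]) (use c d at in \<open>auto simp: darts_at_mem\<close>)
      then show "c = d" by (rule dag_inj[OF p(1) cA dA])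
    qed
    show "inj_on (evert l) (Verts (edom l))" by (rule inj_onI) (use winj in \<open>simp add: l_def\<close>)
    fix d v assume d: "d \<in> Darts ?G" and "v \<in> Verts (edom l)" and at: "att ?G d = evert l v"
    then have v: "v \<in> Verts ?H" and at': "att ?G d = w v" by (auto simp: l_def)
    have "dag ?G d \<in> garc f ` dag ?H ` darts_at ?H {v}" unfolding bd[OF v] using d at' by (simp add: darts_at_mem)
    then obtain e where e: "e \<in> Darts ?H" "att ?H e = v" "dag ?G d = garc f (dag ?H e)" by (auto simp: darts_at_mem)
    have eA: "e \<in> Arcs ?H" using e hg(3) by auto
    have "dag ?G (garc f e) = dag ?G d" using e(3) p(5)[OF eA] by simp
    then have "garc f e = d" by (rule dag_inj[OF p(2) p(4)[OF eA] gg(3)[OF d]])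
    then show "\<exists>d'\<in>Darts (edom l). att (edom l) d' = v \<and> earc l d' = d" using e by (auto simp: l_def)
  qed
  have "f = inert_of ?G l"
    by (rule graph_map_ext[OF m inert_of_map[OF l]])
      (use gv gverts_inert_of[OF l] in \<open>auto simp: l_def\<close>)
  then show ?thesis by (intro that[OF l]) (simp_all add: l_def)
qed

lemma inert_of_comp:
  assumes l: "is_embedding G l" and m: "is_embedding (edom l) m"
  shows "gcomp (inert_of G l) (inert_of (edom l) m) = inert_of G (emb_comp l m)"
proof (rule graph_map_ext)
  note c = emb_comp_embedding[OF l m]
  show "is_graph_map (gcomp (inert_of G l) (inert_of (edom l) m))"
    by (rule gcomp_map[OF inert_of_map[OF m] inert_of_map[OF l]]) simp
  show "is_graph_map (inert_of G (emb_comp l m))" by (rule inert_of_map[OF c])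
  show "garc (gcomp (inert_of G l) (inert_of (edom l) m)) = garc (inert_of G (emb_comp l m))"
    by (simp add: U_cat_def emb_comp_def)
  show "gverts (gcomp (inert_of G l) (inert_of (edom l) m)) v = gverts (inert_of G (emb_comp l m)) v"
    if "v \<in> Verts (gsrc (gcomp (inert_of G l) (inert_of (edom l) m)))" for v
  proof -
    have v: "v \<in> Verts (edom m)" using that by simp
    show ?thesis
      using gverts_gcomp[OF inert_of_map[OF m] inert_of_map[OF l]] gverts_inert_of[OF m v] gverts_inert_of[OF c] v
        gverts_inert_of[OF l embeddingD(6)[OF m v]] by simp
  qed
qed simp_all

section \<open>Cancellation and uniqueness of factorizations\<close>

text \<open>
  Two active maps with the same composite with \<open>l\<close> have the same vertices, since
  \<open>l\<close> is injective on these; hence they collapse the same embeddings. If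
  \<open>a\<close> is live, both send its opposite to darts, on which \<open>l\<close> is
  injective. If everything is collapsed, the common target is an edge, on which \<open>l\<close>
  is injective as well.
\<close>

lemma ginert_cancel:
  assumes l: "ginert l" and p: "gactive p" and q: "gactive q"
    and s: "gsrc p = gsrc q" and tp: "gtgt p = gsrc l" and tq: "gtgt q = gsrc l"
    and eq: "gcomp l p = gcomp l q"
  shows "p = q"
proof -
  let ?G = "gsrc p" and ?H = "gsrc l"
  have lm: "is_graph_map l" and pm: "is_graph_map p" and qm: "is_graph_map q"
    using l p q by (auto simp: ginert_def gactive_def)
  note pD = graph_mapD[OF pm] and qD = graph_mapD[OF qm]
  obtain e where e: "is_embedding (gtgt l) e" "edom e = ?H" "earc e = garc l" "l = inert_of (gtgt l) e"
    using ginert_inert_of[OF l] by blast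
  have ea: "earc e (garc p a) = earc e (garc q a)" if "a \<in> Arcs ?G" for a
    using gcomp_sel(3)[of a p l] gcomp_sel(3)[of a q l] that s eq e(3) by simp
  have gl: "gverts l v = {evert e v}" if "v \<in> Verts ?H" for v
    using gverts_inert_of[OF e(1)] that e(2,4) by metis
  have gv: "gverts p v = gverts q v" if v: "v \<in> Verts ?G" for v
  proof -
    have sp: "gverts p v \<subseteq> Verts ?H" and sq: "gverts q v \<subseteq> Verts ?H"
      using gverts_subset[OF pm, of v] gverts_subset[OF qm, of v] v s tp tq by auto
    have "(\<Union>w\<in>gverts p v. gverts l w) = (\<Union>w\<in>gverts q v. gverts l w)"
      using gverts_gcomp[OF pm lm tp, of v] gverts_gcomp[OF qm lm tq, of v] v s eq by simp
    moreover have "(\<Union>w\<in>A. gverts l w) = evert e ` A" if "A \<subseteq> Verts ?H" for A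
      using that gl by blast
    ultimately have "evert e ` gverts p v = evert e ` gverts q v" using sp sq by simp
    then show ?thesis using inj_on_image_eq_iff[OF embeddingD(11)[OF e(1)]] sp sq e(2) by simp
  qed
  have gemb_eq: "emb_verts (gemb p x) = emb_verts (gemb q x)" if x: "x \<in> Emb ?G" for x
    unfolding graph_map_verts[OF pm x] graph_map_verts[OF qm x[unfolded s]]
    by (rule SUP_cong[OF refl]) (use gv Emb_subset(1)[OF x] in blast)
  have arc: "garc p a = garc q a" if a: "a \<in> Arcs ?G" for a
  proof (cases "Verts ?H = {}")
    case True
    have "Darts ?H = {}" by (rule no_verts(1)) (use pD(2) tp True in simp_all)
    then have "inj_on (earc e) (Arcs ?H)"
      using embedding_inj_boundary[OF e(1)] e(2) by (simp add: graph_boundary_def)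
    then show ?thesis
      by (rule inj_onD) (use ea[OF a] pD(4)[of a] qD(4)[of a] a s tp tq in simp_all)
  next
    case False
    have "emb_verts (gemb p (id_emb ?G)) \<noteq> {}"
      using p id_emb(2)[OF pD(2)] False tp by (simp add: gactive_def)
    then have lv: "live p a \<or> live p (dag ?G a)" by (rule live_cases[OF pm _ a])
    have *: "garc p (dag ?G a) = garc q (dag ?G a)" if a: "a \<in> Arcs ?G" and "live p a" for a
    proof -
      obtain x where x: "x \<in> Emb ?G" "a \<in> emb_boundary x" "emb_verts (gemb p x) \<noteq> {}"
        using \<open>live p a\<close> by (auto simp: live_def)
      have "garc p (dag ?G a) \<in> Darts ?H" using noncollapsed_boundary(3)[OF pm x] tp by (simp add: darts_at_mem)
      moreover have "garc q (dag ?G a) \<in> Darts ?H"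
        using noncollapsed_boundary(3)[OF qm, of x a] x gemb_eq[OF x(1)] s tq by (simp add: darts_at_mem)
      moreover have "earc e (garc p (dag ?G a)) = earc e (garc q (dag ?G a))"
        by (rule ea) (use conn_graphD(4)[OF pD(1) a] in simp)
      ultimately show ?thesis using e(2) by - (rule inj_onD[OF embeddingD(10)[OF e(1)]]; simp)
    qed
    note dA = conn_graphD(4,5)[OF pD(1) a]
    from lv show ?thesis
    proof
      assume "live p a"
      then have "garc p (dag ?G a) = garc q (dag ?G a)" by (rule *[OF a])
      then have "dag ?H (garc p a) = dag ?H (garc q a)" using pD(5)[OF a] qD(5)[of a] a s tp tq by simp
      then show ?thesis
        by (rule dag_inj[rotated 3]) (use pD(2) pD(4)[OF a] qD(4)[of a] a s tp tq in simp_all)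
    next
      assume "live p (dag ?G a)"
      then have "garc p (dag ?G (dag ?G a)) = garc q (dag ?G (dag ?G a))" by (rule *[OF dA(1)])
      then show ?thesis unfolding dA(2) .
    qed
  qed
  show ?thesis
  proof (rule graph_map_ext[OF pm qm s])
    show "gtgt p = gtgt q" using tp tq by simp
    show "garc p = garc q"
      by (rule PiE_ext[OF pD(3)]) (use qD(3) s tp tq arc in simp_all)
    show "gverts p v = gverts q v" if "v \<in> Verts ?G" for v using gv that .
  qed
qed

text \<open>
  The image of the identity determines an inert map up to isomorphism, since it is the class of
  the corresponding embedding. Comparison maps exist in both directions and are mutually inverse
  by cancellation.
\<close>

lemma inert_same_class:
  assumes f: "ginert f" and f': "ginert f'" and t: "gtgt f = gtgt f'"
    and eq: "gemb f (id_emb (gsrc f)) = gemb f' (id_emb (gsrc f'))"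
  shows "\<exists>i. is_iso U_cat i \<and> gsrc i = gsrc f' \<and> gtgt i = gsrc f \<and> gcomp f i = f'"
proof -
  have half: "\<exists>i. ginert i \<and> gactive i \<and> gsrc i = gsrc f' \<and> gtgt i = gsrc f \<and> gcomp f i = f'"
    if f: "ginert f" and f': "ginert f'" and t: "gtgt f = gtgt f'"
    and eq: "gemb f (id_emb (gsrc f)) = gemb f' (id_emb (gsrc f'))" for f f'
  proof -
    obtain e where e: "is_embedding (gtgt f) e" "edom e = gsrc f" "earc e = garc f" "f = inert_of (gtgt f) e"
      using ginert_inert_of[OF f] by blast
    obtain e' where e': "is_embedding (gtgt f) e'" "edom e' = gsrc f'" "earc e' = garc f'" "f' = inert_of (gtgt f) e'"
      using ginert_inert_of[OF f', unfolded t[symmetric]] by blast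
    have "emb_class (gtgt f) e = emb_class (gtgt f) e'"
      using inert_of_id[OF e(1), unfolded e(2) e(4)[symmetric]]
        inert_of_id[OF e'(1), unfolded e'(2) e'(4)[symmetric]] eq by simp
    then have "(e', e) \<in> emb_iso (gtgt f)"
      using emb_class_mem[of e "gtgt f" e'] emb_class_mem[of e "gtgt f" e] e(1) by (simp add: emb_iso_iff)
    then obtain i where i: "factors_by e e' i" "bij_betw (earc i) (Arcs (edom e')) (Arcs (edom e))"
      "bij_betw (evert i) (Verts (edom e')) (Verts (edom e))" by (auto simp: emb_iso_def)
    have ie: "is_embedding (edom e) i" and id: "edom i = edom e'" using i by (auto simp: factors_by_def)
    have comp: "emb_comp e i = e'"
    proof (rule emb.equality)
      have fa: "\<And>a. a \<in> Arcs (edom e') \<Longrightarrow> earc e (earc i a) = earc e' a"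
        and fv: "\<And>v. v \<in> Verts (edom e') \<Longrightarrow> evert e (evert i v) = evert e' v"
        using i(1) by (simp_all add: factors_by_def)
      show "earc (emb_comp e i) = earc e'"
      proof
        fix a show "earc (emb_comp e i) a = earc e' a"
          using fa[of a] PiE_arb[OF embeddingD(3)[OF e'(1)], of a] id
          by (cases "a \<in> Arcs (edom e')") (simp_all add: emb_comp_def compose_def)
      qed
      show "evert (emb_comp e i) = evert e'"
      proof
        fix v show "evert (emb_comp e i) v = evert e' v"
          using fv[of v] PiE_arb[OF embeddingD(4)[OF e'(1)], of v] id
          by (cases "v \<in> Verts (edom e')") (simp_all add: emb_comp_def compose_def)
      qed
    qed (use id in simp_all)
    have "(i, emb_unit (edom e)) \<in> emb_iso (edom e)"
      unfolding emb_iso_def using ie emb_unit_embedding[OF embeddingD(1)[OF e(1)]] i(2,3) id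
        embeddingD(5,6)[OF ie]
      by (auto simp: factors_by_def intro!: exI[of _ i])
    then have cl: "emb_class (edom e) i = id_emb (edom e)"
      unfolding id_emb_class emb_class_def by (rule equiv_class_eq[OF emb_iso_equiv])
    let ?i = "inert_of (edom e) i"
    have "gactive ?i" using inert_of_map[OF ie] inert_of_id[OF ie] cl by (simp add: gactive_def)
    moreover have "gcomp f ?i = f'" using inert_of_comp[OF e(1) ie] comp e(4) e'(4) by simp
    ultimately show ?thesis using inert_of_ginert[OF ie] id e(2) e'(2) by (intro exI[of _ ?i]) simp
  qed
  obtain i where i: "ginert i" "gactive i" "gsrc i = gsrc f'" "gtgt i = gsrc f" "gcomp f i = f'"
    using half[OF f f' t eq] by blast
  obtain j where j: "ginert j" "gactive j" "gsrc j = gsrc f" "gtgt j = gsrc f'" "gcomp f' j = f"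
    using half[OF f' f t[symmetric] eq[symmetric]] by blast
  have m: "is_graph_map f" "is_graph_map f'" "is_graph_map i" "is_graph_map j" using f f' i j by (auto simp: ginert_def)
  have idact: "gactive (gid G)" if "connected_graph G" for G
    using gid_map[OF that] id_emb(1)[OF that] by (simp add: gactive_def)
  have "gcomp i j = gid (gsrc f)"
  proof (rule ginert_cancel[OF f gactive_gcomp[OF j(2) i(2)] idact[OF graph_mapD(1)[OF m(1)]]])
    show "gcomp f (gcomp i j) = gcomp f (gid (gsrc f))"
      using gcomp_assoc[OF m(4,3,1)] i j gcomp_gid(1)[OF m(1)] by simp
  qed (use i j in simp_all)
  moreover have "gcomp j i = gid (gsrc f')"
  proof (rule ginert_cancel[OF f' gactive_gcomp[OF i(2) j(2)] idact[OF graph_mapD(1)[OF m(2)]]])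
    show "gcomp f' (gcomp j i) = gcomp f' (gid (gsrc f'))"
      using gcomp_assoc[OF m(3,4,2)] i j gcomp_gid(1)[OF m(2)] by simp
  qed (use i j in simp_all)
  ultimately have "is_iso U_cat i" unfolding iso_U_iff using m i j by auto
  then show ?thesis using i by blast
qed

text \<open>
  Both inert maps have the class of the image of the identity under the composite. The
  comparison isomorphism commutes with the active maps by cancellation.
\<close>

lemma factorization_unique:
  assumes r: "gactive r" and r': "gactive r'" and l: "ginert l" and l': "ginert l'"
    and c: "gtgt r = gsrc l" "gtgt r' = gsrc l'" "gsrc r = gsrc r'" "gtgt l = gtgt l'"
    and eq: "gcomp l r = gcomp l' r'"
  shows "\<exists>!i. is_iso U_cat i \<and> gsrc i = gsrc l' \<and> gtgt i = gsrc l \<and> gcomp l i = l' \<and> gcomp i r' = r"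
proof (rule ex_ex1I)
  have m: "is_graph_map r" "is_graph_map r'" "is_graph_map l" "is_graph_map l'"
    using r r' l l' by (auto simp: ginert_def gactive_def)
  have cl: "gemb l (id_emb (gsrc l)) = gemb (gcomp l r) (id_emb (gsrc r))"
    if "gactive r" "gtgt r = gsrc l" for l r
    using that id_emb(1)[OF graph_mapD(1), of r] by (simp add: gactive_def)
  have "gemb l (id_emb (gsrc l)) = gemb l' (id_emb (gsrc l'))"
    using cl[OF r c(1)] cl[OF r' c(2)] c(3) eq by simp
  then obtain i where i: "is_iso U_cat i" "gsrc i = gsrc l'" "gtgt i = gsrc l" "gcomp l i = l'"
    using inert_same_class[OF l l' c(4)] by blast
  have ia: "gactive i" by (rule iso_gactive[OF i(1)])
  then have im: "is_graph_map i" by (simp add: gactive_def)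
  have "gcomp i r' = r"
  proof (rule ginert_cancel[OF l gactive_gcomp[OF r' ia] r])
    show "gcomp l (gcomp i r') = gcomp l r" using gcomp_assoc[OF m(2) im m(3)] i c eq by simp
  qed (use i c in simp_all)
  then show "\<exists>i. is_iso U_cat i \<and> gsrc i = gsrc l' \<and> gtgt i = gsrc l \<and> gcomp l i = l' \<and> gcomp i r' = r"
    using i by blast
  fix i j assume i: "is_iso U_cat i \<and> gsrc i = gsrc l' \<and> gtgt i = gsrc l \<and> gcomp l i = l' \<and> gcomp i r' = r"
    and j: "is_iso U_cat j \<and> gsrc j = gsrc l' \<and> gtgt j = gsrc l \<and> gcomp l j = l' \<and> gcomp j r' = r"
  show "i = j" by (rule ginert_cancel[OF l iso_gactive iso_gactive]) (use i j in simp_all)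
qed

section \<open>Existence of active-inert factorizations\<close>

lemma emb_arcs_dag_closed:
  assumes z: "z \<in> Emb G" and a: "a \<in> darts_at G (emb_verts z) \<union> emb_boundary z"
  shows "dag G a \<in> darts_at G (emb_verts z) \<union> emb_boundary z"
proof (cases "emb_verts z = {}")
  case True
  then obtain b where b: "b \<in> Arcs G" "emb_boundary z = {b, dag G b}" using Emb_no_verts[OF z] by blast
  then show ?thesis using a True conn_graphD(5)[OF Emb_connected[OF z] b(1)] by (auto simp: darts_at_def)
next
  case False
  show ?thesis using a emb_boundary_dag[OF z False] regionD(4)[OF Emb_region[OF z False]] by blast
qed

text \<open>
  The two sides of a cut, inside an embedding instead of the whole graph; they are components of
  the domain of \<open>y\<close>, carried over to \<open>G\<close>.
\<close>

lemma cut_inside: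
  assumes y: "y \<in> Emb G" and a: "a \<in> darts_at G (emb_verts y)" "a \<notin> emb_boundary y" "dag G a \<notin> emb_boundary y"
  shows "\<exists>y1\<in>Emb G. \<exists>y2\<in>Emb G. emb_le G y1 y \<and> emb_le G y2 y \<and> a \<in> emb_boundary y1 \<and> dag G a \<in> emb_boundary y2 \<and>
    emb_verts y = emb_verts y1 \<union> emb_verts y2 \<and> emb_boundary y1 \<subseteq> {a, dag G a} \<union> emb_boundary y \<and>
    (dag G a \<in> emb_boundary y1 \<longrightarrow> emb_verts y1 = emb_verts y)"
proof -
  obtain e where e: "is_embedding G e" "e \<in> y" "y = emb_class G e" "emb_verts y = vert_image e" "emb_boundary y = bdry_image e"
    using y by (rule Emb_E)
  let ?Y = "edom e"
  note Y = embeddingD(1)[OF e(1)] and G = embeddingD(2)[OF e(1)]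
  note yg = conn_graphD[OF Y] and gg = conn_graphD[OF G]
  have aA: "a \<in> Arcs G" using a(1) gg(3) by (simp add: darts_at_mem)
  obtain \<alpha> where \<alpha>: "\<alpha> \<in> Darts ?Y" "a = earc e \<alpha>" using a(1) embedding_darts[OF e(1)] e(4) by auto
  have \<alpha>A: "\<alpha> \<in> Arcs ?Y" using \<alpha> yg(3) by simp
  have ed: "earc e (dag ?Y \<alpha>) = dag G a" using embeddingD(7)[OF e(1) \<alpha>A] \<alpha> by simp
  have d\<alpha>: "dag ?Y \<alpha> \<in> Darts ?Y"
  proof (rule ccontr)
    assume "dag ?Y \<alpha> \<notin> Darts ?Y"
    then have "dag ?Y \<alpha> \<in> graph_boundary ?Y" using yg(4)[OF \<alpha>A] by (simp add: graph_boundary_def)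
    then have "earc e (dag ?Y \<alpha>) \<in> emb_boundary y" unfolding e(5) bdry_image_def by (rule imageI)
    then show False using ed a(3) by simp
  qed
  let ?b = "\<lambda>\<alpha>. {c \<in> Arcs ?Y. dag ?Y c \<in> darts_at ?Y (cut_side ?Y \<alpha>) \<and> (c \<in> graph_boundary ?Y \<or> c = \<alpha> \<or> c = dag ?Y \<alpha>)}"
  obtain z1 where z1: "z1 \<in> Emb ?Y" "emb_verts z1 = cut_side ?Y \<alpha>" "emb_boundary z1 = ?b \<alpha>"
    using component_exists[OF Y \<alpha>A d\<alpha>] by blast
  have dd: "dag ?Y (dag ?Y \<alpha>) = \<alpha>" by (rule yg(5)[OF \<alpha>A])
  obtain z2 where z2: "z2 \<in> Emb ?Y" "emb_verts z2 = cut_side ?Y (dag ?Y \<alpha>)" "emb_boundary z2 = ?b (dag ?Y \<alpha>)"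
    using component_exists[OF Y yg(4)[OF \<alpha>A]] \<alpha>(1) dd by auto
  have \<alpha>1: "\<alpha> \<in> emb_boundary z1" using z1(3) \<alpha>A d\<alpha> cut_side_start by (simp add: darts_at_mem)
  have \<alpha>2: "dag ?Y \<alpha> \<in> emb_boundary z2"
    using z2(3) yg(4)[OF \<alpha>A] \<alpha>(1) dd cut_side_start[of ?Y "dag ?Y \<alpha>"] by (simp add: darts_at_mem)
  have sub: "cut_side ?Y \<alpha> \<subseteq> Verts ?Y" "cut_side ?Y (dag ?Y \<alpha>) \<subseteq> Verts ?Y"
    using cut_side_verts[OF Y d\<alpha>] cut_side_verts[OF Y, of "dag ?Y \<alpha>"] dd \<alpha>(1) by auto
  have cov: "Verts ?Y = cut_side ?Y \<alpha> \<union> cut_side ?Y (dag ?Y \<alpha>)"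
    using cut_side_cover[OF Y \<alpha>A d\<alpha>] sub by blast
  let ?p = "gemb (inert_of G e)"
  note pE = inert_of_emb[OF e(1)]
  have le: "emb_le G (?p z) y" if z: "z \<in> Emb ?Y" for z
    using graph_map_mono[OF inert_of_map[OF e(1)], of z "id_emb ?Y"] emb_le_id[OF z] id_emb(1)[OF Y] z
      inert_of_id[OF e(1)] e(3) by simp
  have "a \<in> emb_boundary (?p z1)" using pE(3)[OF z1(1)] \<alpha>1 \<alpha>(2) by simp
  moreover have "dag G a \<in> emb_boundary (?p z2)" unfolding pE(3)[OF z2(1)] ed[symmetric] using \<alpha>2 by (rule imageI)
  moreover have "emb_verts y = emb_verts (?p z1) \<union> emb_verts (?p z2)"
    unfolding pE(2)[OF z1(1)] pE(2)[OF z2(1)] e(4) vert_image_def cov z1(2) z2(2) by (rule image_Un)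
  moreover have b1: "emb_boundary (?p z1) \<subseteq> {a, dag G a} \<union> emb_boundary y"
  proof
    fix c assume "c \<in> emb_boundary (?p z1)"
    then obtain \<gamma> where \<gamma>: "\<gamma> \<in> emb_boundary z1" "c = earc e \<gamma>" unfolding pE(3)[OF z1(1)] by blast
    then have "\<gamma> \<in> graph_boundary ?Y \<or> \<gamma> = \<alpha> \<or> \<gamma> = dag ?Y \<alpha>" using z1(3) by blast
    then show "c \<in> {a, dag G a} \<union> emb_boundary y" using \<gamma>(2) \<alpha>(2) ed e(5) by (auto simp: bdry_image_def)
  qed
  moreover have "emb_verts (?p z1) = emb_verts y" if da: "dag G a \<in> emb_boundary (?p z1)"
  proof -
    obtain \<gamma> where \<gamma>: "\<gamma> \<in> emb_boundary z1" "dag G a = earc e \<gamma>" using da unfolding pE(3)[OF z1(1)] by blast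
    have "\<gamma> \<notin> graph_boundary ?Y" using \<gamma>(2) a(3) e(5) by (auto simp: bdry_image_def)
    moreover have "\<gamma> \<noteq> \<alpha>" using \<gamma>(2) \<alpha>(2) gg(6)[OF aA] by auto
    ultimately have "\<gamma> = dag ?Y \<alpha>" using \<gamma>(1) z1(3) by blast
    then have "dag ?Y (dag ?Y \<alpha>) \<in> darts_at ?Y (cut_side ?Y \<alpha>)" using \<gamma>(1) z1(3) by blast
    then have "att ?Y \<alpha> \<in> cut_side ?Y \<alpha>" using dd by (simp add: darts_at_mem)
    moreover have "att ?Y \<alpha> \<in> cut_side ?Y (dag ?Y \<alpha>)" using cut_side_start[of ?Y "dag ?Y \<alpha>"] dd by simp
    ultimately have "cut_side ?Y (dag ?Y \<alpha>) = cut_side ?Y \<alpha>" by (rule cut_side_eq[OF Y \<alpha>A])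
    then have "cut_side ?Y \<alpha> = Verts ?Y" using cov by blast
    then show ?thesis using pE(2)[OF z1(1)] z1(2) e(4) by (simp add: vert_image_def)
  qed
  ultimately show ?thesis
    using pE(1)[OF z1(1)] pE(1)[OF z2(1)] le[OF z1(1)] le[OF z2(1)] by blast
qed

text \<open>
  The embedding \<open>h\<close> represents the image of the identity, along which
  \<open>\<phi>\<close> is to be lifted.
\<close>

locale active_lift =
  fixes \<phi> :: graph_map and h :: emb
  assumes map: "is_graph_map \<phi>" and emb: "is_embedding (gtgt \<phi>) h"
    and cls: "gemb \<phi> (id_emb (gsrc \<phi>)) = emb_class (gtgt \<phi>) h"
begin

abbreviation "G \<equiv> gsrc \<phi>"
abbreviation "G' \<equiv> gtgt \<phi>"
abbreviation "H \<equiv> edom h"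

lemmas conn = graph_mapD(1)[OF map] graph_mapD(2)[OF map] embeddingD(1)[OF emb]
lemmas gG = conn_graphD[OF conn(1)]
lemmas gG' = conn_graphD[OF conn(2)]
lemmas gH = conn_graphD[OF conn(3)]

lemma image_id: "emb_verts (gemb \<phi> (id_emb G)) = vert_image h" "emb_boundary (gemb \<phi> (id_emb G)) = bdry_image h"
  using emb_class_images[OF emb] cls by simp_all

lemma boundary_id: "bdry_image h = garc \<phi> ` graph_boundary G" "inj_on (garc \<phi>) (graph_boundary G)"
  using graph_map_boundary[OF map id_emb(1)[OF conn(1)]] id_emb(3)[OF conn(1)] image_id(2) by simp_all

lemma le_class: "x \<in> Emb G \<Longrightarrow> emb_le G' (gemb \<phi> x) (emb_class G' h)"
  using graph_map_mono[OF map _ id_emb(1)[OF conn(1)] emb_le_id] cls by simp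

lemma verts_sub: "x \<in> Emb G \<Longrightarrow> emb_verts (gemb \<phi> x) \<subseteq> vert_image h"
  using le_class[of x] emb_class_images[OF emb] unfolding emb_le_def pair_le_def by simp

lemma arc_in_image:
  assumes a: "a \<in> Arcs G"
  shows "garc \<phi> a \<in> earc h ` Arcs H"
proof -
  obtain x where x: "x \<in> edge_embs G" "emb_verts x = {}" "emb_boundary x = {a, dag G a}"
    using edge_exists[OF conn(1) a] by blast
  have xE: "x \<in> Emb G" using x by (simp add: edge_embs_iff)
  have "emb_verts (gemb \<phi> x) = {}" using graph_map_verts[OF map xE] x by simp
  then have "emb_boundary (gemb \<phi> x) \<subseteq> darts_at G' (vert_image h) \<union> bdry_image h"
    using le_class[OF xE] emb_class_images[OF emb] unfolding emb_le_def pair_le_def by simp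
  then show ?thesis using graph_map_boundary(2)[OF map xE] x(3) embedding_arcs[OF emb] by blast
qed

lemma dart_eq: "c \<in> Darts H \<Longrightarrow> d \<in> Darts H \<Longrightarrow> earc h c = earc h d \<Longrightarrow> c = d"
  by (rule inj_onD[OF embeddingD(10)[OF emb]])

definition dart_lift :: "nat \<Rightarrow> nat" where "dart_lift y = inv_into (Darts H) (earc h) y"

lemma dart_lift:
  assumes "y \<in> darts_at G' (vert_image h)"
  shows "dart_lift y \<in> Darts H" "earc h (dart_lift y) = y"
  using assms unfolding embedding_darts[OF emb, symmetric] dart_lift_def
  by (auto intro: inv_into_into f_inv_into_f simp del: inv_into_f_f)

text \<open>
  The lift of an arc. A live arc lifts to the opposite of a dart; for other arcs the opposite
  arc is live, so they lift to a dart. If \<open>h\<close> is an edge it is injective on arcs.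
\<close>

definition arc_lift :: "nat \<Rightarrow> nat" where
  "arc_lift a = (if Verts H = {} then inv_into (Arcs H) (earc h) (garc \<phi> a)
     else if live \<phi> a then dag H (dart_lift (garc \<phi> (dag G a))) else dart_lift (garc \<phi> a))"

lemma live_dart:
  assumes "live \<phi> a"
  shows "garc \<phi> (dag G a) \<in> darts_at G' (vert_image h)" "a \<in> Arcs G" "dag G a \<in> Darts G"
proof -
  obtain x where x: "x \<in> Emb G" "a \<in> emb_boundary x" "emb_verts (gemb \<phi> x) \<noteq> {}" using assms by (auto simp: live_def)
  note n = noncollapsed_boundary[OF map x]
  show "garc \<phi> (dag G a) \<in> darts_at G' (vert_image h)" using n(3) verts_sub[OF x(1)] by (auto simp: darts_at_mem)
  show "a \<in> Arcs G" "dag G a \<in> Darts G" using n(1,2) by (simp_all add: darts_at_mem)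
qed

lemma live_or:
  assumes "Verts H \<noteq> {}" "a \<in> Arcs G"
  shows "live \<phi> a \<or> live \<phi> (dag G a)"
  by (rule live_cases[OF map _ assms(2)]) (use image_id(1) assms(1) in \<open>simp add: vert_image_def\<close>)

lemma live_component:
  assumes "live \<phi> a"
  obtains x where "x \<in> Emb G" "emb_verts x = cut_side G a" "emb_boundary x =
    {c \<in> Arcs G. dag G c \<in> darts_at G (cut_side G a) \<and> (c \<in> graph_boundary G \<or> c = a \<or> c = dag G a)}"
    "emb_verts (gemb \<phi> x) \<noteq> {}" "a \<in> emb_boundary x"
proof -
  note l = live_dart[OF assms]
  obtain x where x: "x \<in> Emb G" "emb_verts x = cut_side G a" "emb_boundary x =
    {c \<in> Arcs G. dag G c \<in> darts_at G (cut_side G a) \<and> (c \<in> graph_boundary G \<or> c = a \<or> c = dag G a)}"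
    using component_exists[OF conn(1) l(2,3)] by blast
  have "emb_verts (gemb \<phi> x) \<noteq> {}"
    using graph_map_verts[OF map x(1)] x(2) assms live_cut[OF map, of a] by auto
  moreover have "a \<in> emb_boundary x" using x(3) l(2,3) cut_side_start by (simp add: darts_at_mem)
  ultimately show thesis using that x by blast
qed

text \<open>
  If both arcs of an edge are live, the two prescriptions for its lift agree. Otherwise the lift
  of \<open>dag G a\<close> to a dart has its opposite \<open>z\<close> in the boundary of the
  domain of \<open>h\<close>, so that the image of \<open>a\<close> is also the image of some
  \<open>b\<close> in the boundary of \<open>G\<close>. Now \<open>b\<close> ends one of the two
  components of the cut at \<open>a\<close>. It is not that of \<open>a\<close>, where
  \<open>\<phi>\<close> is injective on the boundary. In the other one the opposite of
  \<open>b\<close> is sent to the same dart as that of \<open>a\<close>, against the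
  disjointness of the components.
\<close>

lemma live_both:
  assumes V: "Verts H \<noteq> {}" and l: "live \<phi> a" "live \<phi> (dag G a)"
  shows "dag H (dart_lift (garc \<phi> (dag G a))) = dart_lift (garc \<phi> a)"
proof -
  note ld = live_dart[OF l(1)]
  note dd = gG(5)[OF ld(2)]
  have lb: "garc \<phi> a \<in> darts_at G' (vert_image h)" "a \<in> Darts G" using live_dart[OF l(2)] dd by simp_all
  have yA: "garc \<phi> (dag G a) = dag G' (garc \<phi> a)" by (rule graph_mapD(5)[OF map ld(2)])
  have y: "garc \<phi> a \<in> Arcs G'" by (rule graph_mapD(4)[OF map ld(2)])
  define d where "d = dart_lift (garc \<phi> (dag G a))"
  have d: "d \<in> Darts H" "earc h d = dag G' (garc \<phi> a)" using dart_lift[OF ld(1)] yA by (simp_all add: d_def)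
  have dA: "d \<in> Arcs H" using d gH(3) by simp
  have z: "earc h (dag H d) = garc \<phi> a" using embeddingD(7)[OF emb dA] d(2) gG'(5)[OF y] by simp
  have "dag H d \<in> Darts H"
  proof (rule ccontr)
    assume "dag H d \<notin> Darts H"
    then have "dag H d \<in> graph_boundary H" using gH(4)[OF dA] by (simp add: graph_boundary_def)
    then have "garc \<phi> a \<in> garc \<phi> ` graph_boundary G" using z boundary_id(1) unfolding bdry_image_def by (metis imageI)
    then obtain b where b: "b \<in> graph_boundary G" "garc \<phi> b = garc \<phi> a" by auto
    have bA: "b \<in> Arcs G" using b by (simp add: graph_boundary_def)
    have GV: "Verts G \<noteq> {}" using gG(7)[OF lb(2)] by auto
    have bd: "dag G b \<in> Darts G" by (rule dag_boundary_dart[OF conn(1) GV b(1)])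
    obtain X where X: "X \<in> Emb G" "emb_verts X = cut_side G a" "emb_boundary X =
      {c \<in> Arcs G. dag G c \<in> darts_at G (cut_side G a) \<and> (c \<in> graph_boundary G \<or> c = a \<or> c = dag G a)}"
      "emb_verts (gemb \<phi> X) \<noteq> {}" "a \<in> emb_boundary X" by (rule live_component[OF l(1)])
    obtain X' where X': "X' \<in> Emb G" "emb_verts X' = cut_side G (dag G a)" "emb_boundary X' =
      {c \<in> Arcs G. dag G c \<in> darts_at G (cut_side G (dag G a)) \<and> (c \<in> graph_boundary G \<or> c = dag G a \<or> c = dag G (dag G a))}"
      "emb_verts (gemb \<phi> X') \<noteq> {}" "dag G a \<in> emb_boundary X'" by (rule live_component[OF l(2)])
    have n1: "att G (dag G b) \<notin> cut_side G a"
    proof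
      assume "att G (dag G b) \<in> cut_side G a"
      then have "b \<in> emb_boundary X" using X(3) bA bd b(1) by (simp add: darts_at_mem)
      then have "b = a" using inj_onD[OF graph_map_boundary(1)[OF map X(1)] b(2)] X(5) by blast
      then show False using b(1) lb(2) by (simp add: graph_boundary_def)
    qed
    then have n2: "att G (dag G b) \<in> cut_side G (dag G a)"
      using cut_side_cover[OF conn(1) ld(2,3) gG(7)[OF bd]] by blast
    then have bX': "b \<in> emb_boundary X'" using X'(3) bA bd b(1) by (simp add: darts_at_mem)
    have disj: "emb_verts X \<inter> emb_verts X' = {}"
      unfolding X(2) X'(2) using cut_side_eq[OF conn(1) ld(2)] n1 n2 by blast
    have "garc \<phi> (dag G b) \<in> darts_at G' (emb_verts (gemb \<phi> X'))"
      by (rule noncollapsed_boundary(3)[OF map X'(1) bX' X'(4)])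
    moreover have "garc \<phi> (dag G a) \<in> darts_at G' (emb_verts (gemb \<phi> X))"
      by (rule noncollapsed_boundary(3)[OF map X(1) X(5) X(4)])
    moreover have "garc \<phi> (dag G b) = garc \<phi> (dag G a)"
      using graph_mapD(5)[OF map bA] graph_mapD(5)[OF map ld(2)] b(2) by simp
    ultimately show False using graph_mapD(10)[OF map X(1) X'(1) disj] by (auto simp: darts_at_mem)
  qed
  then have "dag H d = dart_lift (garc \<phi> a)"
    by (rule dart_eq[OF _ dart_lift(1)[OF lb(1)]]) (use z dart_lift(2)[OF lb(1)] in simp)
  then show ?thesis by (simp add: d_def)
qed

lemma edge_inj: "Verts H = {} \<Longrightarrow> inj_on (earc h) (Arcs H)"
  using embedding_inj_boundary[OF emb] no_verts(1)[OF conn(3)] by (simp add: graph_boundary_def)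

lemma not_live_dart:
  assumes "Verts H \<noteq> {}" "a \<in> Arcs G" "\<not> live \<phi> a"
  shows "garc \<phi> a \<in> darts_at G' (vert_image h)"
  using live_or[OF assms(1,2)] assms(3) live_dart(1)[of "dag G a"] gG(5)[OF assms(2)] by simp

lemma arc_lift:
  assumes a: "a \<in> Arcs G"
  shows "arc_lift a \<in> Arcs H" "earc h (arc_lift a) = garc \<phi> a"
proof -
  have "arc_lift a \<in> Arcs H \<and> earc h (arc_lift a) = garc \<phi> a"
  proof (cases "Verts H = {}")
    case True
    then show ?thesis using arc_in_image[OF a] unfolding arc_lift_def
      by (auto intro: inv_into_into f_inv_into_f simp del: inv_into_f_f)
  next
    case V: False
    show ?thesis
    proof (cases "live \<phi> a")
      case True
      note l = live_dart[OF True]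
      have A: "dart_lift (garc \<phi> (dag G a)) \<in> Arcs H" using dart_lift(1)[OF l(1)] gH(3) by simp
      have "earc h (dag H (dart_lift (garc \<phi> (dag G a)))) = dag G' (garc \<phi> (dag G a))"
        using embeddingD(7)[OF emb A] dart_lift(2)[OF l(1)] by simp
      also have "\<dots> = garc \<phi> a"
        using graph_mapD(5)[OF map a] gG'(5)[OF graph_mapD(4)[OF map a]] by simp
      finally show ?thesis using V True gH(4)[OF A] by (simp add: arc_lift_def)
    next
      case False
      have n: "garc \<phi> a \<in> darts_at G' (vert_image h)" by (rule not_live_dart[OF V a False])
      then show ?thesis using V False dart_lift[OF n] gH(3) by (simp add: arc_lift_def)
    qed
  qed
  then show "arc_lift a \<in> Arcs H" "earc h (arc_lift a) = garc \<phi> a" by simp_all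
qed

lemma arc_lift_dag:
  assumes a: "a \<in> Arcs G"
  shows "arc_lift (dag G a) = dag H (arc_lift a)"
proof (cases "Verts H = {}")
  case True
  note d = gG(4)[OF a]
  have "earc h (arc_lift (dag G a)) = earc h (dag H (arc_lift a))"
    using arc_lift(2)[OF d] arc_lift(2)[OF a] embeddingD(7)[OF emb arc_lift(1)[OF a]] graph_mapD(5)[OF map a] by simp
  then show ?thesis by (rule inj_onD[OF edge_inj[OF True]]) (use arc_lift(1)[OF d] arc_lift(1)[OF a] gH(4) in simp_all)
next
  case V: False
  note dd = gG(5)[OF a]
  have dldl: "dag H (dag H (dart_lift y)) = dart_lift y" if "y \<in> darts_at G' (vert_image h)" for y
    using gH(5)[OF gH(3)[OF dart_lift(1)[OF that]]] .
  show ?thesis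
  proof (cases "live \<phi> a")
    case alive: True
    note l = live_dart[OF alive]
    show ?thesis
    proof (cases "live \<phi> (dag G a)")
      case True
      have "arc_lift (dag G a) = dag H (dart_lift (garc \<phi> a))" using V True dd by (simp add: arc_lift_def)
      moreover have "arc_lift a = dag H (dart_lift (garc \<phi> (dag G a)))" using V alive by (simp add: arc_lift_def)
      ultimately show ?thesis using live_both[OF V alive True] by simp
    next
      case False
      then show ?thesis using V alive dldl[OF l(1)] by (simp add: arc_lift_def)
    qed
  next
    case dead: False
    then have "live \<phi> (dag G a)" using live_or[OF V a] by blast
    then show ?thesis using V dead dd by (simp add: arc_lift_def)
  qed
qed

lemma arc_lift_noncollapsed:
  assumes x: "x \<in> Emb G" "a \<in> emb_boundary x" "emb_verts (gemb \<phi> x) \<noteq> {}"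
  shows "arc_lift (dag G a) \<in> Darts H"
proof -
  have V: "Verts H \<noteq> {}" using verts_sub[OF x(1)] x(3) by (auto simp: vert_image_def)
  have l: "live \<phi> a" using x by (auto simp: live_def)
  note d = live_dart[OF l]
  have A: "dart_lift (garc \<phi> (dag G a)) \<in> Arcs H" using dart_lift(1)[OF d(1)] gH(3) by simp
  have "arc_lift (dag G a) = dart_lift (garc \<phi> (dag G a))" using arc_lift_dag[OF d(2)] V l gH(5)[OF A] by (simp add: arc_lift_def)
  then show ?thesis using dart_lift(1)[OF d(1)] by simp
qed

text \<open>
  The two ends of an edge are its opposite arcs, and \<open>\<phi>\<close> is bijective on
  boundaries.
\<close>

lemma collapsed_boundary:
  assumes x: "x \<in> Emb G" "emb_verts (gemb \<phi> x) = {}" and a: "a \<in> emb_boundary x"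
  shows "\<exists>c. c \<noteq> a \<and> emb_boundary x = {a, c} \<and> garc \<phi> c = dag G' (garc \<phi> a)"
proof -
  obtain b where b: "b \<in> Arcs G'" "emb_boundary (gemb \<phi> x) = {b, dag G' b}"
    using Emb_no_verts[OF graph_mapD(7)[OF map x(1)] x(2)] by blast
  note gb = graph_map_boundary[OF map x(1)]
  have "garc \<phi> a \<in> {b, dag G' b}" using gb(2) a b(2) by blast
  then consider "garc \<phi> a = b" | "garc \<phi> a = dag G' b" by blast
  then have b': "emb_boundary (gemb \<phi> x) = {garc \<phi> a, dag G' (garc \<phi> a)} \<and> garc \<phi> a \<in> Arcs G'"
  proof cases
    case 1 then show ?thesis using b by simp
  next
    case 2 then show ?thesis unfolding 2 b(2) gG'(5)[OF b(1)] using gG'(4)[OF b(1)] by blast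
  qed
  have "dag G' (garc \<phi> a) \<in> garc \<phi> ` emb_boundary x" unfolding gb(2)[symmetric] using b' by blast
  then obtain c where c: "dag G' (garc \<phi> a) = garc \<phi> c" "c \<in> emb_boundary x" by (rule imageE)
  have ne: "c \<noteq> a" using c(1) gG'(6)[OF conjunct2[OF b']] by auto
  have "e \<in> {a, c}" if e: "e \<in> emb_boundary x" for e
  proof -
    have "garc \<phi> e \<in> {garc \<phi> a, garc \<phi> c}" unfolding c(1)[symmetric] conjunct1[OF b', symmetric] gb(2)
      using e by (rule imageI)
    then show ?thesis using inj_onD[OF gb(1) _ e a] inj_onD[OF gb(1) _ e c(2)] by blast
  qed
  then have "emb_boundary x = {a, c}" using a c(2) by blast
  then show ?thesis using ne c(1)[symmetric] by blast
qed

text \<open>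
  A vertex that is reached behind \<open>a\<close> and does not belong to \<open>x\<close> is
  reached by leaving \<open>x\<close> through its other end \<open>c\<close>.
\<close>

lemma live_through:
  assumes x: "x \<in> Emb G" "emb_verts (gemb \<phi> x) = {}" "emb_verts x \<noteq> {}"
    and b: "emb_boundary x = {a, c}" and l: "live \<phi> a"
  shows "live \<phi> (dag G c)"
proof -
  have cA: "c \<in> Arcs G" using Emb_subset(2)[OF x(1)] b by auto
  have dc: "dag G c \<in> darts_at G (emb_verts x)" and da: "dag G a \<in> darts_at G (emb_verts x)"
    using emb_boundary_dag[OF x(1,3)] b by auto
  note r = Emb_region[OF x(1,3)]
  have cc: "dag G (dag G c) = c" by (rule gG(5)[OF cA])
  obtain v where v: "v \<in> cut_side G a" "gverts \<phi> v \<noteq> {}" using l live_cut[OF map, of a] by blast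
  have vx: "v \<notin> emb_verts x" using v(2) graph_map_verts[OF map x(1)] x(2) by auto
  have "v \<in> emb_verts x \<or> (c \<in> Darts G \<and> v \<in> cut_side G (dag G c))"
    using v(1)
  proof (rule cut_side_induct)
    show "att G (dag G a) \<in> emb_verts x \<or> (c \<in> Darts G \<and> att G (dag G a) \<in> cut_side G (dag G c))"
      using da by (simp add: darts_at_mem)
    fix d assume d: "d \<in> Darts G" "dag G d \<in> Darts G" "d \<noteq> a" "d \<noteq> dag G a"
      and q: "att G d \<in> emb_verts x \<or> (c \<in> Darts G \<and> att G d \<in> cut_side G (dag G c))"
    have dd: "dag G (dag G d) = d" using gG(5)[OF gG(3)[OF d(1)]] .
    show "att G (dag G d) \<in> emb_verts x \<or> (c \<in> Darts G \<and> att G (dag G d) \<in> cut_side G (dag G c))"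
      using q
    proof
      assume u: "att G d \<in> emb_verts x"
      show ?thesis
      proof (cases "att G (dag G d) \<in> emb_verts x")
        case False
        then have "dag G d \<notin> darts_at G (emb_verts x)" by (simp add: darts_at_mem)
        then have "dag G d \<in> {a, c}" using regionD(4)[OF r, of d] u d(1) b by (simp add: darts_at_mem)
        then have "dag G d = c" using d(4) dd by auto
        then show ?thesis using d(2) cut_side_start[of G "dag G c"] cc by auto
      qed simp
    next
      assume u: "c \<in> Darts G \<and> att G d \<in> cut_side G (dag G c)"
      consider "d = c" | "d = dag G c" | "d \<noteq> c" "d \<noteq> dag G c" by blast
      then show ?thesis
      proof cases
        case 1 then show ?thesis using dc by (simp add: darts_at_mem)
      next
        case 2 then show ?thesis using u cc cut_side_start[of G "dag G c"] by simp
      next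
        case 3 then show ?thesis using cut_side_step[OF d(1,2), of "dag G c"] u cc by simp
      qed
    qed
  qed
  then have "c \<in> Darts G" "v \<in> cut_side G (dag G c)" using vx by auto
  then show ?thesis unfolding live_cut[OF map] using v(2) gG(4)[OF cA] cc by auto
qed

text \<open>
  Every vertex lies behind one of the two ends of \<open>x\<close>: what is outside
  \<open>x\<close> is reached through one end without using the other.
\<close>

lemma live_end:
  assumes V: "Verts H \<noteq> {}" and x: "x \<in> Emb G" "emb_verts (gemb \<phi> x) = {}" "emb_verts x \<noteq> {}"
    and b: "emb_boundary x = {a, c}" and ne: "c \<noteq> a"
  shows "live \<phi> a \<or> live \<phi> c"
proof -
  have aA: "a \<in> Arcs G" and cA: "c \<in> Arcs G" using Emb_subset(2)[OF x(1)] b by auto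
  have dc: "dag G c \<in> darts_at G (emb_verts x)" and da: "dag G a \<in> darts_at G (emb_verts x)"
    using emb_boundary_dag[OF x(1,3)] b by auto
  have sa: "emb_verts x \<subseteq> cut_side G a" and sc: "emb_verts x \<subseteq> cut_side G c"
    using cut_side_contains[OF x(1) _ x(3)] b by auto
  have "\<forall>v\<in>Verts G. v \<in> cut_side G a \<union> cut_side G c"
  proof (rule vertex_induct[OF conn(1)])
    show "\<exists>v\<in>Verts G. v \<in> cut_side G a \<union> cut_side G c"
      using x(3) sa Emb_subset(1)[OF x(1)] by blast
    fix d assume d: "d \<in> Darts G" "dag G d \<in> Darts G" and q: "att G d \<in> cut_side G a \<union> cut_side G c"
    show "att G (dag G d) \<in> cut_side G a \<union> cut_side G c"
    proof (cases "dag G d \<in> darts_at G (emb_verts x)")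
      case True
      then show ?thesis using sa by (auto simp: darts_at_mem)
    next
      case False
      have n: "d \<noteq> a" "d \<noteq> c" using False da dc by auto
      consider "d = dag G a" | "d = dag G c" | "d \<noteq> dag G a" "d \<noteq> dag G c" by blast
      then show ?thesis
      proof cases
        case 1
        have "d \<noteq> dag G c" using 1 ne gG(5)[OF aA] gG(5)[OF cA] by metis
        moreover have "att G d \<in> cut_side G c" using 1 da sc by (auto simp: darts_at_mem)
        ultimately show ?thesis using cut_side_step[OF d n(2)] by blast
      next
        case 2
        have "d \<noteq> dag G a" using 2 ne gG(5)[OF aA] gG(5)[OF cA] by metis
        moreover have "att G d \<in> cut_side G a" using 2 dc sa by (auto simp: darts_at_mem)
        ultimately show ?thesis using cut_side_step[OF d n(1)] by blast
      next
        case 3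
        then show ?thesis using q cut_side_step[OF d n(1)] cut_side_step[OF d n(2)] by blast
      qed
    qed
  qed
  moreover obtain v where "v \<in> Verts G" "gverts \<phi> v \<noteq> {}"
  proof -
    have "(\<Union>v\<in>Verts G. gverts \<phi> v) = vert_image h"
      using graph_map_verts[OF map id_emb(1)[OF conn(1)]] id_emb(2)[OF conn(1)] image_id(1) by metis
    then have "(\<Union>v\<in>Verts G. gverts \<phi> v) \<noteq> {}" using V vert_image_empty_iff[of h] by metis
    then show thesis using that by blast
  qed
  ultimately show ?thesis
    unfolding live_cut[OF map] using aA cA da dc by (auto simp: darts_at_mem)
qed

text \<open>
  Collapsed embeddings lift to edges. If \<open>a\<close> is live then so is \<open>dag G
  c\<close>, and both are lifted through the same dart.
\<close>

lemma arc_lift_collapsed: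
  assumes x: "x \<in> Emb G" "emb_verts (gemb \<phi> x) = {}" and b: "emb_boundary x = {a, c}" and ne: "c \<noteq> a"
  shows "arc_lift c = dag H (arc_lift a)"
proof -
  have aA: "a \<in> Arcs G" and cA: "c \<in> Arcs G" using Emb_subset(2)[OF x(1)] b by auto
  have gc: "garc \<phi> c = dag G' (garc \<phi> a)"
  proof -
    obtain c' where "c' \<noteq> a" "emb_boundary x = {a, c'}" "garc \<phi> c' = dag G' (garc \<phi> a)"
      using collapsed_boundary[OF x, of a] b by auto
    then show ?thesis using b ne by (metis doubleton_eq_iff)
  qed
  show ?thesis
  proof (cases "Verts H = {}")
    case True
    have "earc h (arc_lift c) = earc h (dag H (arc_lift a))"
      using arc_lift(2)[OF cA] arc_lift(2)[OF aA] embeddingD(7)[OF emb arc_lift(1)[OF aA]] gc by simp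
    then show ?thesis by (rule inj_onD[OF edge_inj[OF True]]) (use arc_lift(1)[OF cA] arc_lift(1)[OF aA] gH(4) in simp_all)
  next
    case V: False
    show ?thesis
    proof (cases "emb_verts x = {}")
      case True
      then obtain e where e: "e \<in> Arcs G" "emb_boundary x = {e, dag G e}" using Emb_no_verts[OF x(1)] by blast
      then have "c = dag G a" using b ne gG(5)[OF e(1)] by (auto simp: doubleton_eq_iff)
      then show ?thesis using arc_lift_dag[OF aA] by simp
    next
      case xV: False
      have key: "arc_lift q = dag H (arc_lift p)"
        if pq: "emb_boundary x = {p, q}" "live \<phi> p" "garc \<phi> q = dag G' (garc \<phi> p)"
          and A: "p \<in> Arcs G" "q \<in> Arcs G" for p q
      proof -
        have "live \<phi> (dag G q)" by (rule live_through[OF x xV pq(1,2)])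
        then have "arc_lift (dag G q) = dag H (dart_lift (garc \<phi> q))" using V gG(5)[OF A(2)] by (simp add: arc_lift_def)
        also have "\<dots> = arc_lift p" using V pq(2,3) graph_mapD(5)[OF map A(1)] by (simp add: arc_lift_def)
        finally have "dag H (arc_lift q) = arc_lift p" using arc_lift_dag[OF A(2)] by simp
        then show ?thesis using gH(5)[OF arc_lift(1)[OF A(2)]] by simp
      qed
      from live_end[OF V x xV b ne] show ?thesis
      proof
        assume "live \<phi> a"
        then show ?thesis using key[OF b _ gc aA cA] by blast
      next
        assume l: "live \<phi> c"
        have b': "emb_boundary x = {c, a}" using b by blast
        have "garc \<phi> a = dag G' (garc \<phi> c)" using gc gG'(5)[OF graph_mapD(4)[OF map aA]] by simp
        then have "arc_lift a = dag H (arc_lift c)" using key[OF b' l _ cA aA] by blast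
        then show ?thesis using gH(5)[OF arc_lift(1)[OF cA]] by simp
      qed
    qed
  qed
qed

definition vert_lift :: "emb set \<Rightarrow> nat set" where
  "vert_lift x = {v \<in> Verts H. evert h v \<in> emb_verts (gemb \<phi> x)}"

lemma vert_lift_image: "x \<in> Emb G \<Longrightarrow> evert h ` vert_lift x = emb_verts (gemb \<phi> x)"
  using verts_sub[of x] by (auto simp: vert_lift_def vert_image_def)

text \<open>
  Boundary compatibility of the lift. Both \<open>arc_lift a\<close> and the boundary arc of
  \<open>z\<close> over the same arc are opposite to darts, which are determined by their
  images.
\<close>

lemma arc_lift_boundary:
  assumes x: "x \<in> Emb G" "emb_verts (gemb \<phi> x) \<noteq> {}" and z: "z \<in> Emb H" "emb_verts z \<noteq> {}"
    and zb: "earc h ` emb_boundary z = emb_boundary (gemb \<phi> x)"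
  shows "arc_lift ` emb_boundary x = emb_boundary z"
proof -
  note gb = graph_map_boundary(2)[OF map x(1)]
  have eq: "arc_lift a = c" if a: "a \<in> emb_boundary x" and c: "c \<in> emb_boundary z" and e: "earc h c = garc \<phi> a" for a c
  proof -
    have aA: "a \<in> Arcs G" using a Emb_subset(2)[OF x(1)] by blast
    have cA: "c \<in> Arcs H" using c Emb_subset(2)[OF z(1)] by blast
    have "dag H c \<in> Darts H" using emb_boundary_dag[OF z c] by (simp add: darts_at_mem)
    moreover have "earc h (arc_lift (dag G a)) = earc h (dag H c)"
      using arc_lift(2)[OF gG(4)[OF aA]] graph_mapD(5)[OF map aA] embeddingD(7)[OF emb cA] e by simp
    ultimately have "arc_lift (dag G a) = dag H c" by (rule dart_eq[OF arc_lift_noncollapsed[OF x(1) a x(2)]])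
    then have "dag H (arc_lift a) = dag H c" using arc_lift_dag[OF aA] by simp
    then show ?thesis by (rule dag_inj[OF conn(3) arc_lift(1)[OF aA] cA])
  qed
  show ?thesis
  proof (intro equalityI subsetI)
    fix c assume "c \<in> arc_lift ` emb_boundary x"
    then obtain a where a: "a \<in> emb_boundary x" "c = arc_lift a" by blast
    then have "garc \<phi> a \<in> earc h ` emb_boundary z" using gb zb by blast
    then obtain c' where "c' \<in> emb_boundary z" "earc h c' = garc \<phi> a" by auto
    then show "c \<in> emb_boundary z" using eq a by blast
  next
    fix c assume c: "c \<in> emb_boundary z"
    then have "earc h c \<in> garc \<phi> ` emb_boundary x" using gb zb by blast
    then obtain a where "a \<in> emb_boundary x" "earc h c = garc \<phi> a" by auto
    then show "c \<in> arc_lift ` emb_boundary x" using eq c by blast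
  qed
qed

text \<open>
  The image of \<open>x\<close> lies below that of the identity, hence factors through
  \<open>h\<close>; unless it is an edge, the factor is the lift.
\<close>

lemma lift_exists:
  assumes x: "x \<in> Emb G"
  shows "\<exists>z\<in>Emb H. emb_verts z = vert_lift x \<and> emb_boundary z = arc_lift ` emb_boundary x"
proof (cases "emb_verts (gemb \<phi> x) = {}")
  case True
  obtain b where "b \<in> Arcs G'" "emb_boundary (gemb \<phi> x) = {b, dag G' b}"
    using Emb_no_verts[OF graph_mapD(7)[OF map x] True] by blast
  then obtain a where a: "a \<in> emb_boundary x" using graph_map_boundary(2)[OF map x] by auto
  have aA: "a \<in> Arcs G" using a Emb_subset(2)[OF x] by blast
  obtain c where c: "c \<noteq> a" "emb_boundary x = {a, c}" using collapsed_boundary[OF x True a] by blast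
  have "arc_lift ` emb_boundary x = {arc_lift a, dag H (arc_lift a)}" using arc_lift_collapsed[OF x True c(2,1)] c(2) by simp
  moreover have "vert_lift x = {}" using True by (simp add: vert_lift_def)
  moreover obtain z where "z \<in> Emb H" "emb_verts z = {}" "emb_boundary z = {arc_lift a, dag H (arc_lift a)}"
    using edge_exists[OF conn(3) arc_lift(1)[OF aA]] edge_embs_iff by blast
  ultimately show ?thesis by (intro bexI[of _ z]) simp_all
next
  case False
  obtain k where k: "is_embedding G' k" "k \<in> gemb \<phi> x" "emb_verts (gemb \<phi> x) = vert_image k" "emb_boundary (gemb \<phi> x) = bdry_image k"
    using graph_mapD(7)[OF map x] by (rule Emb_E)
  have hm: "h \<in> emb_class G' h" using emb by (simp add: emb_class_mem emb_iso_iff)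
  obtain i where i: "factors_by h k i"
    using le_class[OF x] emb_le_factors[OF graph_mapD(7)[OF map x] emb_class_Emb[OF emb] k(2) hm] by blast
  have ie: "is_embedding H i" using i by (simp add: factors_by_def)
  note ci = emb_class_images[OF ie] and cE = emb_class_Emb[OF ie]
  have V: "evert h ` vert_image i = emb_verts (gemb \<phi> x)" and B: "earc h ` bdry_image i = emb_boundary (gemb \<phi> x)"
    using factors_images[OF i] k by simp_all
  have "vert_lift x = vert_image i"
  proof -
    have "evert h ` vert_lift x = evert h ` vert_image i" using V vert_lift_image[OF x] by simp
    then show ?thesis
      using inj_on_image_eq_iff[OF embeddingD(11)[OF emb], of "vert_lift x" "vert_image i"] embedding_verts_subset[OF ie]
      by (simp add: vert_lift_def)
  qed
  moreover have "arc_lift ` emb_boundary x = bdry_image i"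
  proof -
    have "vert_image i \<noteq> {}" using V False by (metis image_is_empty)
    then show ?thesis using arc_lift_boundary[OF x False cE] ci B by simp
  qed
  ultimately show ?thesis using ci cE by auto
qed

definition lift :: graph_map where
  "lift = \<lparr>gsrc = G, gtgt = H, garc = (\<lambda>a\<in>Arcs G. arc_lift a),
     gemb = (\<lambda>x\<in>Emb G. the_emb H (vert_lift x) (arc_lift ` emb_boundary x))\<rparr>"

lemma lift_sel [simp]: "gsrc lift = G" "gtgt lift = H" "a \<in> Arcs G \<Longrightarrow> garc lift a = arc_lift a"
  by (simp_all add: lift_def)

lemma lift_emb:
  assumes x: "x \<in> Emb G"
  shows "gemb lift x \<in> Emb H" "emb_verts (gemb lift x) = vert_lift x" "emb_boundary (gemb lift x) = arc_lift ` emb_boundary x"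
proof -
  obtain z where z: "z \<in> Emb H" "emb_verts z = vert_lift x" "emb_boundary z = arc_lift ` emb_boundary x"
    using lift_exists[OF x] by blast
  have "gemb lift x = z" using the_emb[OF z] x by (simp add: lift_def)
  then show "gemb lift x \<in> Emb H" "emb_verts (gemb lift x) = vert_lift x" "emb_boundary (gemb lift x) = arc_lift ` emb_boundary x"
    using z by simp_all
qed

lemma arc_lift_darts:
  assumes x: "x \<in> Emb G" and d: "arc_lift a \<in> Darts H" and a: "a \<in> Arcs G"
    and g: "garc \<phi> a \<in> darts_at G' (emb_verts (gemb \<phi> x))"
  shows "arc_lift a \<in> darts_at H (vert_lift x)"
  using d gH(7)[OF d] embeddingD(9)[OF emb d] arc_lift(2)[OF a] g by (simp add: darts_at_mem vert_lift_def)

text \<open>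
  The lift of an edge of \<open>y\<close> is an edge of the lift of \<open>y\<close>, which is
  monotonicity for edges. Cutting \<open>y\<close> at an interior edge gives two parts. If one
  of them is not collapsed, its boundary shows that the lift contains a dart of the lift of
  \<open>y\<close>. If both are collapsed, the edge is lifted to the same edge as the ends of
  \<open>y\<close>.
\<close>

lemma arc_lift_inside:
  assumes y: "y \<in> Emb G" and a: "a \<in> darts_at G (emb_verts y) \<union> emb_boundary y"
  shows "arc_lift a \<in> darts_at H (vert_lift y) \<union> arc_lift ` emb_boundary y"
proof -
  have aA: "a \<in> Arcs G" using a gG(3) Emb_subset(2)[OF y] by (auto simp: darts_at_mem)
  have cl: "arc_lift c \<in> darts_at H (vert_lift y) \<union> arc_lift ` emb_boundary y"
    if "arc_lift (dag G c) \<in> darts_at H (vert_lift y) \<union> arc_lift ` emb_boundary y" "c \<in> Arcs G" for c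
    using emb_arcs_dag_closed[OF lift_emb(1)[OF y], of "arc_lift (dag G c)"] that lift_emb(2,3)[OF y]
      arc_lift_dag[OF that(2)] gH(5)[OF arc_lift(1)[OF that(2)]] by simp
  have mono: "emb_verts (gemb \<phi> y') \<subseteq> emb_verts (gemb \<phi> y)" if "y' \<in> Emb G" "emb_le G y' y" for y'
    using graph_map_mono[OF map that(1) y that(2)] by (simp add: emb_le_def pair_le_def)
  consider "a \<in> emb_boundary y" | "dag G a \<in> emb_boundary y"
    | "a \<notin> emb_boundary y" "dag G a \<notin> emb_boundary y" by blast
  then show ?thesis
  proof cases
    case 1 then show ?thesis by blast
  next
    case 2 then show ?thesis using cl[of a] aA by blast
  next
    case 3
    then have aD: "a \<in> darts_at G (emb_verts y)" using a by blast
    obtain y1 y2 where y1: "y1 \<in> Emb G" "emb_le G y1 y" "a \<in> emb_boundary y1" "emb_boundary y1 \<subseteq> {a, dag G a} \<union> emb_boundary y"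
        "dag G a \<in> emb_boundary y1 \<longrightarrow> emb_verts y1 = emb_verts y"
      and y2: "y2 \<in> Emb G" "emb_le G y2 y" "dag G a \<in> emb_boundary y2"
      and un: "emb_verts y = emb_verts y1 \<union> emb_verts y2"
      using cut_inside[OF y aD 3] by (elim bexE conjE) (rule that)
    have Vun: "emb_verts (gemb \<phi> y) = emb_verts (gemb \<phi> y1) \<union> emb_verts (gemb \<phi> y2)"
      using graph_map_verts[OF map y] graph_map_verts[OF map y1(1)] graph_map_verts[OF map y2(1)] un by auto
    show ?thesis
    proof (cases "emb_verts (gemb \<phi> y) = {}")
      case False
      then have "emb_verts (gemb \<phi> y1) \<noteq> {} \<or> emb_verts (gemb \<phi> y2) \<noteq> {}" using Vun by blast
      then show ?thesis
      proof
        assume n: "emb_verts (gemb \<phi> y1) \<noteq> {}"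
        have "garc \<phi> (dag G a) \<in> darts_at G' (emb_verts (gemb \<phi> y))"
          using noncollapsed_boundary(3)[OF map y1(1,3) n] darts_at_mono[OF mono[OF y1(1,2)]] by blast
        then have "arc_lift (dag G a) \<in> darts_at H (vert_lift y)"
          by (rule arc_lift_darts[OF y arc_lift_noncollapsed[OF y1(1,3) n] gG(4)[OF aA]])
        then show ?thesis using cl[of a] aA by blast
      next
        assume n: "emb_verts (gemb \<phi> y2) \<noteq> {}"
        have dd: "dag G (dag G a) = a" by (rule gG(5)[OF aA])
        have g: "garc \<phi> a \<in> darts_at G' (emb_verts (gemb \<phi> y))"
          using noncollapsed_boundary(3)[OF map y2(1,3) n] darts_at_mono[OF mono[OF y2(1,2)]] dd by auto
        have "arc_lift a \<in> Darts H" using arc_lift_noncollapsed[OF y2(1,3) n] dd by simp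
        then show ?thesis using arc_lift_darts[OF y _ aA g] by blast
      qed
    next
      case True
      then have c1: "emb_verts (gemb \<phi> y1) = {}" using Vun by blast
      obtain c where c: "c \<noteq> a" "emb_boundary y1 = {a, c}" using collapsed_boundary[OF y1(1) c1 y1(3)] by blast
      have lc: "arc_lift c = arc_lift (dag G a)" using arc_lift_collapsed[OF y1(1) c1 c(2,1)] arc_lift_dag[OF aA] by simp
      have "c \<in> {a, dag G a} \<union> emb_boundary y" using c(2) y1(4) by blast
      then have "c = dag G a \<or> c \<in> emb_boundary y" using c(1) by blast
      then show ?thesis
      proof
        assume "c \<in> emb_boundary y"
        then have "arc_lift (dag G a) \<in> arc_lift ` emb_boundary y" unfolding lc[symmetric] by (rule imageI)
        then show ?thesis using cl[of a] aA by blast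
      next
        assume cd: "c = dag G a"
        then have V1: "emb_verts y1 = emb_verts y" using y1(5) c(2) by blast
        have yV: "emb_verts y \<noteq> {}" using aD by (auto simp: darts_at_mem)
        \<comment> \<open>The cut does not disconnect \<open>y\<close>, so that \<open>y\<close> would be a loop without ends; but it is sent to an edge, which has two ends.\<close>
        have "emb_boundary y \<subseteq> dag G ` darts_at G (emb_verts y)" by (rule regionD(3)[OF Emb_region[OF y yV]])
        moreover have "emb_boundary y \<inter> dag G ` darts_at G (emb_verts y) \<subseteq> emb_boundary y1"
          using y1(2) V1 by (simp add: emb_le_def pair_le_def)
        ultimately have "emb_boundary y \<subseteq> {a, dag G a}" using c(2) cd by blast
        then have "emb_boundary y = {}" using 3 by blast
        then have "emb_boundary (gemb \<phi> y) = {}" using graph_map_boundary(2)[OF map y] by simp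
        then show ?thesis using Emb_no_verts[OF graph_mapD(7)[OF map y] True] by auto
      qed
    qed
  qed
qed

text \<open>
  Ends of the lift of \<open>y\<close> at darts of the lift of \<open>x\<close> lie over ends of
  the image of \<open>x\<close>; as both are opposite to darts, they agree with the lifts of
  ends of \<open>x\<close>.
\<close>

lemma lift_mono:
  assumes x: "x \<in> Emb G" and y: "y \<in> Emb G" and le: "emb_le G x y"
  shows "emb_le H (gemb lift x) (gemb lift y)"
proof -
  have le': "emb_le G' (gemb \<phi> x) (gemb \<phi> y)" by (rule graph_map_mono[OF map x y le])
  have V: "vert_lift x \<subseteq> vert_lift y" using le' by (auto simp: emb_le_def pair_le_def vert_lift_def)
  have B: "arc_lift ` emb_boundary y \<inter> dag H ` darts_at H (vert_lift x) \<subseteq> arc_lift ` emb_boundary x"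
  proof
    fix b assume "b \<in> arc_lift ` emb_boundary y \<inter> dag H ` darts_at H (vert_lift x)"
    then obtain \<beta> d where \<beta>: "\<beta> \<in> emb_boundary y" "b = arc_lift \<beta>" and d: "d \<in> darts_at H (vert_lift x)" "b = dag H d" by blast
    have \<beta>A: "\<beta> \<in> Arcs G" using \<beta> Emb_subset(2)[OF y] by blast
    have dD: "d \<in> Darts H" "att H d \<in> vert_lift x" using d by (simp_all add: darts_at_mem)
    have dA: "d \<in> Arcs H" using dD gH(3) by simp
    have ne: "emb_verts (gemb \<phi> x) \<noteq> {}" using dD(2) by (auto simp: vert_lift_def)
    have hd: "earc h d \<in> darts_at G' (emb_verts (gemb \<phi> x))"
      using dD embeddingD(8,9)[OF emb dD(1)] by (simp add: darts_at_mem vert_lift_def)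
    have g: "garc \<phi> \<beta> = dag G' (earc h d)" using arc_lift(2)[OF \<beta>A] \<beta>(2) d(2) embeddingD(7)[OF emb dA] by simp
    have "garc \<phi> \<beta> \<in> emb_boundary (gemb \<phi> y)" using graph_map_boundary(2)[OF map y] \<beta>(1) by blast
    moreover have "emb_boundary (gemb \<phi> y) \<inter> dag G' ` darts_at G' (emb_verts (gemb \<phi> x)) \<subseteq> emb_boundary (gemb \<phi> x)"
      using le' by (simp add: emb_le_def pair_le_def)
    ultimately have "garc \<phi> \<beta> \<in> emb_boundary (gemb \<phi> x)" using g hd by blast
    then have "garc \<phi> \<beta> \<in> garc \<phi> ` emb_boundary x" using graph_map_boundary(2)[OF map x] by simp
    then obtain \<alpha> where \<alpha>: "\<alpha> \<in> emb_boundary x" "garc \<phi> \<beta> = garc \<phi> \<alpha>" by blast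
    have \<alpha>A: "\<alpha> \<in> Arcs G" using \<alpha> Emb_subset(2)[OF x] by blast
    have "earc h (arc_lift (dag G \<alpha>)) = dag G' (garc \<phi> \<alpha>)" using arc_lift(2)[OF gG(4)[OF \<alpha>A]] graph_mapD(5)[OF map \<alpha>A] by simp
    also have "\<dots> = earc h d" using \<alpha>(2) g gG'(5)[OF embeddingD(5)[OF emb dA]] by simp
    finally have "arc_lift (dag G \<alpha>) = d" by (rule dart_eq[OF arc_lift_noncollapsed[OF x \<alpha>(1) ne] dD(1)])
    then have "dag H (arc_lift \<alpha>) = d" using arc_lift_dag[OF \<alpha>A] by simp
    then have "b = arc_lift \<alpha>" using d(2) gH(5)[OF arc_lift(1)[OF \<alpha>A]] by simp
    then show "b \<in> arc_lift ` emb_boundary x" using \<alpha>(1) by blast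
  qed
  have C: "arc_lift ` emb_boundary x \<subseteq> darts_at H (vert_lift y) \<union> arc_lift ` emb_boundary y"
  proof
    fix c assume "c \<in> arc_lift ` emb_boundary x"
    then obtain a where a: "a \<in> emb_boundary x" "c = arc_lift a" by blast
    have "a \<in> darts_at G (emb_verts y) \<union> emb_boundary y"
    proof (cases "emb_verts x = {}")
      case True then show ?thesis using le a by (auto simp: emb_le_def pair_le_def)
    next
      case False
      have "dag G a \<in> darts_at G (emb_verts x)" by (rule emb_boundary_dag[OF x False a(1)])
      then have "dag G a \<in> darts_at G (emb_verts y) \<union> emb_boundary y"
        using le by (auto simp: emb_le_def pair_le_def darts_at_mem)
      then have "dag G (dag G a) \<in> darts_at G (emb_verts y) \<union> emb_boundary y" by (rule emb_arcs_dag_closed[OF y])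
      moreover have "dag G (dag G a) = a" using gG(5) a(1) Emb_subset(2)[OF x] by blast
      ultimately show ?thesis by simp
    qed
    then show "c \<in> darts_at H (vert_lift y) \<union> arc_lift ` emb_boundary y" using arc_lift_inside[OF y] a(2) by blast
  qed
  show ?thesis unfolding emb_le_def pair_le_def lift_emb(2,3)[OF x] lift_emb(2,3)[OF y] using V B C by blast
qed

lemma lift_map: "is_graph_map lift"
proof (rule graph_mapI[where F = "\<lambda>v. {w \<in> Verts H. evert h w \<in> gverts \<phi> v}"])
  show "connected_graph (gsrc lift)" "connected_graph (gtgt lift)" using conn by simp_all
  show "garc lift \<in> Arcs (gsrc lift) \<rightarrow>\<^sub>E Arcs (gtgt lift)" using arc_lift(1) by (auto simp: lift_def)
  show "garc lift (dag (gsrc lift) a) = dag (gtgt lift) (garc lift a)" if "a \<in> Arcs (gsrc lift)" for a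
    using that arc_lift_dag gG(4) by simp
  show "gemb lift \<in> Emb (gsrc lift) \<rightarrow>\<^sub>E Emb (gtgt lift)"
    by (rule PiE_I) (use lift_emb(1) in \<open>auto simp: lift_def\<close>)
  show "bij_betw (garc lift) (emb_boundary x) (emb_boundary (gemb lift x))" if "x \<in> Emb (gsrc lift)" for x
  proof -
    have x: "x \<in> Emb G" using that by simp
    have s: "a \<in> Arcs G" if "a \<in> emb_boundary x" for a using that Emb_subset(2)[OF x] by blast
    have "inj_on arc_lift (emb_boundary x)"
    proof (rule inj_onI)
      fix a b assume a: "a \<in> emb_boundary x" "b \<in> emb_boundary x" "arc_lift a = arc_lift b"
      then have "garc \<phi> a = garc \<phi> b" using arc_lift(2)[OF s] by metis
      then show "a = b" by (rule inj_onD[OF graph_map_boundary(1)[OF map x]]) (use a in simp_all)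
    qed
    then have "bij_betw arc_lift (emb_boundary x) (emb_boundary (gemb lift x))"
      using lift_emb(3)[OF x] by (simp add: bij_betw_def)
    moreover have "bij_betw (garc lift) (emb_boundary x) (emb_boundary (gemb lift x)) \<longleftrightarrow>
      bij_betw arc_lift (emb_boundary x) (emb_boundary (gemb lift x))"
      by (rule bij_betw_cong) (use s in simp)
    ultimately show ?thesis by simp
  qed
  show "emb_verts (gemb lift x) = (\<Union>v\<in>emb_verts x. {w \<in> Verts H. evert h w \<in> gverts \<phi> v})" if "x \<in> Emb (gsrc lift)" for x
    using lift_emb(2)[of x] graph_map_verts[OF map, of x] that by (auto simp: vert_lift_def)
  show "{w \<in> Verts H. evert h w \<in> gverts \<phi> u} \<inter> {w \<in> Verts H. evert h w \<in> gverts \<phi> v} = {}"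
    if "u \<in> Verts (gsrc lift)" "v \<in> Verts (gsrc lift)" "u \<noteq> v" for u v
    using graph_map_disjoint[OF map, of u v] that by auto
  show "emb_le (gtgt lift) (gemb lift x) (gemb lift y)"
    if "x \<in> Emb (gsrc lift)" "y \<in> Emb (gsrc lift)" "emb_le (gsrc lift) x y" for x y
    using lift_mono[of x y] that by simp
qed

text \<open>
  The lift of the identity lies over the class of \<open>h\<close>, hence is the identity of the
  domain of \<open>h\<close>.
\<close>

lemma lift_active: "gactive lift"
proof -
  note i = id_emb[OF conn(1)] and j = id_emb[OF conn(3)]
  have V: "vert_lift (id_emb G) = Verts H" using image_id(1) by (auto simp: vert_lift_def vert_image_def)
  have B: "arc_lift ` graph_boundary G = graph_boundary H"
  proof (cases "Verts H = {}")
    case False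
    have "arc_lift ` emb_boundary (id_emb G) = emb_boundary (id_emb H)"
      by (rule arc_lift_boundary[OF i(1) _ j(1)]) (use False image_id i j in \<open>simp_all add: vert_image_def bdry_image_def\<close>)
    then show ?thesis using i j by simp
  next
    case True
    have D: "graph_boundary H = Arcs H" using no_verts(1)[OF conn(3) True] by (simp add: graph_boundary_def)
    have "earc h ` arc_lift ` graph_boundary G = garc \<phi> ` graph_boundary G"
      unfolding image_image using arc_lift(2) by (intro image_cong) (auto simp: graph_boundary_def)
    also have "\<dots> = earc h ` Arcs H" using boundary_id(1) D by (simp add: bdry_image_def)
    finally show ?thesis
      using inj_on_image_eq_iff[OF edge_inj[OF True], of "arc_lift ` graph_boundary G" "Arcs H"] arc_lift(1) D
      by (auto simp: graph_boundary_def)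
  qed
  have "gemb lift (id_emb G) = id_emb H"
    using lift_emb[OF i(1)] V B i j by (intro Emb_ext[OF _ j(1)]) simp_all
  then show ?thesis using lift_map by (simp add: gactive_def)
qed

lemma lift_factors: "gcomp (inert_of G' h) lift = \<phi>"
proof (rule graph_map_ext[OF gcomp_map[OF lift_map inert_of_map[OF emb]] map])
  show "garc (gcomp (inert_of G' h) lift) = garc \<phi>"
  proof
    fix a show "garc (gcomp (inert_of G' h) lift) a = garc \<phi> a"
      using arc_lift(2)[of a] PiE_arb[OF graph_mapD(3)[OF map], of a]
      by (cases "a \<in> Arcs G") (simp_all add: U_cat_def compose_def)
  qed
  show "gverts (gcomp (inert_of G' h) lift) v = gverts \<phi> v" if "v \<in> Verts (gsrc (gcomp (inert_of G' h) lift))" for v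
  proof -
    have v: "v \<in> Verts G" using that by simp
    note ve = vert_emb(2)[OF conn(1) v]
    have "gverts (gcomp (inert_of G' h) lift) v = (\<Union>w\<in>gverts lift v. gverts (inert_of G' h) w)"
      by (rule gverts_gcomp[OF lift_map inert_of_map[OF emb]]) (use v in simp_all)
    also have "gverts lift v = vert_lift (vert_emb G v)" using lift_emb(2)[OF ve] by (simp add: gverts_def)
    also have "(\<Union>w\<in>vert_lift (vert_emb G v). gverts (inert_of G' h) w) = evert h ` vert_lift (vert_emb G v)"
      using gverts_inert_of[OF emb] by (auto simp: vert_lift_def)
    also have "\<dots> = gverts \<phi> v" using vert_lift_image[OF ve] by (simp add: gverts_def)
    finally show ?thesis .
  qed
qed simp_all

end

lemma factorization_exists:
  assumes \<phi>: "is_graph_map \<phi>"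
  shows "\<exists>r l. gactive r \<and> ginert l \<and> gtgt r = gsrc l \<and> gcomp l r = \<phi>"
proof -
  obtain h where h: "is_embedding (gtgt \<phi>) h" "gemb \<phi> (id_emb (gsrc \<phi>)) = emb_class (gtgt \<phi>) h"
    using Emb_rep[OF graph_mapD(7)[OF \<phi> id_emb(1)[OF graph_mapD(1)[OF \<phi>]]]] by blast
  interpret active_lift \<phi> h by unfold_locales (use \<phi> h in simp_all)
  show ?thesis
    using lift_active inert_of_ginert[OF h(1)] lift_factors by (intro exI[of _ lift] exI[of _ "inert_of (gtgt \<phi>) h"]) simp
qed

section \<open>Categories, patterns and equivalences\<close>

lemma categoryD:
  assumes "is_category C"
  shows "f \<in> Arr C \<Longrightarrow> Src C f \<in> Obj C" "f \<in> Arr C \<Longrightarrow> Tgt C f \<in> Obj C"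
    "x \<in> Obj C \<Longrightarrow> Idn C x \<in> Arr C" "x \<in> Obj C \<Longrightarrow> Src C (Idn C x) = x" "x \<in> Obj C \<Longrightarrow> Tgt C (Idn C x) = x"
    "f \<in> Arr C \<Longrightarrow> g \<in> Arr C \<Longrightarrow> Tgt C f = Src C g \<Longrightarrow> Cmp C g f \<in> Arr C"
    "f \<in> Arr C \<Longrightarrow> g \<in> Arr C \<Longrightarrow> Tgt C f = Src C g \<Longrightarrow> Src C (Cmp C g f) = Src C f"
    "f \<in> Arr C \<Longrightarrow> g \<in> Arr C \<Longrightarrow> Tgt C f = Src C g \<Longrightarrow> Tgt C (Cmp C g f) = Tgt C g"
    "f \<in> Arr C \<Longrightarrow> Cmp C f (Idn C (Src C f)) = f" "f \<in> Arr C \<Longrightarrow> Cmp C (Idn C (Tgt C f)) f = f"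
    "f \<in> Arr C \<Longrightarrow> g \<in> Arr C \<Longrightarrow> h \<in> Arr C \<Longrightarrow> Tgt C f = Src C g \<Longrightarrow> Tgt C g = Src C h \<Longrightarrow>
       Cmp C h (Cmp C g f) = Cmp C (Cmp C h g) f"
  using assms unfolding is_category_def by blast+

lemma isoE:
  assumes "is_iso C f"
  obtains g where "f \<in> Arr C" "g \<in> Arr C" "Src C g = Tgt C f" "Tgt C g = Src C f"
    "Cmp C g f = Idn C (Src C f)" "Cmp C f g = Idn C (Tgt C f)" "is_iso C g"
proof -
  obtain g where g: "f \<in> Arr C" "g \<in> Arr C" "Src C g = Tgt C f" "Tgt C g = Src C f"
    "Cmp C g f = Idn C (Src C f)" "Cmp C f g = Idn C (Tgt C f)" using assms by (auto simp: is_iso_def)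
  then have "is_iso C g" unfolding is_iso_def by auto
  then show thesis using that g by blast
qed

lemma iso_Idn: "is_category C \<Longrightarrow> x \<in> Obj C \<Longrightarrow> is_iso C (Idn C x)"
  unfolding is_iso_def
  using categoryD(3-5)[of C x] categoryD(9)[of C "Idn C x"] by (auto intro!: bexI[of _ "Idn C x"])

lemma iso_Cmp:
  assumes C: "is_category C" and f: "is_iso C f" and g: "is_iso C g" and e: "Tgt C f = Src C g"
  shows "is_iso C (Cmp C g f)"
proof -
  note c = categoryD[OF C]
  obtain f' where f': "f \<in> Arr C" "f' \<in> Arr C" "Src C f' = Tgt C f" "Tgt C f' = Src C f"
    "Cmp C f' f = Idn C (Src C f)" "Cmp C f f' = Idn C (Tgt C f)" using f by (rule isoE)
  obtain g' where g': "g \<in> Arr C" "g' \<in> Arr C" "Src C g' = Tgt C g" "Tgt C g' = Src C g"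
    "Cmp C g' g = Idn C (Src C g)" "Cmp C g g' = Idn C (Tgt C g)" using g by (rule isoE)
  have gf: "Cmp C g f \<in> Arr C" "Src C (Cmp C g f) = Src C f" "Tgt C (Cmp C g f) = Tgt C g"
    using c(6-8)[OF f'(1) g'(1) e] by simp_all
  have m: "Tgt C g' = Src C f'" using g'(4) f'(3) e by simp
  have fg: "Cmp C f' g' \<in> Arr C" "Src C (Cmp C f' g') = Tgt C g" "Tgt C (Cmp C f' g') = Src C f"
    using c(6-8)[OF g'(2) f'(2) m] g'(3) f'(4) by simp_all
  have 1: "Cmp C (Cmp C f' g') (Cmp C g f) = Idn C (Src C f)"
  proof -
    have "Cmp C (Cmp C f' g') (Cmp C g f) = Cmp C f' (Cmp C g' (Cmp C g f))"
      using c(11)[OF gf(1) g'(2) f'(2)] gf(3) g'(3) m by simp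
    also have "Cmp C g' (Cmp C g f) = Cmp C (Cmp C g' g) f" using c(11)[OF f'(1) g'(1,2)] e g'(3) by simp
    also have "\<dots> = f" using g'(5) e[symmetric] c(10)[OF f'(1)] by simp
    finally show ?thesis using f'(5) by simp
  qed
  have 2: "Cmp C (Cmp C g f) (Cmp C f' g') = Idn C (Tgt C g)"
  proof -
    have "Cmp C (Cmp C g f) (Cmp C f' g') = Cmp C g (Cmp C f (Cmp C f' g'))"
      using c(11)[OF fg(1) f'(1) g'(1)] fg(3) e by simp
    also have "Cmp C f (Cmp C f' g') = Cmp C (Cmp C f f') g'" using c(11)[OF g'(2) f'(2,1)] m f'(4) by simp
    also have "\<dots> = g'" using f'(6) e g'(4) c(10)[OF g'(2)] by simp
    finally show ?thesis using g'(6) by simp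
  qed
  show ?thesis unfolding is_iso_def using gf fg 1 2 by auto
qed

lemma isomorphic_refl: "is_category C \<Longrightarrow> x \<in> Obj C \<Longrightarrow> isomorphic C x x"
  unfolding isomorphic_def using iso_Idn[of C x] categoryD(4,5)[of C x] by blast

lemma isomorphic_sym: "isomorphic C x y \<Longrightarrow> isomorphic C y x"
  unfolding isomorphic_def by (metis isoE)

lemma isomorphic_trans:
  assumes "is_category C" "isomorphic C x y" "isomorphic C y z"
  shows "isomorphic C x z"
proof -
  obtain f g where f: "is_iso C f" "Src C f = x" "Tgt C f = y" and g: "is_iso C g" "Src C g = y" "Tgt C g = z"
    using assms(2,3) by (auto simp: isomorphic_def)
  then have A: "f \<in> Arr C" "g \<in> Arr C" by (auto simp: is_iso_def)
  have "is_iso C (Cmp C g f)" using iso_Cmp[OF assms(1) f(1) g(1)] f g by simp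
  then show ?thesis using categoryD(7,8)[OF assms(1) A] f g unfolding isomorphic_def by auto
qed

lemma functor_iso:
  assumes F: "is_functor C D F" and x: "isomorphic C x y"
  shows "isomorphic D (FOb F x) (FOb F y)"
proof -
  have C: "is_category C" using F by (simp add: is_functor_def)
  obtain f where f: "is_iso C f" "Src C f = x" "Tgt C f = y" using x by (auto simp: isomorphic_def)
  obtain g where g: "f \<in> Arr C" "g \<in> Arr C" "Src C g = Tgt C f" "Tgt C g = Src C f"
    "Cmp C g f = Idn C (Src C f)" "Cmp C f g = Idn C (Tgt C f)" using f(1) by (rule isoE)
  have FA: "\<And>f. f \<in> Arr C \<Longrightarrow> FAr F f \<in> Arr D \<and> Src D (FAr F f) = FOb F (Src C f) \<and> Tgt D (FAr F f) = FOb F (Tgt C f)"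
    and FC: "\<And>f g. f \<in> Arr C \<Longrightarrow> g \<in> Arr C \<Longrightarrow> Tgt C f = Src C g \<Longrightarrow> FAr F (Cmp C g f) = Cmp D (FAr F g) (FAr F f)"
    and FI: "\<And>x. x \<in> Obj C \<Longrightarrow> FAr F (Idn C x) = Idn D (FOb F x)"
    using F by (auto simp: is_functor_def)
  have "is_iso D (FAr F f)"
    unfolding is_iso_def
  proof (intro conjI bexI[of _ "FAr F g"])
    show "Cmp D (FAr F g) (FAr F f) = Idn D (Src D (FAr F f))"
      using FC[OF g(1,2)] FA[OF g(1)] g(3,5) FI[OF categoryD(1)[OF C g(1)]] by simp
    show "Cmp D (FAr F f) (FAr F g) = Idn D (Tgt D (FAr F f))"
      using FC[OF g(2,1)] FA[OF g(1)] g(4,6) FI[OF categoryD(2)[OF C g(1)]] by simp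
  qed (use FA g in auto)
  then show ?thesis using FA[OF g(1)] f unfolding isomorphic_def by auto
qed

lemma make_pattern_sel [simp]:
  "Obj (make_pattern C I A S) = Obj C" "Arr (make_pattern C I A S) = Arr C" "Src (make_pattern C I A S) = Src C"
  "Tgt (make_pattern C I A S) = Tgt C" "Idn (make_pattern C I A S) = Idn C" "Cmp (make_pattern C I A S) = Cmp C"
  "Inert (make_pattern C I A S) = I" "Active (make_pattern C I A S) = A" "Elem (make_pattern C I A S) = iso_closure C S"
  by (simp_all add: make_pattern_def)

lemma is_iso_make_pattern [simp]: "is_iso (make_pattern C I A S) f = is_iso C f"
  by (simp add: is_iso_def)

lemma isomorphic_make_pattern [simp]: "isomorphic (make_pattern C I A S) x y = isomorphic C x y"
  by (simp add: isomorphic_def)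

lemma is_category_make_pattern [simp]: "is_category (make_pattern C I A S) = is_category C"
  by (simp add: is_category_def)

lemma factorization_system_make_pattern [simp]:
  "factorization_system (make_pattern C I A S) L R = factorization_system C L R"
  by (simp add: factorization_system_def wide_subclass_def)

lemma make_pattern_is_pattern:
  assumes C: "is_category C" and f: "factorization_system C I A"
  shows "is_pattern (make_pattern C I A S)"
proof -
  have "y \<in> iso_closure C S" if x: "x \<in> iso_closure C S" and i: "isomorphic C x y" for x y
  proof -
    obtain s where s: "s \<in> S" "isomorphic C x s" using x by (auto simp: iso_closure_def)
    have "y \<in> Obj C" using i categoryD(2)[OF C] by (auto simp: isomorphic_def is_iso_def)
    then show ?thesis using s isomorphic_trans[OF C isomorphic_sym[OF i] s(2)] by (auto simp: iso_closure_def)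
  qed
  moreover have "iso_closure C S \<subseteq> Obj C" unfolding iso_closure_def by blast
  ultimately show ?thesis using C f unfolding is_pattern_def by simp
qed

lemma op_cat_sel [simp]: "Obj (op_cat C) = Obj C" "Arr (op_cat C) = Arr C" "Src (op_cat C) = Tgt C"
  "Tgt (op_cat C) = Src C" "Idn (op_cat C) = Idn C" "Cmp (op_cat C) g f = Cmp C f g"
  by (simp_all add: op_cat_def)

lemma op_cat_category: "is_category C \<Longrightarrow> is_category (op_cat C)"
  unfolding is_category_def by simp

lemma is_iso_op [simp]: "is_iso (op_cat C) f = is_iso C f"
  by (auto simp: is_iso_def)

lemma inert_cat_sel [simp]: "Obj (inert_cat P) = Obj P" "Arr (inert_cat P) = Inert P" "Src (inert_cat P) = Src P"
  "Tgt (inert_cat P) = Tgt P" "Idn (inert_cat P) = Idn P" "Cmp (inert_cat P) = Cmp P"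
  by (simp_all add: inert_cat_def)

lemma inert_cat_category:
  assumes P: "is_pattern P"
  shows "is_category (inert_cat P)"
proof -
  have C: "is_category P" and W: "wide_subclass P (Inert P)"
    using P by (auto simp: is_pattern_def factorization_system_def)
  have s: "f \<in> Inert P \<Longrightarrow> f \<in> Arr P" for f using W by (auto simp: wide_subclass_def)
  have i: "x \<in> Obj P \<Longrightarrow> Idn P x \<in> Inert P" for x using W iso_Idn[OF C] by (auto simp: wide_subclass_def)
  have c: "f \<in> Inert P \<Longrightarrow> g \<in> Inert P \<Longrightarrow> Tgt P f = Src P g \<Longrightarrow> Cmp P g f \<in> Inert P" for f g
    using W by (auto simp: wide_subclass_def)
  show ?thesis unfolding is_category_def using categoryD[OF C] s i c by simp
qed

lemma under_cat_sel [simp]: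
  "Obj (under_cat C x) = {f \<in> Arr C. Src C f = x}"
  "(f, g, f') \<in> Arr (under_cat C x) \<longleftrightarrow> f \<in> Arr C \<and> g \<in> Arr C \<and> f' \<in> Arr C \<and> Src C f = x \<and>
     Tgt C f = Src C g \<and> f' = Cmp C g f"
  "Src (under_cat C x) (f, g, f') = f" "Tgt (under_cat C x) (f, g, f') = f'"
  "Idn (under_cat C x) f = (f, Idn C (Tgt C f), f)"
  "Cmp (under_cat C x) (f1, h, f2) (f, g, f0) = (f, Cmp C h g, f2)"
  by (auto simp: under_cat_def)

lemma under_cat_category:
  assumes C: "is_category C"
  shows "is_category (under_cat C x)"
  unfolding is_category_def
proof (intro conjI ballI impI)
  note c = categoryD[OF C]
  fix t assume t: "t \<in> Arr (under_cat C x)"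
  obtain f g f' where e: "t = (f, g, f')" by (cases t)
  have a: "f \<in> Arr C" "g \<in> Arr C" "f' \<in> Arr C" "Src C f = x" "Tgt C f = Src C g" "f' = Cmp C g f" using t unfolding e under_cat_sel by blast+
  have f': "Tgt C f' = Tgt C g" "Src C f' = x" using a c(7,8)[OF a(1,2,5)] by simp_all
  show "Src (under_cat C x) t \<in> Obj (under_cat C x)" "Tgt (under_cat C x) t \<in> Obj (under_cat C x)"
    using a f' by (simp_all add: e)
  show "Cmp (under_cat C x) t (Idn (under_cat C x) (Src (under_cat C x) t)) = t"
    "Cmp (under_cat C x) (Idn (under_cat C x) (Tgt (under_cat C x) t)) t = t"
    using a f' c(9,10)[OF a(2)] by (simp_all add: e)
  fix u assume u: "u \<in> Arr (under_cat C x)" and tu: "Tgt (under_cat C x) t = Src (under_cat C x) u"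
  obtain k l k' where eu: "u = (k, l, k')" by (cases u)
  have b: "k = f'" "l \<in> Arr C" "k' \<in> Arr C" "Tgt C g = Src C l" "k' = Cmp C l f'"
  proof -
    show kf: "k = f'" using tu by (simp add: e eu)
    have "k \<in> Arr C \<and> l \<in> Arr C \<and> k' \<in> Arr C \<and> Src C k = x \<and> Tgt C k = Src C l \<and> k' = Cmp C l k"
      using u unfolding eu under_cat_sel .
    then show "l \<in> Arr C" "k' \<in> Arr C" "Tgt C g = Src C l" "k' = Cmp C l f'" using f'(1) kf by metis+
  qed
  note lg = c(6-8)[OF a(2) b(2,4)]
  have k': "k' = Cmp C (Cmp C l g) f" using b(5) a(6) c(11)[OF a(1,2) b(2) a(5) b(4)] by simp
  show "Cmp (under_cat C x) u t \<in> Arr (under_cat C x)" using a b lg k' by (simp add: e eu)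
  show "Src (under_cat C x) (Cmp (under_cat C x) u t) = Src (under_cat C x) t"
    "Tgt (under_cat C x) (Cmp (under_cat C x) u t) = Tgt (under_cat C x) u" by (simp_all add: e eu)
  fix v assume v: "v \<in> Arr (under_cat C x)" and uv: "Tgt (under_cat C x) u = Src (under_cat C x) v"
  obtain m n m' where ev: "v = (m, n, m')" by (cases v)
  have d: "m = k'" "n \<in> Arr C" "Tgt C k' = Src C n" using v uv by (simp_all add: eu ev)
  have "Tgt C k' = Tgt C l" using c(8)[OF a(3) b(2)] f'(1) b(4,5) by simp
  then have "Cmp C n (Cmp C l g) = Cmp C (Cmp C n l) g" using c(11)[OF a(2) b(2) d(2) b(4)] d(3) by simp
  then show "Cmp (under_cat C x) v (Cmp (under_cat C x) u t) = Cmp (under_cat C x) (Cmp (under_cat C x) v u) t"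
    by (simp add: e eu ev)
next
  fix f assume "f \<in> Obj (under_cat C x)"
  then have f: "f \<in> Arr C" "Src C f = x" by simp_all
  note c = categoryD[OF C]
  show "Idn (under_cat C x) f \<in> Arr (under_cat C x)" using f c(2,3,4,10) by simp
  show "Src (under_cat C x) (Idn (under_cat C x) f) = f" "Tgt (under_cat C x) (Idn (under_cat C x) f) = f" by simp_all
qed

lemma full_subcat_sel [simp]: "Obj (full_subcat C S) = Obj C \<inter> S"
  "Arr (full_subcat C S) = {f \<in> Arr C. Src C f \<in> S \<and> Tgt C f \<in> S}" "Src (full_subcat C S) = Src C"
  "Tgt (full_subcat C S) = Tgt C" "Idn (full_subcat C S) = Idn C" "Cmp (full_subcat C S) = Cmp C"
  by (simp_all add: full_subcat_def)

lemma full_subcat_category: "is_category C \<Longrightarrow> is_category (full_subcat C S)"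
  unfolding is_category_def by simp

lemma el_under_category: "is_pattern P \<Longrightarrow> is_category (el_under P x)"
  unfolding el_under_def by (intro full_subcat_category under_cat_category inert_cat_category)

lemma el_under_sel [simp]:
  "Obj (el_under P x) = {f \<in> Inert P. Src P f = x \<and> Tgt P f \<in> Elem P}"
  "(f, g, f') \<in> Arr (el_under P x) \<longleftrightarrow> f \<in> Inert P \<and> g \<in> Inert P \<and> f' \<in> Inert P \<and> Src P f = x \<and>
     Tgt P f = Src P g \<and> f' = Cmp P g f \<and> Tgt P f \<in> Elem P \<and> Tgt P f' \<in> Elem P"
  "Src (el_under P x) (f, g, f') = f" "Tgt (el_under P x) (f, g, f') = f'"
  "Idn (el_under P x) f = (f, Idn P (Tgt P f), f)"
  "Cmp (el_under P x) (f1, h, f2) (f, g, f0) = (f, Cmp P h g, f2)"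
  by (auto simp: el_under_def)

lemma under_functor:
  assumes m: "pattern_morphism P Q F"
  shows "is_functor (el_under P x) (el_under Q (FOb F x)) (under_fctr F)"
proof -
  have P: "is_pattern P" "is_pattern Q" and F: "is_functor P Q F"
    and I: "\<And>f. f \<in> Inert P \<Longrightarrow> FAr F f \<in> Inert Q" and E: "\<And>x. x \<in> Elem P \<Longrightarrow> FOb F x \<in> Elem Q"
    using m by (auto simp: pattern_morphism_def)
  have C: "is_category P" using P by (simp add: is_pattern_def)
  have s: "f \<in> Inert P \<Longrightarrow> f \<in> Arr P" for f
    using P by (auto simp: is_pattern_def factorization_system_def wide_subclass_def)
  have FA: "Src Q (FAr F f) = FOb F (Src P f)" "Tgt Q (FAr F f) = FOb F (Tgt P f)" if "f \<in> Inert P" for f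
    using F s[OF that] by (auto simp: is_functor_def)
  have FC: "FAr F (Cmp P g f) = Cmp Q (FAr F g) (FAr F f)" if "f \<in> Inert P" "g \<in> Inert P" "Tgt P f = Src P g" for f g
    using F s that by (auto simp: is_functor_def)
  have FI: "FAr F (Idn P (Tgt P f)) = Idn Q (FOb F (Tgt P f))" if "f \<in> Inert P" for f
    using F categoryD(2)[OF C s[OF that]] by (auto simp: is_functor_def)
  show ?thesis
    unfolding is_functor_def
  proof (intro conjI ballI impI)
    show "is_category (el_under P x)" "is_category (el_under Q (FOb F x))" by (intro el_under_category P)+
    show "FOb (under_fctr F) f \<in> Obj (el_under Q (FOb F x))" if "f \<in> Obj (el_under P x)" for f
      using that I E FA by (auto simp: under_fctr_def)
    show "FAr (under_fctr F) (Idn (el_under P x) f) = Idn (el_under Q (FOb F x)) (FOb (under_fctr F) f)"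
      if "f \<in> Obj (el_under P x)" for f
      using that FI FA by (auto simp: under_fctr_def)
    fix t assume t: "t \<in> Arr (el_under P x)"
    obtain f g f' where e: "t = (f, g, f')" by (cases t)
    have a: "f \<in> Inert P" "g \<in> Inert P" "f' \<in> Inert P" "Src P f = x" "Tgt P f = Src P g" "f' = Cmp P g f"
      "Tgt P f \<in> Elem P" "Tgt P f' \<in> Elem P" using t unfolding e el_under_sel by blast+
    show "FAr (under_fctr F) t \<in> Arr (el_under Q (FOb F x))"
      using a I[OF a(1)] I[OF a(2)] I[OF a(3)] FA[OF a(1)] FA[OF a(2)] FA[OF a(3)] FC[OF a(1,2,5)] E
      by (simp add: e under_fctr_def)
    show "Src (el_under Q (FOb F x)) (FAr (under_fctr F) t) = FOb (under_fctr F) (Src (el_under P x) t)"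
      "Tgt (el_under Q (FOb F x)) (FAr (under_fctr F) t) = FOb (under_fctr F) (Tgt (el_under P x) t)"
      by (simp_all add: e under_fctr_def)
    fix u assume u: "u \<in> Arr (el_under P x)" and tu: "Tgt (el_under P x) t = Src (el_under P x) u"
    obtain k l k' where eu: "u = (k, l, k')" by (cases u)
    have b: "l \<in> Inert P" "Tgt P g = Src P l"
      using u tu a categoryD(8)[OF C s[OF a(1)] s[OF a(2)] a(5)] by (simp_all add: e eu)
    show "FAr (under_fctr F) (Cmp (el_under P x) u t) = Cmp (el_under Q (FOb F x)) (FAr (under_fctr F) u) (FAr (under_fctr F) t)"
      using FC[OF a(2) b] by (simp add: e eu under_fctr_def)
  qed
qed

text \<open>
  Two categories in which objects with the same label are joined by exactly one arrow, and
  others by none, are both equivalent to their sets of labels. A functor that preserves labels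
  and hits all of them is an equivalence; all equations between arrows hold for lack of choice.
\<close>

lemma thin_equivalence:
  fixes C :: "('o, 'm) cat" and D :: "('p, 'n) cat" and L :: "'p \<Rightarrow> 'l"
  assumes F: "is_functor C D F"
    and Cex: "\<And>x y. x \<in> Obj C \<Longrightarrow> y \<in> Obj C \<Longrightarrow> L (FOb F x) = L (FOb F y) \<Longrightarrow> \<exists>f\<in>Arr C. Src C f = x \<and> Tgt C f = y"
    and Cun: "\<And>f g. f \<in> Arr C \<Longrightarrow> g \<in> Arr C \<Longrightarrow> Src C f = Src C g \<Longrightarrow> Tgt C f = Tgt C g \<Longrightarrow> f = g"
    and Dex: "\<And>x y. x \<in> Obj D \<Longrightarrow> y \<in> Obj D \<Longrightarrow> L x = L y \<Longrightarrow> \<exists>f\<in>Arr D. Src D f = x \<and> Tgt D f = y"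
    and Dun: "\<And>f g. f \<in> Arr D \<Longrightarrow> g \<in> Arr D \<Longrightarrow> Src D f = Src D g \<Longrightarrow> Tgt D f = Tgt D g \<Longrightarrow> f = g"
    and DL: "\<And>f. f \<in> Arr D \<Longrightarrow> L (Src D f) = L (Tgt D f)"
    and sur: "\<And>d. d \<in> Obj D \<Longrightarrow> \<exists>c\<in>Obj C. L (FOb F c) = L d"
  shows "is_equivalence C D F"
proof -
  have C: "is_category C" and D: "is_category D" using F by (auto simp: is_functor_def)
  note c = categoryD[OF C] and d = categoryD[OF D]
  have FO: "FOb F x \<in> Obj D" if "x \<in> Obj C" for x using F that by (auto simp: is_functor_def)
  have FA: "FAr F f \<in> Arr D" "Src D (FAr F f) = FOb F (Src C f)" "Tgt D (FAr F f) = FOb F (Tgt C f)" if "f \<in> Arr C" for f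
    using F that by (auto simp: is_functor_def)
  define ca where "ca x y = (SOME f. f \<in> Arr C \<and> Src C f = x \<and> Tgt C f = y)" for x y
  have ca: "ca x y \<in> Arr C" "Src C (ca x y) = x" "Tgt C (ca x y) = y"
    if "x \<in> Obj C" "y \<in> Obj C" "L (FOb F x) = L (FOb F y)" for x y
  proof -
    have "\<exists>f. f \<in> Arr C \<and> Src C f = x \<and> Tgt C f = y" using Cex[OF that] by blast
    from someI_ex[OF this] show "ca x y \<in> Arr C" "Src C (ca x y) = x" "Tgt C (ca x y) = y" by (auto simp: ca_def)
  qed
  define da where "da x y = (SOME f. f \<in> Arr D \<and> Src D f = x \<and> Tgt D f = y)" for x y
  have da: "da x y \<in> Arr D" "Src D (da x y) = x" "Tgt D (da x y) = y" if "x \<in> Obj D" "y \<in> Obj D" "L x = L y" for x y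
  proof -
    have "\<exists>f. f \<in> Arr D \<and> Src D f = x \<and> Tgt D f = y" using Dex[OF that] by blast
    from someI_ex[OF this] show "da x y \<in> Arr D" "Src D (da x y) = x" "Tgt D (da x y) = y" by (auto simp: da_def)
  qed
  have CL: "L (FOb F (Src C f)) = L (FOb F (Tgt C f))" if "f \<in> Arr C" for f using DL[OF FA(1)[OF that]] FA(2,3)[OF that] by simp
  define go where "go y = (SOME x. x \<in> Obj C \<and> L (FOb F x) = L y)" for y
  have go: "go y \<in> Obj C" "L (FOb F (go y)) = L y" if "y \<in> Obj D" for y
  proof -
    have "\<exists>x. x \<in> Obj C \<and> L (FOb F x) = L y" using sur[OF that] by blast
    from someI_ex[OF this] show "go y \<in> Obj C" "L (FOb F (go y)) = L y" by (auto simp: go_def)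
  qed
  define K where "K = \<lparr>FOb = go, FAr = (\<lambda>f. ca (go (Src D f)) (go (Tgt D f)))\<rparr>"
  have KA: "FAr K f \<in> Arr C" "Src C (FAr K f) = go (Src D f)" "Tgt C (FAr K f) = go (Tgt D f)" if "f \<in> Arr D" for f
    using ca[OF go(1)[OF d(1)[OF that]] go(1)[OF d(2)[OF that]]] go(2)[OF d(1)[OF that]] go(2)[OF d(2)[OF that]] DL[OF that]
    by (simp_all add: K_def)
  have KO: "FOb K y = go y" for y by (simp add: K_def)
  have Ciso: "is_iso C f" if f: "f \<in> Arr C" for f
  proof -
    let ?g = "ca (Tgt C f) (Src C f)"
    have g: "?g \<in> Arr C" "Src C ?g = Tgt C f" "Tgt C ?g = Src C f"
      using ca[OF c(2)[OF f] c(1)[OF f]] CL[OF f] by simp_all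
    have "Cmp C ?g f = Idn C (Src C f)"
      by (rule Cun) (use f g c(1,3-8) in simp_all)
    moreover have "Cmp C f ?g = Idn C (Tgt C f)"
      by (rule Cun) (use f g c(2,3-8) in simp_all)
    ultimately show ?thesis using f g unfolding is_iso_def by auto
  qed
  have Diso: "is_iso D f" if f: "f \<in> Arr D" for f
  proof -
    let ?g = "da (Tgt D f) (Src D f)"
    have g: "?g \<in> Arr D" "Src D ?g = Tgt D f" "Tgt D ?g = Src D f"
      using da[OF d(2)[OF f] d(1)[OF f]] DL[OF f] by simp_all
    have "Cmp D ?g f = Idn D (Src D f)"
      by (rule Dun) (use f g d(1,3-8) in simp_all)
    moreover have "Cmp D f ?g = Idn D (Tgt D f)"
      by (rule Dun) (use f g d(2,3-8) in simp_all)
    ultimately show ?thesis using f g unfolding is_iso_def by auto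
  qed
  have KF: "is_functor D C K"
    unfolding is_functor_def
  proof (intro conjI ballI impI)
    show "FOb K y \<in> Obj C" if "y \<in> Obj D" for y using go(1)[OF that] KO by simp
    show "FAr K (Idn D y) = Idn C (FOb K y)" if "y \<in> Obj D" for y
      by (rule Cun) (use KA[OF d(3)[OF that]] d(4,5)[OF that] c(3-5)[OF go(1)[OF that]] KO in simp_all)
    show "FAr K (Cmp D g f) = Cmp C (FAr K g) (FAr K f)" if "f \<in> Arr D" "g \<in> Arr D" "Tgt D f = Src D g" for f g
    proof -
      have e: "Tgt C (FAr K f) = Src C (FAr K g)" using KA that by simp
      show ?thesis
        by (rule Cun) (use KA[OF d(6)[OF that]] d(7,8)[OF that] c(6-8)[OF KA(1)[OF that(1)] KA(1)[OF that(2)] e] KA that in simp_all)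
    qed
  qed (use C D KA KO in simp_all)
  define \<tau> where "\<tau> x = ca x (go (FOb F x))" for x
  have \<tau>: "\<tau> x \<in> Arr C" "Src C (\<tau> x) = x" "Tgt C (\<tau> x) = go (FOb F x)" if "x \<in> Obj C" for x
    using ca[OF that go(1)[OF FO[OF that]]] go(2)[OF FO[OF that]] by (simp_all add: \<tau>_def)
  have "is_nat_iso C C id_fctr (comp_fctr K F) \<tau>"
    unfolding is_nat_iso_def
  proof (intro conjI ballI)
    show "is_iso C (\<tau> x)" "Src C (\<tau> x) = FOb id_fctr x" "Tgt C (\<tau> x) = FOb (comp_fctr K F) x" if "x \<in> Obj C" for x
      using Ciso \<tau>[OF that] KO by (simp_all add: id_fctr_def comp_fctr_def)
    fix f assume f: "f \<in> Arr C"
    have k: "FAr K (FAr F f) \<in> Arr C" "Src C (FAr K (FAr F f)) = go (FOb F (Src C f))" "Tgt C (FAr K (FAr F f)) = go (FOb F (Tgt C f))"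
      using KA[OF FA(1)[OF f]] FA[OF f] by simp_all
    show "Cmp C (\<tau> (Tgt C f)) (FAr id_fctr f) = Cmp C (FAr (comp_fctr K F) f) (\<tau> (Src C f))"
      by (rule Cun) (use k f \<tau>[OF c(1)[OF f]] \<tau>[OF c(2)[OF f]] c(6-8) in \<open>simp_all add: id_fctr_def comp_fctr_def\<close>)
  qed
  moreover define \<sigma> where "\<sigma> y = da (FOb F (go y)) y" for y
  have \<sigma>: "\<sigma> y \<in> Arr D" "Src D (\<sigma> y) = FOb F (go y)" "Tgt D (\<sigma> y) = y" if "y \<in> Obj D" for y
    using da[OF FO[OF go(1)[OF that]] that] go(2)[OF that] by (simp_all add: \<sigma>_def)
  have "is_nat_iso D D (comp_fctr F K) id_fctr \<sigma>"
    unfolding is_nat_iso_def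
  proof (intro conjI ballI)
    show "is_iso D (\<sigma> x)" "Src D (\<sigma> x) = FOb (comp_fctr F K) x" "Tgt D (\<sigma> x) = FOb id_fctr x" if "x \<in> Obj D" for x
      using Diso \<sigma>[OF that] KO by (simp_all add: id_fctr_def comp_fctr_def)
    fix f assume f: "f \<in> Arr D"
    have k: "FAr F (FAr K f) \<in> Arr D" "Src D (FAr F (FAr K f)) = FOb F (go (Src D f))" "Tgt D (FAr F (FAr K f)) = FOb F (go (Tgt D f))"
      using FA[OF KA(1)[OF f]] KA[OF f] by simp_all
    show "Cmp D (\<sigma> (Tgt D f)) (FAr (comp_fctr F K) f) = Cmp D (FAr id_fctr f) (\<sigma> (Src D f))"
      by (rule Dun) (use k f \<sigma>[OF d(1)[OF f]] \<sigma>[OF d(2)[OF f]] d(6-8) in \<open>simp_all add: id_fctr_def comp_fctr_def\<close>)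
  qed
  ultimately show ?thesis unfolding is_equivalence_def using F KF by blast
qed

section \<open>Finite pointed sets\<close>

lemma FinPt_Obj: "P \<in> Obj FinPt \<longleftrightarrow> finite (fst P) \<and> snd P \<in> fst P"
  by (cases P) (simp add: FinPt_def)

lemma FinPt_Arr: "(P, Q, f) \<in> Arr FinPt \<longleftrightarrow> P \<in> Obj FinPt \<and> Q \<in> Obj FinPt \<and> f \<in> fst P \<rightarrow>\<^sub>E fst Q \<and> f (snd P) = snd Q"
  by (cases P; cases Q) (auto simp: FinPt_def)

lemma FinPt_sel [simp]: "Src FinPt (P, Q, f) = P" "Tgt FinPt (P, Q, f) = Q" "Idn FinPt P = (P, P, \<lambda>a\<in>fst P. a)"
  "Cmp FinPt (Q', R, g) (P, Q, f) = (P, R, compose (fst P) g f)"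
  by (simp_all add: FinPt_def)

lemma FinPt_inert_iff: "(P, Q, f) \<in> FinPt_inert \<longleftrightarrow> (P, Q, f) \<in> Arr FinPt \<and> bij_betw f {a \<in> fst P. f a \<noteq> snd Q} (fst Q - {snd Q})"
  by (cases P; cases Q) (auto simp: FinPt_inert_def)

lemma FinPt_active_iff: "(P, Q, f) \<in> FinPt_active \<longleftrightarrow> (P, Q, f) \<in> Arr FinPt \<and> {a \<in> fst P. f a = snd Q} = {snd P}"
  by (cases P; cases Q) (auto simp: FinPt_active_def)

lemma FinPt_Idn: "P \<in> Obj FinPt \<Longrightarrow> (P, P, \<lambda>a\<in>fst P. a) \<in> Arr FinPt"
  by (auto simp: FinPt_Arr FinPt_Obj)

lemma FinPt_Cmp: "(P, Q, f) \<in> Arr FinPt \<Longrightarrow> (Q, R, g) \<in> Arr FinPt \<Longrightarrow> (P, R, compose (fst P) g f) \<in> Arr FinPt"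
  by (auto simp: FinPt_Arr FinPt_Obj compose_def PiE_def Pi_def extensional_def)

lemma FinPt_category: "is_category FinPt"
  unfolding is_category_def
proof (intro conjI ballI impI)
  show "Idn FinPt P \<in> Arr FinPt" "Src FinPt (Idn FinPt P) = P" "Tgt FinPt (Idn FinPt P) = P" if "P \<in> Obj FinPt" for P
    using FinPt_Idn[OF that] by simp_all
  fix t assume t: "t \<in> Arr FinPt"
  obtain P Q f where e: "t = (P, Q, f)" by (cases t)
  have f: "f \<in> extensional (fst P)" "f \<in> fst P \<rightarrow> fst Q" and O: "P \<in> Obj FinPt" "Q \<in> Obj FinPt"
    using t by (auto simp: e FinPt_Arr PiE_def)
  show "Src FinPt t \<in> Obj FinPt" "Tgt FinPt t \<in> Obj FinPt" using O by (simp_all add: e)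
  show "Cmp FinPt t (Idn FinPt (Src FinPt t)) = t" "Cmp FinPt (Idn FinPt (Tgt FinPt t)) t = t"
    using compose_Id[OF f(2,1)] Id_compose[OF f(2,1)] by (simp_all add: e)
  fix u assume u: "u \<in> Arr FinPt" and tu: "Tgt FinPt t = Src FinPt u"
  obtain R g where eu: "u = (Q, R, g)" using tu by (cases u) (simp add: e)
  show "Cmp FinPt u t \<in> Arr FinPt" using FinPt_Cmp[of P Q f R g] t u by (simp add: e eu)
  show "Src FinPt (Cmp FinPt u t) = Src FinPt t" "Tgt FinPt (Cmp FinPt u t) = Tgt FinPt u" by (simp_all add: e eu)
  fix v assume v: "v \<in> Arr FinPt" and uv: "Tgt FinPt u = Src FinPt v"
  obtain T h where ev: "v = (R, T, h)" using uv by (cases v) (simp add: eu)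
  show "Cmp FinPt v (Cmp FinPt u t) = Cmp FinPt (Cmp FinPt v u) t"
    using compose_assoc[OF f(2), of h g] by (simp add: e eu ev)
qed

lemma FinPt_iso_bij:
  assumes "is_iso FinPt (P, Q, f)"
  shows "(P, Q, f) \<in> Arr FinPt" "bij_betw f (fst P) (fst Q)"
proof -
  obtain t where t: "(P, Q, f) \<in> Arr FinPt" "t \<in> Arr FinPt" "Src FinPt t = Q" "Tgt FinPt t = P"
    "Cmp FinPt t (P, Q, f) = Idn FinPt P" "Cmp FinPt (P, Q, f) t = Idn FinPt Q"
    using assms by (auto simp: is_iso_def)
  obtain g where e: "t = (Q, P, g)" using t(3,4) by (cases t) simp
  show "(P, Q, f) \<in> Arr FinPt" by fact
  have fP: "f a \<in> fst Q" if "a \<in> fst P" for a using t(1) that by (auto simp: FinPt_Arr)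
  have gP: "g a \<in> fst P" if "a \<in> fst Q" for a using t(2) that by (auto simp: FinPt_Arr e)
  have c: "compose (fst P) g f = (\<lambda>a\<in>fst P. a)" "compose (fst Q) f g = (\<lambda>a\<in>fst Q. a)"
    using t(5,6) by (simp_all add: e)
  have gf: "g (f a) = a" if "a \<in> fst P" for a
    using fun_cong[OF c(1), of a] that by (simp add: compose_def)
  have fg: "f (g a) = a" if "a \<in> fst Q" for a
    using fun_cong[OF c(2), of a] that by (simp add: compose_def)
  show "bij_betw f (fst P) (fst Q)" by (rule bij_betw_byWitness[of _ g]) (use fP gP gf fg in auto)
qed

lemma FinPt_inert_surj:
  assumes "(P, Q, f) \<in> FinPt_inert" "b \<in> fst Q"
  shows "\<exists>a\<in>fst P. f a = b"
proof (cases "b = snd Q")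
  case True
  then show ?thesis using assms by (auto simp: FinPt_inert_iff FinPt_Arr FinPt_Obj)
next
  case False
  then have "b \<in> f ` {a \<in> fst P. f a \<noteq> snd Q}" using assms bij_betw_imp_surj_on by (fastforce simp: FinPt_inert_iff)
  then show ?thesis by auto
qed

lemma FinPt_inert_epi:
  assumes l: "(P, Q, f) \<in> FinPt_inert" and g: "(Q, R, g) \<in> Arr FinPt" and g': "(Q, R, g') \<in> Arr FinPt"
    and eq: "compose (fst P) g f = compose (fst P) g' f"
  shows "g = g'"
proof (rule PiE_ext)
  show "g \<in> fst Q \<rightarrow>\<^sub>E fst R" "g' \<in> fst Q \<rightarrow>\<^sub>E fst R" using g g' by (auto simp: FinPt_Arr)
  fix b assume "b \<in> fst Q"
  then obtain a where "a \<in> fst P" "f a = b" using FinPt_inert_surj[OF l] by blast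
  then show "g b = g' b" using fun_cong[OF eq, of a] by (auto simp: compose_def)
qed

lemma FinPt_wide_inert: "wide_subclass FinPt FinPt_inert"
  unfolding wide_subclass_def
proof (intro conjI allI impI ballI)
  show "FinPt_inert \<subseteq> Arr FinPt" by (auto simp: FinPt_inert_def)
  show "t \<in> FinPt_inert" if i: "is_iso FinPt t" for t
  proof -
    obtain P Q f where e: "t = (P, Q, f)" by (cases t)
    note b = FinPt_iso_bij[OF i[unfolded e]]
    have f: "f (snd P) = snd Q" "snd P \<in> fst P" using b(1) by (auto simp: FinPt_Arr FinPt_Obj)
    have s: "{a \<in> fst P. f a \<noteq> snd Q} = fst P - {snd P}"
    proof -
      have "a = snd P" if "a \<in> fst P" "f a = snd Q" for a
        by (rule inj_onD[OF bij_betw_imp_inj_on[OF b(2)]]) (use that f in simp_all)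
      then show ?thesis using f by blast
    qed
    have "bij_betw f (fst P - {snd P}) (fst Q - {snd Q})"
    proof (rule bij_betw_subset[OF b(2)])
      have "f ` (fst P - {snd P}) = f ` fst P - f ` {snd P}"
        using f(2) by (intro inj_on_image_set_diff[OF bij_betw_imp_inj_on[OF b(2)]]) auto
      then show "f ` (fst P - {snd P}) = fst Q - {snd Q}" using bij_betw_imp_surj_on[OF b(2)] f(1) by simp
    qed blast
    then show ?thesis using b(1) s by (simp add: e FinPt_inert_iff)
  qed
  fix t u assume t: "t \<in> FinPt_inert" and u: "u \<in> FinPt_inert" and tu: "Tgt FinPt t = Src FinPt u"
  obtain P Q f where e: "t = (P, Q, f)" by (cases t)
  obtain R g where eu: "u = (Q, R, g)" using tu by (cases u) (simp add: e)
  have f: "(P, Q, f) \<in> Arr FinPt" "bij_betw f {a \<in> fst P. f a \<noteq> snd Q} (fst Q - {snd Q})"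
    and g: "(Q, R, g) \<in> Arr FinPt" "bij_betw g {a \<in> fst Q. g a \<noteq> snd R} (fst R - {snd R})"
    using t u by (auto simp: e eu FinPt_inert_iff)
  let ?A = "{a \<in> fst P. compose (fst P) g f a \<noteq> snd R}"
  have A: "?A = {a \<in> fst P. g (f a) \<noteq> snd R}" by (auto simp: compose_def)
  have gb: "g (snd Q) = snd R" and fQ: "\<And>a. a \<in> fst P \<Longrightarrow> f a \<in> fst Q" using f(1) g(1) by (auto simp: FinPt_Arr)
  have sub: "a \<in> {a \<in> fst P. f a \<noteq> snd Q}" "f a \<in> {a \<in> fst Q. g a \<noteq> snd R}" if "a \<in> ?A" for a
    using that gb fQ unfolding A by auto
  have "bij_betw (compose (fst P) g f) ?A (fst R - {snd R})"
    unfolding bij_betw_def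
  proof
    show "inj_on (compose (fst P) g f) ?A"
    proof (rule inj_onI)
      fix a b assume a: "a \<in> ?A" "b \<in> ?A" and "compose (fst P) g f a = compose (fst P) g f b"
      then have "g (f a) = g (f b)" by (simp add: compose_def)
      then have "f a = f b" by (rule inj_onD[OF bij_betw_imp_inj_on[OF g(2)] _ sub(2)[OF a(1)] sub(2)[OF a(2)]])
      then show "a = b" by (rule inj_onD[OF bij_betw_imp_inj_on[OF f(2)] _ sub(1)[OF a(1)] sub(1)[OF a(2)]])
    qed
    show "compose (fst P) g f ` ?A = fst R - {snd R}"
    proof (intro equalityI subsetI)
      fix c assume "c \<in> compose (fst P) g f ` ?A"
      then obtain a where a: "a \<in> fst P" "g (f a) \<noteq> snd R" "c = g (f a)" by (auto simp: compose_def)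
      then show "c \<in> fst R - {snd R}" using g(1) fQ by (auto simp: FinPt_Arr)
    next
      fix c assume "c \<in> fst R - {snd R}"
      then obtain b where b: "b \<in> fst Q" "g b \<noteq> snd R" "c = g b" using bij_betw_imp_surj_on[OF g(2)] by (auto simp: image_iff)
      obtain a where a: "a \<in> fst P" "f a = b" using FinPt_inert_surj[of P Q f b] t b(1) by (auto simp: e)
      then show "c \<in> compose (fst P) g f ` ?A" using b by (intro image_eqI[of _ _ a]) (auto simp: compose_def)
    qed
  qed
  then show "Cmp FinPt u t \<in> FinPt_inert" using FinPt_Cmp[OF f(1) g(1)] by (simp add: e eu FinPt_inert_iff)
qed

lemma FinPt_wide_active: "wide_subclass FinPt FinPt_active"
  unfolding wide_subclass_def
proof (intro conjI allI impI ballI)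
  show "FinPt_active \<subseteq> Arr FinPt" by (auto simp: FinPt_active_def)
  show "t \<in> FinPt_active" if i: "is_iso FinPt t" for t
  proof -
    obtain P Q f where e: "t = (P, Q, f)" by (cases t)
    note b = FinPt_iso_bij[OF i[unfolded e]]
    have f: "f (snd P) = snd Q" "snd P \<in> fst P" using b(1) by (auto simp: FinPt_Arr FinPt_Obj)
    have s: "{a \<in> fst P. f a = snd Q} = {snd P}"
    proof -
      have "a = snd P" if "a \<in> fst P" "f a = snd Q" for a
        by (rule inj_onD[OF bij_betw_imp_inj_on[OF b(2)]]) (use that f in simp_all)
      then show ?thesis using f by blast
    qed
    then show ?thesis using b(1) by (simp add: e FinPt_active_iff)
  qed
  fix t u assume t: "t \<in> FinPt_active" and u: "u \<in> FinPt_active" and tu: "Tgt FinPt t = Src FinPt u"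
  obtain P Q f where e: "t = (P, Q, f)" by (cases t)
  obtain R g where eu: "u = (Q, R, g)" using tu by (cases u) (simp add: e)
  have f: "(P, Q, f) \<in> Arr FinPt" "{a \<in> fst P. f a = snd Q} = {snd P}"
    and g: "(Q, R, g) \<in> Arr FinPt" "{a \<in> fst Q. g a = snd R} = {snd Q}"
    using t u by (auto simp: e eu FinPt_active_iff)
  have fQ: "f a \<in> fst Q" if "a \<in> fst P" for a using f(1) that by (auto simp: FinPt_Arr)
  have "g (f a) = snd R \<longleftrightarrow> a = snd P" if "a \<in> fst P" for a
    using f(2) g(2) that fQ[OF that] by blast
  then have "{a \<in> fst P. compose (fst P) g f a = snd R} = {snd P}"
    using f(1) by (auto simp: compose_def FinPt_Arr FinPt_Obj)
  then show "Cmp FinPt u t \<in> FinPt_active" using FinPt_Cmp[OF f(1) g(1)] by (simp add: e eu FinPt_active_iff)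
qed

text \<open>
  The middle object consists of the points that are not sent to the base point.
\<close>

lemma FinPt_factor:
  assumes f: "(P, Q, f) \<in> Arr FinPt"
  shows "\<exists>l\<in>FinPt_inert. \<exists>r\<in>FinPt_active. Tgt FinPt l = Src FinPt r \<and> Cmp FinPt r l = (P, Q, f)"
proof -
  have PO: "finite (fst P)" "snd P \<in> fst P" and QO: "Q \<in> Obj FinPt" and fE: "f \<in> fst P \<rightarrow>\<^sub>E fst Q" and fb: "f (snd P) = snd Q"
    using f by (auto simp: FinPt_Arr FinPt_Obj)
  define Z where "Z = (insert (snd P) {a \<in> fst P. f a \<noteq> snd Q}, snd P)"
  define l where "l = (\<lambda>a\<in>fst P. if f a = snd Q then snd P else a)"
  have Zs: "fst Z \<subseteq> fst P" using PO by (auto simp: Z_def)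
  then have ZO: "Z \<in> Obj FinPt" using PO finite_subset by (auto simp: FinPt_Obj Z_def)
  have lA: "(P, Z, l) \<in> Arr FinPt" using ZO PO fb by (auto simp: FinPt_Arr FinPt_Obj l_def Z_def)
  have set: "{a \<in> fst P. l a \<noteq> snd Z} = {a \<in> fst P. f a \<noteq> snd Q}" using fb by (auto simp: l_def Z_def)
  have "bij_betw l {a \<in> fst P. l a \<noteq> snd Z} (fst Z - {snd Z})"
    unfolding set bij_betw_def
  proof
    show "inj_on l {a \<in> fst P. f a \<noteq> snd Q}" by (auto simp: inj_on_def l_def)
    show "l ` {a \<in> fst P. f a \<noteq> snd Q} = fst Z - {snd Z}" using fb by (force simp: l_def Z_def)
  qed
  then have li: "(P, Z, l) \<in> FinPt_inert" using lA by (simp add: FinPt_inert_iff)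
  have rA: "(Z, Q, restrict f (fst Z)) \<in> Arr FinPt"
    using ZO QO fE fb Zs by (auto simp: FinPt_Arr FinPt_Obj) (simp add: Z_def)
  have "{a \<in> fst Z. restrict f (fst Z) a = snd Q} = {snd Z}" using fb by (auto simp: Z_def)
  then have ra: "(Z, Q, restrict f (fst Z)) \<in> FinPt_active" using rA by (simp add: FinPt_active_iff)
  have "compose (fst P) (restrict f (fst Z)) l = f"
  proof
    fix a show "compose (fst P) (restrict f (fst Z)) l a = f a"
      using fb PiE_arb[OF fE, of a] by (cases "a \<in> fst P") (auto simp: compose_def l_def Z_def)
  qed
  then show ?thesis using li ra by (intro bexI[OF _ li] bexI[OF _ ra]) simp
qed

text \<open>
  In any factorization the first map sends to the base point exactly what the composite does, so
  the points of the two middle objects correspond.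
\<close>

lemma FinPt_factor_half:
  assumes l: "(P, Z, l) \<in> FinPt_inert" and r: "(Z, Q, r) \<in> FinPt_active"
    and l': "(P, Z', l') \<in> FinPt_inert" and r': "(Z', Q, r') \<in> FinPt_active"
    and eq: "compose (fst P) r l = compose (fst P) r' l'"
  shows "\<exists>i. (Z, Z', i) \<in> Arr FinPt \<and> compose (fst P) i l = l' \<and> compose (fst Z) r' i = r"
proof -
  have lA: "(P, Z, l) \<in> Arr FinPt" and lb: "bij_betw l {a \<in> fst P. l a \<noteq> snd Z} (fst Z - {snd Z})"
    using l by (auto simp: FinPt_inert_iff)
  have lA': "(P, Z', l') \<in> Arr FinPt" using l' by (auto simp: FinPt_inert_iff)
  have rA: "(Z, Q, r) \<in> Arr FinPt" and rz: "{a \<in> fst Z. r a = snd Q} = {snd Z}" using r by (auto simp: FinPt_active_iff)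
  have rA': "(Z', Q, r') \<in> Arr FinPt" and rz': "{a \<in> fst Z'. r' a = snd Q} = {snd Z'}" using r' by (auto simp: FinPt_active_iff)
  have lE: "l \<in> fst P \<rightarrow>\<^sub>E fst Z" "l' \<in> fst P \<rightarrow>\<^sub>E fst Z'" "r \<in> fst Z \<rightarrow>\<^sub>E fst Q" "r' \<in> fst Z' \<rightarrow>\<^sub>E fst Q"
    using lA lA' rA rA' by (simp_all add: FinPt_Arr)
  have lm: "l a \<in> fst Z" "l' a \<in> fst Z'" if "a \<in> fst P" for a using lE(1,2) that by auto
  have e: "r (l a) = r' (l' a)" if "a \<in> fst P" for a using fun_cong[OF eq, of a] that by (simp add: compose_def)
  have z: "l a = snd Z \<longleftrightarrow> l' a = snd Z'" if a: "a \<in> fst P" for a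
  proof -
    have "l a = snd Z \<longleftrightarrow> r (l a) = snd Q" using rz lm(1)[OF a] by blast
    moreover have "l' a = snd Z' \<longleftrightarrow> r' (l' a) = snd Q" using rz' lm(2)[OF a] by blast
    ultimately show ?thesis using e[OF a] by simp
  qed
  let ?A = "{a \<in> fst P. l a \<noteq> snd Z}"
  define i where "i = (\<lambda>b\<in>fst Z. if b = snd Z then snd Z' else l' (inv_into ?A l b))"
  have il: "i (l a) = l' a" if a: "a \<in> fst P" for a
  proof (cases "l a = snd Z")
    case True
    then show ?thesis using z[OF a] lm[OF a] by (simp add: i_def)
  next
    case False
    then have "inv_into ?A l (l a) = a" using a by (intro inv_into_f_f[OF bij_betw_imp_inj_on[OF lb]]) simp
    then show ?thesis using False lm[OF a] by (simp add: i_def)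
  qed
  have cover: "\<exists>a\<in>fst P. b = l a" if "b \<in> fst Z" for b using FinPt_inert_surj[OF l that] by blast
  have iZ: "i b \<in> fst Z'" if "b \<in> fst Z" for b using cover[OF that] il lm by auto
  have "(Z, Z', i) \<in> Arr FinPt"
    using lA lA' iZ by (auto simp: FinPt_Arr FinPt_Obj i_def)
  moreover have "compose (fst P) i l = l'"
  proof
    fix a show "compose (fst P) i l a = l' a"
      using il[of a] PiE_arb[OF lE(2), of a] by (cases "a \<in> fst P") (auto simp: compose_def)
  qed
  moreover have "compose (fst Z) r' i = r"
  proof
    fix b show "compose (fst Z) r' i b = r b"
      using cover[of b] il e PiE_arb[OF lE(3), of b] by (cases "b \<in> fst Z") (auto simp: compose_def)
  qed
  ultimately show ?thesis by blast
qed

text \<open>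
  Inert maps are surjective, so that the comparison maps of \<open>FinPt_factor_half\<close> in
  the two directions are unique and mutually inverse.
\<close>

lemma FinPt_factorization_system: "factorization_system FinPt FinPt_inert FinPt_active"
  unfolding factorization_system_def
proof (intro conjI ballI impI)
  show "wide_subclass FinPt FinPt_inert" "wide_subclass FinPt FinPt_active" by (rule FinPt_wide_inert FinPt_wide_active)+
  show "\<exists>l\<in>FinPt_inert. \<exists>r\<in>FinPt_active. Tgt FinPt l = Src FinPt r \<and> Cmp FinPt r l = t" if "t \<in> Arr FinPt" for t
    using FinPt_factor that by (cases t) auto
  fix t u t' u'
  assume t: "t \<in> FinPt_inert" and u: "u \<in> FinPt_active" and t': "t' \<in> FinPt_inert" and u': "u' \<in> FinPt_active"
    and c: "Tgt FinPt t = Src FinPt u" "Tgt FinPt t' = Src FinPt u'" "Src FinPt t = Src FinPt t'" "Tgt FinPt u = Tgt FinPt u'"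
    and eq: "Cmp FinPt u t = Cmp FinPt u' t'"
  obtain P Z l where et: "t = (P, Z, l)" by (cases t)
  obtain Q r where eu: "u = (Z, Q, r)" using c(1) by (cases u) (simp add: et)
  obtain Z' l' where et': "t' = (P, Z', l')" using c(3) by (cases t') (simp add: et)
  obtain r' where eu': "u' = (Z', Q, r')" using c(2,4) by (cases u') (simp add: et' eu)
  have l: "(P, Z, l) \<in> FinPt_inert" and r: "(Z, Q, r) \<in> FinPt_active"
    and l': "(P, Z', l') \<in> FinPt_inert" and r': "(Z', Q, r') \<in> FinPt_active" using t u t' u' by (simp_all add: et eu et' eu')
  have eq': "compose (fst P) r l = compose (fst P) r' l'" using eq by (simp add: et eu et' eu')
  have lp: "l \<in> fst P \<rightarrow> fst Z" and lp': "l' \<in> fst P \<rightarrow> fst Z'" and ZO: "Z \<in> Obj FinPt" "Z' \<in> Obj FinPt"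
    and lx: "l \<in> extensional (fst P)" "l' \<in> extensional (fst P)"
    using l l' by (auto simp: FinPt_inert_iff FinPt_Arr PiE_def)
  obtain i where i: "(Z, Z', i) \<in> Arr FinPt" "compose (fst P) i l = l'" "compose (fst Z) r' i = r"
    using FinPt_factor_half[OF l r l' r' eq'] by blast
  obtain j where j: "(Z', Z, j) \<in> Arr FinPt" "compose (fst P) j l' = l"
    using FinPt_factor_half[OF l' r' l r eq'[symmetric]] by blast
  have ji: "compose (fst Z) j i = (\<lambda>a\<in>fst Z. a)"
  proof (rule FinPt_inert_epi[OF l FinPt_Cmp[OF i(1) j(1)] FinPt_Idn[OF ZO(1)]])
    show "compose (fst P) (compose (fst Z) j i) l = compose (fst P) (\<lambda>a\<in>fst Z. a) l"
      using compose_assoc[OF lp, of j i] i(2) j(2) Id_compose[OF lp lx(1)] by simp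
  qed
  have ij: "compose (fst Z') i j = (\<lambda>a\<in>fst Z'. a)"
  proof (rule FinPt_inert_epi[OF l' FinPt_Cmp[OF j(1) i(1)] FinPt_Idn[OF ZO(2)]])
    show "compose (fst P) (compose (fst Z') i j) l' = compose (fst P) (\<lambda>a\<in>fst Z'. a) l'"
      using compose_assoc[OF lp', of i j] i(2) j(2) Id_compose[OF lp' lx(2)] by simp
  qed
  have iso: "is_iso FinPt (Z, Z', i)"
    unfolding is_iso_def using i(1) j(1) ji ij by (auto intro!: bexI[of _ "(Z', Z, j)"])
  show "\<exists>!i. is_iso FinPt i \<and> Src FinPt i = Tgt FinPt t \<and> Tgt FinPt i = Tgt FinPt t' \<and> Cmp FinPt i t = t' \<and> Cmp FinPt u' i = u"
  proof (rule ex1I[of _ "(Z, Z', i)"])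
    show "is_iso FinPt (Z, Z', i) \<and> Src FinPt (Z, Z', i) = Tgt FinPt t \<and> Tgt FinPt (Z, Z', i) = Tgt FinPt t' \<and>
      Cmp FinPt (Z, Z', i) t = t' \<and> Cmp FinPt u' (Z, Z', i) = u" using iso i by (simp add: et eu et' eu')
    fix k assume k: "is_iso FinPt k \<and> Src FinPt k = Tgt FinPt t \<and> Tgt FinPt k = Tgt FinPt t' \<and> Cmp FinPt k t = t' \<and> Cmp FinPt u' k = u"
    then obtain k' where ek: "k = (Z, Z', k')" by (cases k) (simp add: et et')
    have kA: "(Z, Z', k') \<in> Arr FinPt" using k unfolding is_iso_def ek by blast
    have "k' = i" by (rule FinPt_inert_epi[OF l kA i(1)]) (use k i(2) in \<open>simp add: ek et et'\<close>)
    then show "k = (Z, Z', i)" by (simp add: ek)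
  qed
qed

lemma FinPt_patterns: "is_pattern FinPt_natural" "is_pattern FinPt_flat"
  unfolding FinPt_natural_def FinPt_flat_def
  by (rule make_pattern_is_pattern[OF FinPt_category FinPt_factorization_system])+

section \<open>The pattern of graphs\<close>

lemma U_op_factorization_system: "factorization_system (op_cat U_cat) U_inert U_active"
  unfolding factorization_system_def
proof (intro conjI ballI impI)
  show "wide_subclass (op_cat U_cat) U_inert"
    unfolding wide_subclass_def U_inert_eq using iso_ginert ginert_gcomp by (auto simp: ginert_def)
  show "wide_subclass (op_cat U_cat) U_active"
    unfolding wide_subclass_def U_active_eq using iso_gactive gactive_gcomp by (auto simp: gactive_def)
  show "\<exists>l\<in>U_inert. \<exists>r\<in>U_active. Tgt (op_cat U_cat) l = Src (op_cat U_cat) r \<and> Cmp (op_cat U_cat) r l = f"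
    if f: "f \<in> Arr (op_cat U_cat)" for f
  proof -
    obtain r l where "gactive r" "ginert l" "gtgt r = gsrc l" "gcomp l r = f"
      using factorization_exists[of f] f by auto
    then show ?thesis by (intro bexI[of _ l] bexI[of _ r]) (simp_all add: U_inert_eq U_active_eq)
  qed
  show "\<exists>!i. is_iso (op_cat U_cat) i \<and> Src (op_cat U_cat) i = Tgt (op_cat U_cat) l \<and> Tgt (op_cat U_cat) i = Tgt (op_cat U_cat) l' \<and>
              Cmp (op_cat U_cat) i l = l' \<and> Cmp (op_cat U_cat) r' i = r"
    if "l \<in> U_inert" "r \<in> U_active" "l' \<in> U_inert" "r' \<in> U_active"
      "Tgt (op_cat U_cat) l = Src (op_cat U_cat) r" "Tgt (op_cat U_cat) l' = Src (op_cat U_cat) r'"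
      "Src (op_cat U_cat) l = Src (op_cat U_cat) l'" "Tgt (op_cat U_cat) r = Tgt (op_cat U_cat) r'"
      "Cmp (op_cat U_cat) r l = Cmp (op_cat U_cat) r' l'" for l r l' r'
  proof -
    \<comment> \<open>In the opposite category the comparison isomorphism runs from the middle object of the second factorization to that of the first.\<close>
    have "\<exists>!i. is_iso U_cat i \<and> gsrc i = gsrc l' \<and> gtgt i = gsrc l \<and> gcomp l i = l' \<and> gcomp i r' = r"
      by (rule factorization_unique) (use that in \<open>simp_all add: U_inert_eq U_active_eq\<close>)
    then show ?thesis by (simp add: conj_ac)
  qed
qed

lemma U_op_category: "is_category (op_cat U_cat)"
  by (rule op_cat_category[OF U_cat_category])

lemma Uop_pattern: "is_pattern Uop_natural"
  unfolding Uop_natural_def by (rule make_pattern_is_pattern[OF U_op_category U_op_factorization_system])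

section \<open>The vertex functor\<close>

lemma verts_plus_sel [simp]: "fst (verts_plus G) = insert None (Some ` Verts G)" "snd (verts_plus G) = None"
  by (simp_all add: verts_plus_def)

lemma verts_plus_Obj: "connected_graph G \<Longrightarrow> verts_plus G \<in> Obj FinPt"
  using conn_graphD(2)[of G] by (simp add: FinPt_Obj)

lemma verts_map_None: "verts_map \<phi> None = None"
  by (simp add: verts_map_def)

text \<open>
  Disjointness of the vertex sets makes the preimage of a vertex unique.
\<close>

lemma verts_map_Some:
  assumes \<phi>: "is_graph_map \<phi>" and v: "v \<in> Verts (gtgt \<phi>)"
  shows "verts_map \<phi> (Some v) = Some w \<longleftrightarrow> w \<in> Verts (gsrc \<phi>) \<and> v \<in> gverts \<phi> w"
    "verts_map \<phi> (Some v) = None \<longleftrightarrow> (\<forall>w\<in>Verts (gsrc \<phi>). v \<notin> gverts \<phi> w)"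
proof -
  have eq: "verts_map \<phi> (Some v) = (if \<exists>w\<in>Verts (gsrc \<phi>). v \<in> gverts \<phi> w
      then Some (THE w. w \<in> Verts (gsrc \<phi>) \<and> v \<in> gverts \<phi> w) else None)"
    using v by (simp add: verts_map_def gverts_def)
  have un: "u = w" if "u \<in> Verts (gsrc \<phi>)" "v \<in> gverts \<phi> u" "w \<in> Verts (gsrc \<phi>)" "v \<in> gverts \<phi> w" for u w
    using graph_map_disjoint[OF \<phi>, of u w] that by blast
  have the: "(THE w. w \<in> Verts (gsrc \<phi>) \<and> v \<in> gverts \<phi> w) = w" if "w \<in> Verts (gsrc \<phi>)" "v \<in> gverts \<phi> w" for w
    by (rule the_equality) (use that un in blast)+
  show "verts_map \<phi> (Some v) = None \<longleftrightarrow> (\<forall>w\<in>Verts (gsrc \<phi>). v \<notin> gverts \<phi> w)"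
    unfolding eq by simp
  show "verts_map \<phi> (Some v) = Some w \<longleftrightarrow> w \<in> Verts (gsrc \<phi>) \<and> v \<in> gverts \<phi> w"
  proof (cases "\<exists>u\<in>Verts (gsrc \<phi>). v \<in> gverts \<phi> u")
    case True
    then obtain u where u: "u \<in> Verts (gsrc \<phi>)" "v \<in> gverts \<phi> u" by blast
    have "verts_map \<phi> (Some v) = Some u" unfolding eq using True the[OF u] by simp
    then show ?thesis using u un by auto
  next
    case False
    then show ?thesis unfolding eq by auto
  qed
qed

lemma verts_map_PiE:
  assumes \<phi>: "is_graph_map \<phi>"
  shows "verts_map \<phi> \<in> fst (verts_plus (gtgt \<phi>)) \<rightarrow>\<^sub>E fst (verts_plus (gsrc \<phi>))"
proof (rule PiE_I)
  fix p assume "p \<in> fst (verts_plus (gtgt \<phi>))"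
  then consider "p = None" | v where "v \<in> Verts (gtgt \<phi>)" "p = Some v" by auto
  then show "verts_map \<phi> p \<in> fst (verts_plus (gsrc \<phi>))"
  proof cases
    case 2
    then show ?thesis using verts_map_Some(1)[OF \<phi> 2(1)] by (cases "verts_map \<phi> p") auto
  qed (simp add: verts_map_None)
qed (auto simp: verts_map_def)

lemma vertex_functor_sel [simp]: "FOb vertex_functor = verts_plus"
  "FAr vertex_functor \<phi> = (verts_plus (gtgt \<phi>), verts_plus (gsrc \<phi>), verts_map \<phi>)"
  by (simp_all add: vertex_functor_def)

lemma verts_map_Arr: "is_graph_map \<phi> \<Longrightarrow> (verts_plus (gtgt \<phi>), verts_plus (gsrc \<phi>), verts_map \<phi>) \<in> Arr FinPt"
  unfolding FinPt_Arr using verts_map_PiE[of \<phi>] graph_mapD(1,2)[of \<phi>] verts_plus_Obj by (simp add: verts_map_None)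

lemma verts_map_gid:
  assumes G: "connected_graph G"
  shows "verts_map (gid G) = (\<lambda>a\<in>fst (verts_plus G). a)"
proof (rule PiE_ext[OF verts_map_PiE[OF gid_map[OF G]]])
  show "(\<lambda>a\<in>fst (verts_plus G). a) \<in> fst (verts_plus (gtgt (gid G))) \<rightarrow>\<^sub>E fst (verts_plus (gsrc (gid G)))" by auto
  fix p assume "p \<in> fst (verts_plus (gtgt (gid G)))"
  then consider "p = None" | v where "v \<in> Verts G" "p = Some v" by auto
  then show "verts_map (gid G) p = (\<lambda>a\<in>fst (verts_plus G). a) p"
  proof cases
    case 2
    then have "verts_map (gid G) (Some v) = Some v"
      using verts_map_Some(1)[OF gid_map[OF G], of v v] gverts_gid[OF G] by simp
    then show ?thesis using 2 by simp
  qed (simp add: verts_map_None)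
qed

text \<open>
  The set that the composite attaches to \<open>u\<close> is the union of the sets attached by
  \<open>\<psi>\<close> to the vertices in the set that \<open>\<phi>\<close> attaches to
  \<open>u\<close>, so that both sides have the same fibres.
\<close>

lemma verts_map_gcomp:
  assumes \<phi>: "is_graph_map \<phi>" and \<psi>: "is_graph_map \<psi>" and e: "gtgt \<phi> = gsrc \<psi>"
  shows "verts_map (gcomp \<psi> \<phi>) = compose (fst (verts_plus (gtgt \<psi>))) (verts_map \<phi>) (verts_map \<psi>)"
proof (rule PiE_ext)
  note c = gcomp_map[OF \<phi> \<psi> e]
  show "verts_map (gcomp \<psi> \<phi>) \<in> fst (verts_plus (gtgt \<psi>)) \<rightarrow>\<^sub>E fst (verts_plus (gsrc \<phi>))"
    using verts_map_PiE[OF c] by simp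
  show "compose (fst (verts_plus (gtgt \<psi>))) (verts_map \<phi>) (verts_map \<psi>) \<in> fst (verts_plus (gtgt \<psi>)) \<rightarrow>\<^sub>E fst (verts_plus (gsrc \<phi>))"
    using FinPt_Cmp[OF verts_map_Arr[OF \<psi>] verts_map_Arr[OF \<phi>, unfolded e]] unfolding FinPt_Arr by blast
  fix p assume p: "p \<in> fst (verts_plus (gtgt \<psi>))"
  then consider "p = None" | v where "v \<in> Verts (gtgt \<psi>)" "p = Some v" by auto
  then show "verts_map (gcomp \<psi> \<phi>) p = compose (fst (verts_plus (gtgt \<psi>))) (verts_map \<phi>) (verts_map \<psi>) p"
  proof cases
    case 1 then show ?thesis by (simp add: compose_def verts_map_None)
  next
    case 2
    have r: "compose (fst (verts_plus (gtgt \<psi>))) (verts_map \<phi>) (verts_map \<psi>) p = verts_map \<phi> (verts_map \<psi> (Some v))"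
      using 2 by (simp add: compose_def)
    have v': "v \<in> Verts (gtgt (gcomp \<psi> \<phi>))" using 2 by simp
    have key: "verts_map (gcomp \<psi> \<phi>) (Some v) = Some u \<longleftrightarrow> verts_map \<phi> (verts_map \<psi> (Some v)) = Some u" for u
    proof
      assume "verts_map (gcomp \<psi> \<phi>) (Some v) = Some u"
      then have u: "u \<in> Verts (gsrc \<phi>)" "v \<in> gverts (gcomp \<psi> \<phi>) u" using verts_map_Some(1)[OF c v', of u] by simp_all
      then obtain w where w: "w \<in> gverts \<phi> u" "v \<in> gverts \<psi> w" using gverts_gcomp[OF \<phi> \<psi> e u(1)] by auto
      have wV: "w \<in> Verts (gtgt \<phi>)" using gverts_subset[OF \<phi> u(1)] w by blast
      have "verts_map \<psi> (Some v) = Some w" using verts_map_Some(1)[OF \<psi> 2(1), of w] w wV e by simp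
      moreover have "verts_map \<phi> (Some w) = Some u" using verts_map_Some(1)[OF \<phi> wV, of u] u w by simp
      ultimately show "verts_map \<phi> (verts_map \<psi> (Some v)) = Some u" by simp
    next
      assume a: "verts_map \<phi> (verts_map \<psi> (Some v)) = Some u"
      then obtain w where w: "verts_map \<psi> (Some v) = Some w" by (cases "verts_map \<psi> (Some v)") (auto simp: verts_map_None)
      then have w': "w \<in> Verts (gtgt \<phi>)" "v \<in> gverts \<psi> w" using verts_map_Some(1)[OF \<psi> 2(1), of w] e by simp_all
      have u: "u \<in> Verts (gsrc \<phi>)" "w \<in> gverts \<phi> u" using verts_map_Some(1)[OF \<phi> w'(1), of u] a w by simp_all
      have "v \<in> gverts (gcomp \<psi> \<phi>) u" using gverts_gcomp[OF \<phi> \<psi> e u(1)] u(2) w'(2) by auto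
      then show "verts_map (gcomp \<psi> \<phi>) (Some v) = Some u" using verts_map_Some(1)[OF c v', of u] u(1) by simp
    qed
    have "verts_map (gcomp \<psi> \<phi>) (Some v) = verts_map \<phi> (verts_map \<psi> (Some v))"
      using key by (metis option.exhaust)
    then show ?thesis using 2 r by simp
  qed
qed

lemma vertex_functor_functor: "is_functor (op_cat U_cat) FinPt vertex_functor"
  unfolding is_functor_def
  using U_op_category FinPt_category verts_plus_Obj verts_map_gid verts_map_Arr verts_map_gcomp by auto

lemma verts_map_inert:
  assumes \<phi>: "ginert \<phi>"
  shows "FAr vertex_functor \<phi> \<in> FinPt_inert"
proof -
  have m: "is_graph_map \<phi>" using \<phi> by (simp add: ginert_def)
  have g: "\<exists>w. gverts \<phi> v = {w} \<and> w \<in> Verts (gtgt \<phi>)" if v: "v \<in> Verts (gsrc \<phi>)" for v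
  proof -
    obtain w where "w \<in> Verts (gtgt \<phi>)" "gemb \<phi> (vert_emb (gsrc \<phi>) v) = vert_emb (gtgt \<phi>) w"
      using \<phi> v by (auto simp: ginert_def)
    then show ?thesis using vert_emb(3)[OF graph_mapD(2)[OF m]] by (auto simp: gverts_def)
  qed
  let ?A = "{a \<in> fst (verts_plus (gtgt \<phi>)). verts_map \<phi> a \<noteq> None}"
  have A: "\<exists>v w. a = Some v \<and> v \<in> Verts (gtgt \<phi>) \<and> w \<in> Verts (gsrc \<phi>) \<and> verts_map \<phi> a = Some w \<and> gverts \<phi> w = {v}"
    if a: "a \<in> ?A" for a
  proof -
    obtain v where v: "a = Some v" "v \<in> Verts (gtgt \<phi>)" using a by (auto simp: verts_map_None)
    obtain w where w: "verts_map \<phi> a = Some w" using a by blast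
    then have "w \<in> Verts (gsrc \<phi>)" "v \<in> gverts \<phi> w" using verts_map_Some(1)[OF m v(2), of w] v by simp_all
    then show ?thesis using v w g[of w] by auto
  qed
  have "bij_betw (verts_map \<phi>) ?A (Some ` Verts (gsrc \<phi>))"
    unfolding bij_betw_def
  proof
    show "inj_on (verts_map \<phi>) ?A"
    proof (rule inj_onI)
      fix a b assume a: "a \<in> ?A" "b \<in> ?A" "verts_map \<phi> a = verts_map \<phi> b"
      then show "a = b" using A[OF a(1)] A[OF a(2)] by auto
    qed
    show "verts_map \<phi> ` ?A = Some ` Verts (gsrc \<phi>)"
    proof (intro equalityI subsetI)
      fix c assume "c \<in> verts_map \<phi> ` ?A"
      then obtain a where a: "a \<in> ?A" "c = verts_map \<phi> a" by blast
      show "c \<in> Some ` Verts (gsrc \<phi>)" using A[OF a(1)] a(2) by auto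
    next
      fix c assume "c \<in> Some ` Verts (gsrc \<phi>)"
      then obtain w where w: "w \<in> Verts (gsrc \<phi>)" "c = Some w" by auto
      obtain v where v: "gverts \<phi> w = {v}" "v \<in> Verts (gtgt \<phi>)" using g[OF w(1)] by blast
      then have "verts_map \<phi> (Some v) = Some w" using verts_map_Some(1)[OF m v(2), of w] w by simp
      then show "c \<in> verts_map \<phi> ` ?A" using w v by (intro image_eqI[of _ _ "Some v"]) auto
    qed
  qed
  moreover have "fst (verts_plus (gsrc \<phi>)) - {snd (verts_plus (gsrc \<phi>))} = Some ` Verts (gsrc \<phi>)" by auto
  ultimately show ?thesis using verts_map_Arr[OF m] unfolding vertex_functor_sel FinPt_inert_iff by simp
qed

lemma gverts_union:
  assumes "is_graph_map \<phi>"
  shows "(\<Union>w\<in>Verts (gsrc \<phi>). gverts \<phi> w) = emb_verts (gemb \<phi> (id_emb (gsrc \<phi>)))"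
  using graph_map_verts[OF assms id_emb(1)[OF graph_mapD(1)[OF assms]]] id_emb(2)[OF graph_mapD(1)[OF assms]] by simp

lemma verts_map_nonbase:
  assumes m: "is_graph_map \<phi>"
  shows "{a \<in> fst (verts_plus (gtgt \<phi>)). verts_map \<phi> a \<noteq> None} = Some ` emb_verts (gemb \<phi> (id_emb (gsrc \<phi>)))"
proof (intro equalityI subsetI)
  fix a assume "a \<in> {a \<in> fst (verts_plus (gtgt \<phi>)). verts_map \<phi> a \<noteq> None}"
  then obtain v where v: "a = Some v" "v \<in> Verts (gtgt \<phi>)" "verts_map \<phi> a \<noteq> None" by (auto simp: verts_map_None)
  then obtain w where "w \<in> Verts (gsrc \<phi>)" "v \<in> gverts \<phi> w" using verts_map_Some(2)[OF m v(2)] by auto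
  then show "a \<in> Some ` emb_verts (gemb \<phi> (id_emb (gsrc \<phi>)))" using v gverts_union[OF m] by blast
next
  fix a assume "a \<in> Some ` emb_verts (gemb \<phi> (id_emb (gsrc \<phi>)))"
  then obtain v w where v: "a = Some v" "w \<in> Verts (gsrc \<phi>)" "v \<in> gverts \<phi> w" unfolding gverts_union[OF m, symmetric] by blast
  then have "v \<in> Verts (gtgt \<phi>)" using gverts_subset[OF m v(2)] by blast
  then show "a \<in> {a \<in> fst (verts_plus (gtgt \<phi>)). verts_map \<phi> a \<noteq> None}"
    using v verts_map_Some(2)[OF m, of v] by auto
qed

lemma verts_map_active:
  assumes \<phi>: "gactive \<phi>"
  shows "FAr vertex_functor \<phi> \<in> FinPt_active"
proof -
  have m: "is_graph_map \<phi>" using \<phi> by (simp add: gactive_def)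
  have "{a \<in> fst (verts_plus (gtgt \<phi>)). verts_map \<phi> a \<noteq> None} = Some ` Verts (gtgt \<phi>)"
    using verts_map_nonbase[OF m] \<phi> id_emb(2)[OF graph_mapD(2)[OF m]] by (simp add: gactive_def)
  then have "{a \<in> fst (verts_plus (gtgt \<phi>)). verts_map \<phi> a = None} = {None}"
    by (auto simp: verts_map_None)
  then show ?thesis using verts_map_Arr[OF m] unfolding vertex_functor_sel FinPt_active_iff by simp
qed

section \<open>Elementary objects\<close>

lemma edge_verts_plus: "verts_plus edge_graph = std_pset 0"
  by (simp add: verts_plus_def std_pset_def edge_graph_def)

lemma star_verts_plus: "isomorphic FinPt (verts_plus (star_graph n)) (std_pset 1)"
proof -
  let ?f = "\<lambda>a\<in>{None, Some (0::nat)}. map_option Suc a" and ?g = "\<lambda>a\<in>{None, Some (1::nat)}. map_option (\<lambda>n. n - 1) a"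
  let ?P = "({None, Some 0}, None) :: pset" and ?Q = "({None, Some 1}, None) :: pset"
  have e: "verts_plus (star_graph n) = ?P" "std_pset 1 = ?Q" by (simp_all add: verts_plus_def star_graph_def std_pset_def)
  have "compose {None, Some 0} ?g ?f = (\<lambda>a\<in>{None, Some 0}. a)" "compose {None, Some 1} ?f ?g = (\<lambda>a\<in>{None, Some 1}. a)"
    by (auto simp: compose_def fun_eq_iff)
  then have "is_iso FinPt (?P, ?Q, ?f)"
    unfolding is_iso_def by (auto simp: FinPt_Arr FinPt_Obj intro!: bexI[of _ "(?Q, ?P, ?g)"])
  then show ?thesis unfolding isomorphic_def e by (intro exI[of _ "(?P, ?Q, ?f)"]) simp
qed

lemma isomorphic_pset_card:
  assumes "isomorphic FinPt P Q"
  shows "card (fst P) = card (fst Q)"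
proof -
  obtain f where "is_iso FinPt (P, Q, f)" using assms by (auto simp: isomorphic_def)
  then show ?thesis using FinPt_iso_bij(2) bij_betw_same_card by blast
qed

lemma elementary_pset:
  assumes i: "isomorphic FinPt P (std_pset 1)"
  obtains p where "fst P = {p, snd P}" "p \<noteq> snd P"
proof -
  obtain f where "f \<in> Arr FinPt" "Src FinPt f = P" using i unfolding isomorphic_def is_iso_def by blast
  then have O: "P \<in> Obj FinPt" using categoryD(1)[OF FinPt_category, of f] by simp
  have "card (fst P) = 2" using isomorphic_pset_card[OF i] by (simp add: std_pset_def)
  then have "card (fst P - {snd P}) = 1" using O by (simp add: FinPt_Obj)
  then obtain p where p: "fst P - {snd P} = {p}" by (auto simp: card_1_singleton_iff)
  then show thesis using that[of p] O by (auto simp: FinPt_Obj)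
qed

abbreviation "Uflat \<equiv> flat_pattern Uop_natural vertex_functor"

lemma Uop_sel [simp]: "Obj Uop_natural = {G. connected_graph G}" "Arr Uop_natural = {\<phi>. is_graph_map \<phi>}"
  "Src Uop_natural = gtgt" "Tgt Uop_natural = gsrc" "Idn Uop_natural = gid" "Cmp Uop_natural g f = gcomp f g"
  "Inert Uop_natural = Collect ginert" "Active Uop_natural = Collect gactive"
  by (simp_all add: Uop_natural_def U_inert_eq U_active_eq)

lemma Elem_Uop: "Elem Uop_natural = iso_closure (op_cat U_cat) (insert edge_graph (range star_graph))"
  by (simp add: Uop_natural_def)

lemma Uflat_sel [simp]: "Obj Uflat = {G. connected_graph G}" "Arr Uflat = {\<phi>. is_graph_map \<phi>}"
  "Src Uflat = gtgt" "Tgt Uflat = gsrc" "Idn Uflat = gid" "Cmp Uflat g f = gcomp f g"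
  "Inert Uflat = Collect ginert" "Active Uflat = Collect gactive"
  "Elem Uflat = {x \<in> Elem Uop_natural. isomorphic FinPt (verts_plus x) (std_pset 1)}"
  by (simp_all add: flat_pattern_def)

lemma pset_pattern_sel [simp]:
  "Obj FinPt_natural = Obj FinPt" "Arr FinPt_natural = Arr FinPt" "Src FinPt_natural = Src FinPt"
  "Tgt FinPt_natural = Tgt FinPt" "Idn FinPt_natural = Idn FinPt" "Cmp FinPt_natural = Cmp FinPt"
  "Inert FinPt_natural = FinPt_inert" "Active FinPt_natural = FinPt_active"
  "Obj FinPt_flat = Obj FinPt" "Arr FinPt_flat = Arr FinPt" "Src FinPt_flat = Src FinPt"
  "Tgt FinPt_flat = Tgt FinPt" "Idn FinPt_flat = Idn FinPt" "Cmp FinPt_flat = Cmp FinPt"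
  "Inert FinPt_flat = FinPt_inert" "Active FinPt_flat = FinPt_active"
  by (simp_all add: FinPt_natural_def FinPt_flat_def)

lemma Elem_pset: "Elem FinPt_natural = iso_closure FinPt {std_pset 0, std_pset 1}"
  "Elem FinPt_flat = iso_closure FinPt {std_pset 1}"
  by (simp_all add: FinPt_natural_def FinPt_flat_def)

lemma Uop_Elem_image:
  assumes x: "x \<in> Elem Uop_natural"
  shows "verts_plus x \<in> Elem FinPt_natural"
proof -
  obtain s where s: "s \<in> insert edge_graph (range star_graph)" "isomorphic (op_cat U_cat) x s" and xO: "connected_graph x"
    using x by (auto simp: Elem_Uop iso_closure_def)
  have i: "isomorphic FinPt (verts_plus x) (verts_plus s)" using functor_iso[OF vertex_functor_functor s(2)] by simp
  from s(1) have "isomorphic FinPt (verts_plus x) (std_pset 0) \<or> isomorphic FinPt (verts_plus x) (std_pset 1)"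
  proof
    assume "s = edge_graph"
    then show ?thesis using i edge_verts_plus by simp
  next
    assume "s \<in> range star_graph"
    then show ?thesis using i isomorphic_trans[OF FinPt_category i] star_verts_plus by blast
  qed
  then show ?thesis using verts_plus_Obj[OF xO] by (auto simp: Elem_pset iso_closure_def)
qed

lemma is_functor_transfer:
  assumes "Obj C = Obj C'" "Arr C = Arr C'" "Src C = Src C'" "Tgt C = Tgt C'" "Idn C = Idn C'" "Cmp C = Cmp C'"
    and "Obj D = Obj D'" "Arr D = Arr D'" "Src D = Src D'" "Tgt D = Tgt D'" "Idn D = Idn D'" "Cmp D = Cmp D'"
    and "is_functor C' D' F"
  shows "is_functor C D F"
  using assms(13) unfolding is_functor_def is_category_def assms(1-12) .

lemma op_U_Cmp: "Cmp Uop_natural = Cmp (op_cat U_cat)" "Cmp Uflat = Cmp (op_cat U_cat)"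
  by (intro ext; simp)+

lemma Uop_morphism: "pattern_morphism Uop_natural FinPt_natural vertex_functor"
  unfolding pattern_morphism_def
proof (intro conjI ballI)
  show "is_functor Uop_natural FinPt_natural vertex_functor"
    by (rule is_functor_transfer[OF _ _ _ _ _ _ _ _ _ _ _ _ vertex_functor_functor]) (simp_all add: op_U_Cmp)
qed (use Uop_pattern FinPt_patterns verts_map_inert verts_map_active Uop_Elem_image in simp_all)

lemma Uflat_pattern: "is_pattern Uflat"
proof -
  have iso: "is_iso Uflat f = is_iso Uop_natural f" for f by (simp add: is_iso_def)
  have P: "is_category Uop_natural" "factorization_system Uop_natural (Inert Uop_natural) (Active Uop_natural)"
    "Elem Uop_natural \<subseteq> Obj Uop_natural" and E: "\<And>x y. x \<in> Elem Uop_natural \<Longrightarrow> isomorphic Uop_natural x y \<Longrightarrow> y \<in> Elem Uop_natural"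
    using Uop_pattern unfolding is_pattern_def by blast+
  have "y \<in> Elem Uflat" if x: "x \<in> Elem Uflat" and i: "isomorphic Uflat x y" for x y
  proof -
    have i': "isomorphic Uop_natural x y" using i by (simp add: isomorphic_def iso)
    then have "isomorphic (op_cat U_cat) x y" by (simp add: Uop_natural_def)
    from functor_iso[OF vertex_functor_functor this]
    have xy: "isomorphic FinPt (verts_plus x) (verts_plus y)" by simp
    have "isomorphic FinPt (verts_plus x) (std_pset 1)" using x by simp
    then have "isomorphic FinPt (verts_plus y) (std_pset 1)"
      by (rule isomorphic_trans[OF FinPt_category isomorphic_sym[OF xy]])
    then show ?thesis using x E[OF _ i'] by simp
  qed
  moreover have "is_category Uflat" using P(1) unfolding is_category_def by simp
  moreover have "factorization_system Uflat (Inert Uflat) (Active Uflat)"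
    using P(2) unfolding factorization_system_def wide_subclass_def iso by simp
  moreover have "Elem Uflat \<subseteq> Obj Uflat" using P(3) by auto
  ultimately show ?thesis unfolding is_pattern_def by blast
qed

lemma Uflat_morphism: "pattern_morphism Uflat FinPt_flat vertex_functor"
  unfolding pattern_morphism_def
proof (intro conjI ballI)
  show "is_functor Uflat FinPt_flat vertex_functor"
    by (rule is_functor_transfer[OF _ _ _ _ _ _ _ _ _ _ _ _ vertex_functor_functor]) (simp_all add: op_U_Cmp)
  show "FOb vertex_functor x \<in> Elem FinPt_flat" if "x \<in> Elem Uflat" for x
  proof -
    have "connected_graph x" using that by (simp add: Elem_Uop iso_closure_def)
    then show ?thesis using that verts_plus_Obj by (simp add: Elem_pset iso_closure_def)
  qed
qed (use Uflat_pattern FinPt_patterns verts_map_inert verts_map_active in simp_all)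

text \<open>
  Of the elementary objects only stars have one vertex, and isomorphisms preserve the identity
  embedding as well as vertices.
\<close>

lemma Uflat_Elem:
  assumes x: "x \<in> Elem Uflat"
  obtains w where "w \<in> Verts x" "id_emb x = vert_emb x w" "connected_graph x"
proof -
  obtain s where s: "s \<in> insert edge_graph (range star_graph)" "isomorphic (op_cat U_cat) x s" and xO: "connected_graph x"
    and x1: "isomorphic FinPt (verts_plus x) (std_pset 1)"
    using x by (auto simp: Elem_Uop iso_closure_def)
  have "isomorphic FinPt (verts_plus x) (verts_plus s)" using functor_iso[OF vertex_functor_functor s(2)] by simp
  then have c: "card (fst (verts_plus s)) = 2" using isomorphic_pset_card[OF x1] isomorphic_pset_card by (fastforce simp: std_pset_def)
  have "s \<noteq> edge_graph"
  proof
    assume "s = edge_graph"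
    then show False using c by (simp add: edge_graph_def)
  qed
  then obtain n where n: "s = star_graph n" using s(1) by blast
  obtain f where f: "is_iso U_cat f" "gsrc f = star_graph n" "gtgt f = x" using s(2) n by (auto simp: isomorphic_def)
  have "gemb f (id_emb (star_graph n)) = id_emb x" using iso_gactive[OF f(1)] f by (simp add: gactive_def)
  moreover have "0 \<in> Verts (gsrc f)" using f(2) by (simp add: star_graph_def)
  then have "gemb f (vert_emb (gsrc f) 0) \<in> vert_emb x ` Verts x" using iso_ginert[OF f(1)] f(3) by (auto simp: ginert_def)
  ultimately have "id_emb x \<in> vert_emb x ` Verts x" using f(2) by (simp add: star_graph_id_emb)
  then show thesis using that xO by blast
qed

lemma star_Elem: "star_graph n \<in> Elem Uflat"
  using star_verts_plus isomorphic_refl[OF U_op_category, of "star_graph n"] star_graph_connected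
  by (auto simp: Elem_Uop iso_closure_def)

lemma inert_from_Elem:
  assumes f: "ginert f" and e: "gsrc f \<in> Elem Uflat"
  obtains v where "v \<in> Verts (gtgt f)" "gemb f (id_emb (gsrc f)) = vert_emb (gtgt f) v"
proof -
  obtain w where w: "w \<in> Verts (gsrc f)" "id_emb (gsrc f) = vert_emb (gsrc f) w" using e by (rule Uflat_Elem)
  then have "gemb f (id_emb (gsrc f)) \<in> vert_emb (gtgt f) ` Verts (gtgt f)" using f by (simp add: ginert_def)
  then show thesis using that by blast
qed

text \<open>
  For an inert map to a set with one point besides the base point this is a singleton.
\<close>

definition pt_label :: "pmap \<Rightarrow> nat option set" where
  "pt_label = (\<lambda>(P, Q, f). {a \<in> fst P. f a \<noteq> snd Q})"

lemma pt_label_vertex: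
  assumes f: "ginert f" "gemb f (id_emb (gsrc f)) = vert_emb (gtgt f) v" "v \<in> Verts (gtgt f)"
  shows "pt_label (FAr vertex_functor f) = {Some v}"
proof -
  have m: "is_graph_map f" using f by (simp add: ginert_def)
  show ?thesis using verts_map_nonbase[OF m] f vert_emb(3)[OF graph_mapD(2)[OF m] f(3)] by (simp add: pt_label_def)
qed

text \<open>
  On both sides an object is classified by the vertex that it singles out. Arrows between
  star-like graphs are active as well as inert, so that cancellation applies to them.
\<close>

lemma Uflat_el_equivalence:
  assumes G: "connected_graph G"
  shows "is_equivalence (el_under Uflat G) (el_under FinPt_flat (verts_plus G)) (under_fctr vertex_functor)"
proof (rule thin_equivalence[where L = pt_label])
  let ?C = "el_under Uflat G" and ?D = "el_under FinPt_flat (verts_plus G)"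
  show "is_functor ?C ?D (under_fctr vertex_functor)" using under_functor[OF Uflat_morphism, of G] by simp
  have uo: "FOb (under_fctr vertex_functor) f = FAr vertex_functor f" for f by (simp only: under_fctr_def fctr.simps)
  show "\<exists>t\<in>Arr ?C. Src ?C t = x \<and> Tgt ?C t = y"
    if x: "x \<in> Obj ?C" and y: "y \<in> Obj ?C"
      and L: "pt_label (FOb (under_fctr vertex_functor) x) = pt_label (FOb (under_fctr vertex_functor) y)" for x y
  proof -
    have xi: "ginert x" "gtgt x = G" "gsrc x \<in> Elem Uflat" and yi: "ginert y" "gtgt y = G" "gsrc y \<in> Elem Uflat"
      using x y by (simp_all del: Uflat_sel(9))
    obtain v where v: "v \<in> Verts (gtgt x)" "gemb x (id_emb (gsrc x)) = vert_emb (gtgt x) v" using inert_from_Elem[OF xi(1,3)] .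
    obtain w where w: "w \<in> Verts (gtgt y)" "gemb y (id_emb (gsrc y)) = vert_emb (gtgt y) w" using inert_from_Elem[OF yi(1,3)] .
    have "v = w" using L pt_label_vertex[OF xi(1) v(2,1)] pt_label_vertex[OF yi(1) w(2,1)] unfolding uo by simp
    then have "gemb x (id_emb (gsrc x)) = gemb y (id_emb (gsrc y))" using v w xi yi by simp
    then obtain i where i: "is_iso U_cat i" "gsrc i = gsrc y" "gtgt i = gsrc x" "gcomp x i = y"
      using inert_same_class[OF xi(1) yi(1)] xi yi by auto
    have "x \<in> Inert Uflat" "i \<in> Inert Uflat" "y \<in> Inert Uflat" "Src Uflat x = G" "Tgt Uflat x = Src Uflat i" "y = Cmp Uflat i x"
      using xi(1,2) yi(1) i(3,4) iso_ginert[OF i(1)] by simp_all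
    moreover have "Tgt Uflat x \<in> Elem Uflat" "Tgt Uflat y \<in> Elem Uflat"
      using xi(3) yi(3) by (simp_all only: Uflat_sel(4))
    ultimately have "(x, i, y) \<in> Arr ?C" unfolding el_under_sel by blast
    then show ?thesis by (rule bexI[rotated]) simp
  qed
  show "t = u" if t: "t \<in> Arr ?C" and u: "u \<in> Arr ?C" and s: "Src ?C t = Src ?C u" "Tgt ?C t = Tgt ?C u" for t u
  proof -
    obtain f g f' where et: "t = (f, g, f')" by (cases t)
    obtain k l k' where eu: "u = (k, l, k')" by (cases u)
    have k: "k = f" "k' = f'" using s by (simp_all add: et eu)
    have a: "ginert f" "ginert g" "gsrc f = gtgt g" "f' = gcomp f g" "gsrc f \<in> Elem Uflat" "gsrc f' \<in> Elem Uflat"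
      using t unfolding et el_under_sel Uflat_sel(3,4,6,7) mem_Collect_eq by blast+
    have b: "ginert l" "gsrc f = gtgt l" "f' = gcomp f l"
      using u unfolding eu k el_under_sel Uflat_sel(3,4,6,7) mem_Collect_eq by blast+
    \<comment> \<open>The identity of a star-like graph is the star at its only vertex, which an inert map preserves.\<close>
    have act: "gactive h" if h: "ginert h" "gtgt h = gsrc f" "gsrc h = gsrc f'" for h
    proof -
      obtain v where v: "v \<in> Verts (gtgt h)" "gemb h (id_emb (gsrc h)) = vert_emb (gtgt h) v"
        using inert_from_Elem[OF h(1)] a(6) h(3) by metis
      obtain w where w: "w \<in> Verts (gsrc f)" "id_emb (gsrc f) = vert_emb (gsrc f) w" "connected_graph (gsrc f)"
        using Uflat_Elem[OF a(5)] .
      have "Verts (gsrc f) = {w}" using id_emb(2)[OF w(3)] vert_emb(3)[OF w(3,1)] w(2) by simp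
      then have "v = w" using v(1) h(2) by simp
      then show ?thesis using v w h by (simp add: gactive_def ginert_def)
    qed
    have sg: "gsrc g = gsrc f'" unfolding a(4) by simp
    have sl: "gsrc l = gsrc f'" unfolding b(3) by simp
    have "g = l"
      by (rule ginert_cancel[OF a(1) act[OF a(2) a(3)[symmetric] sg] act[OF b(1) b(2)[symmetric] sl]])
        (use a(3,4) b(2,3) sg sl in metis)+
    then show ?thesis using k by (simp add: et eu)
  qed
  show "\<exists>t\<in>Arr ?D. Src ?D t = x \<and> Tgt ?D t = y" if x: "x \<in> Obj ?D" and y: "y \<in> Obj ?D" and L: "pt_label x = pt_label y" for x y
  proof -
    obtain P Q f where ex: "x = (P, Q, f)" by (cases x)
    obtain P' Q' f' where ey: "y = (P', Q', f')" by (cases y)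
    have P: "P = verts_plus G" "P' = verts_plus G" using x y by (simp_all add: ex ey)
    have f: "(P, Q, f) \<in> FinPt_inert" "Q \<in> Elem FinPt_flat" "(P, Q', f') \<in> FinPt_inert" "Q' \<in> Elem FinPt_flat"
      using x y P by (simp_all add: ex ey)
    have Q: "isomorphic FinPt Q (std_pset 1)" "isomorphic FinPt Q' (std_pset 1)" using f by (auto simp: Elem_pset iso_closure_def)
    obtain q where q: "fst Q = {q, snd Q}" "q \<noteq> snd Q" using Q(1) by (rule elementary_pset)
    obtain q' where q': "fst Q' = {q', snd Q'}" "q' \<noteq> snd Q'" using Q(2) by (rule elementary_pset)
    have fA: "(P, Q, f) \<in> Arr FinPt" "(P, Q', f') \<in> Arr FinPt" using f by (simp_all add: FinPt_inert_iff)
    have QO: "Q \<in> Obj FinPt" "Q' \<in> Obj FinPt" using fA by (simp_all add: FinPt_Arr)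
    define g where "g = (\<lambda>b\<in>fst Q. if b = snd Q then snd Q' else q')"
    have gA: "(Q, Q', g) \<in> Arr FinPt" using QO q' by (auto simp: FinPt_Arr FinPt_Obj g_def)
    have s: "{a \<in> fst Q. g a \<noteq> snd Q'} = {q}" "fst Q' - {snd Q'} = {q'}" "g q = q'" using q q' by (auto simp: g_def)
    have gi: "(Q, Q', g) \<in> FinPt_inert" using gA by (simp add: FinPt_inert_iff s bij_betw_def)
    have L': "{a \<in> fst P. f a \<noteq> snd Q} = {a \<in> fst P. f' a \<noteq> snd Q'}"
      using L unfolding ex ey pt_label_def P prod.case .
    have l: "f a = snd Q \<longleftrightarrow> f' a = snd Q'" if "a \<in> fst P" for a
      using that L' by blast
    have fm: "f \<in> fst P \<rightarrow>\<^sub>E fst Q" "f' \<in> fst P \<rightarrow>\<^sub>E fst Q'" using fA by (simp_all add: FinPt_Arr)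
    have "compose (fst P) g f = f'"
    proof
      fix a show "compose (fst P) g f a = f' a"
      proof (cases "a \<in> fst P")
        case True
        have "f a \<in> {q, snd Q}" "f' a \<in> {q', snd Q'}" using fm True q(1) q'(1) by (auto dest: PiE_mem)
        then show ?thesis using True l[OF True] q q' by (auto simp: compose_def g_def)
      next
        case False
        then show ?thesis using PiE_arb[OF fm(2) False] by (simp add: compose_def)
      qed
    qed
    then have "((P, Q, f), (Q, Q', g), (P, Q', f')) \<in> Arr ?D" using f gi P by simp
    then show ?thesis by (rule bexI[rotated]) (use P ex ey in simp)
  qed
  show "t = u" if t: "t \<in> Arr ?D" and u: "u \<in> Arr ?D" and s: "Src ?D t = Src ?D u" "Tgt ?D t = Tgt ?D u" for t u
  proof -
    obtain P Q f Q1 R g t3 where et: "t = ((P, Q, f), (Q1, R, g), t3)" by (metis prod_cases3)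
    obtain u1 Q2 R2 g2 u3 where eu: "u = (u1, (Q2, R2, g2), u3)" by (metis prod_cases3)
    have u1: "u1 = (P, Q, f)" "u3 = t3" using s by (simp_all add: et eu)
    have a: "(P, Q, f) \<in> FinPt_inert" "(Q1, R, g) \<in> FinPt_inert" "Q = Q1" "t3 = (P, R, compose (fst P) g f)"
      using t unfolding et el_under_sel by auto
    have b: "(Q2, R2, g2) \<in> FinPt_inert" "Q = Q2" "t3 = (P, R2, compose (fst P) g2 f)"
      using u unfolding eu u1 el_under_sel by auto
    have R: "R2 = R" "compose (fst P) g f = compose (fst P) g2 f" using a(4) b(3) by simp_all
    have "g = g2" by (rule FinPt_inert_epi[OF a(1) _ _ R(2)]) (use a b R(1) in \<open>auto simp: FinPt_inert_iff\<close>)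
    then show ?thesis using a b R u1 by (simp add: et eu)
  qed
  show "pt_label (Src ?D t) = pt_label (Tgt ?D t)" if t: "t \<in> Arr ?D" for t
  proof -
    obtain P Q f Q1 R g t3 where et: "t = ((P, Q, f), (Q1, R, g), t3)" by (metis prod_cases3)
    have a: "(P, Q, f) \<in> FinPt_inert" "(Q1, R, g) \<in> FinPt_inert" "Q = Q1" "t3 = (P, R, compose (fst P) g f)"
      "Q \<in> Elem FinPt_flat" "R \<in> Elem FinPt_flat"
      using t unfolding et el_under_sel by auto
    have Q: "isomorphic FinPt Q (std_pset 1)" "isomorphic FinPt R (std_pset 1)" using a by (auto simp: Elem_pset iso_closure_def)
    obtain q where q: "fst Q = {q, snd Q}" "q \<noteq> snd Q" using Q(1) by (rule elementary_pset)
    obtain r where r: "fst R = {r, snd R}" "r \<noteq> snd R" using Q(2) by (rule elementary_pset)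
    have gA: "(Q, R, g) \<in> Arr FinPt" and fA: "(P, Q, f) \<in> Arr FinPt" using a(1-3) by (simp_all add: FinPt_inert_iff)
    have gb: "g (snd Q) = snd R" using gA by (simp add: FinPt_Arr)
    obtain b where b: "b \<in> fst Q" "g b = r" using FinPt_inert_surj[of Q R g r] a(2,3) r(1) by auto
    have gq: "g q = r" using b q gb r(2) by auto
    have "g (f c) \<noteq> snd R \<longleftrightarrow> f c \<noteq> snd Q" if "c \<in> fst P" for c
    proof -
      have "f c \<in> {q, snd Q}" using fA that q(1) by (auto simp: FinPt_Arr dest: PiE_mem)
      then show ?thesis using gq gb q(2) r(2) by auto
    qed
    then show ?thesis using a(4) by (auto simp: et pt_label_def compose_def)
  qed
  show "\<exists>c\<in>Obj ?C. pt_label (FOb (under_fctr vertex_functor) c) = pt_label d" if d: "d \<in> Obj ?D" for d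
  proof -
    obtain P Q f where ed: "d = (P, Q, f)" by (cases d)
    have P: "P = verts_plus G" and f: "(P, Q, f) \<in> FinPt_inert" "Q \<in> Elem FinPt_flat" using d by (auto simp: ed)
    have Q: "isomorphic FinPt Q (std_pset 1)" using f by (auto simp: Elem_pset iso_closure_def)
    obtain q where q: "fst Q = {q, snd Q}" "q \<noteq> snd Q" using Q by (rule elementary_pset)
    have "bij_betw f {a \<in> fst P. f a \<noteq> snd Q} (fst Q - {snd Q})" using f(1) by (simp add: FinPt_inert_iff)
    moreover have "fst Q - {snd Q} = {q}" using q by auto
    ultimately have "card {a \<in> fst P. f a \<noteq> snd Q} = 1" using bij_betw_same_card by fastforce
    then obtain a where a: "{a \<in> fst P. f a \<noteq> snd Q} = {a}" by (auto simp: card_1_singleton_iff)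
    have fb: "f None = snd Q" using f(1) P by (simp add: FinPt_inert_iff FinPt_Arr)
    have aP: "a \<in> fst P" "f a \<noteq> snd Q" using a by blast+
    then obtain v where v: "a = Some v" "v \<in> Verts G" using P fb by auto
    note ve = vert_emb[OF G v(2)]
    obtain e n where e: "e \<in> vert_emb G v" "edom e = star_graph n" using ve(1) by (auto simp: star_embs_def)
    have em: "is_embedding G e" "vert_emb G v = emb_class G e" using Emb_memD[OF ve(2) e(1)] by simp_all
    let ?i = "inert_of G e"
    have "?i \<in> Obj ?C" using inert_of_ginert[OF em(1)] e(2) star_Elem[of n] by simp
    moreover have "pt_label (FAr vertex_functor ?i) = {Some v}"
      by (rule pt_label_vertex[OF inert_of_ginert[OF em(1)]]) (use inert_of_id[OF em(1)] em(2) v(2) in simp_all)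
    moreover have "pt_label d = {Some v}" using a v by (simp add: ed pt_label_def)
    ultimately show ?thesis unfolding uo by (intro bexI[of _ ?i]) simp
  qed
qed

theorem lemma3p6p13:
  shows "pattern_morphism Uop_natural FinPt_natural vertex_functor \<and>
    enrichable_pattern Uop_natural vertex_functor"
proof -
  have "cartesian_pattern Uflat vertex_functor"
    unfolding cartesian_pattern_def using Uflat_pattern Uflat_morphism Uflat_el_equivalence by simp
  then show ?thesis unfolding enrichable_pattern_def using Uop_morphism Uop_pattern by blast
qed

end
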